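(* The Roe algebra $\ell^\infty(G,\mathcal{K}) \rtimes G$ of any locally finite group $G$ is stably finite. Moreover, for each non-zero projection $p \in \ell^\infty(G,\mathcal{K})$ there exists a lower semi-continuous trace $\tau \in T^+(\ell^\infty(G,\mathcal{K}) \rtimes G)$ with $\tau(p)=1$, and hence a $G$-invariant lower semi-continuous trace on $\ell^\infty(G,\mathcal{K})$ taking the value $1$ at $p$.
   Context: $\mathcal{K}$ is the $C^*$-algebra of compact operators on a separable infinite dimensional Hilbert space, and $\ell^\infty(G,\mathcal{K})$ is the $C^*$-algebra of bounded functions $G \to \mathcal{K}$, with $G$ (discrete) acting by left-translation; $\ell^\infty(G,\mathcal{K}) \rtimes G$ is the reduced crossed product. A group is locally finite if each finitely generated subgroup is finite. A $C^*$-algebra $\mathcal{A}$ is stably finite if $\mathcal{A} \otimes \mathcal{K}$ contains no infinite projection (a projection is infinite if it is Murray–von Neumann equivalent to a proper subprojection of itself). $T^+(\mathcal{A})$ is the cone of additive, (positively) homogeneous maps $\tau \colon \mathcal{A}^+ \to [0,\infty]$ with $\tau(x^*x)=\tau(xx^* )$ for all $x \in \mathcal{A}$; such $\tau$ is lower semi-continuous if $\tau(a) = \sup_{\varepsilon>0}\tau((a-\varepsilon)_+)$ for all $a \in \mathcal{A}^+$. The trace on $\ell^\infty(G,\mathcal{K})$ in the last assertion is an element of $T^+(\ell^\infty(G,\mathcal{K}))$. *)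

theory Defs
  imports "HOL-Analysis.Analysis" "HOL-Computational_Algebra.Polynomial"
begin

section \<open>Complex Hilbert spaces\<close>

class complex_inner = real_inner +
  fixes scaleC :: "complex \<Rightarrow> 'a \<Rightarrow> 'a" (infixr "*\<^sub>C" 75)
    and cinner :: "'a \<Rightarrow> 'a \<Rightarrow> complex"
  assumes scaleC_add_right: "c *\<^sub>C (x + y) = c *\<^sub>C x + c *\<^sub>C y"
    and scaleC_add_left: "(c + d) *\<^sub>C x = c *\<^sub>C x + d *\<^sub>C x"
    and scaleC_scaleC: "c *\<^sub>C d *\<^sub>C x = (c * d) *\<^sub>C x"
    and scaleR_scaleC: "r *\<^sub>R x = complex_of_real r *\<^sub>C x"
    and cinner_commute: "cinner x y = cnj (cinner y x)"
    and cinner_add_left: "cinner (x + y) z = cinner x z + cinner y z"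
    and cinner_scaleC_left: "cinner (c *\<^sub>C x) y = c * cinner x y"
    and inner_eq_Re_cinner: "inner x y = Re (cinner x y)"

text \<open>The norm is the one of the underlying real inner product space; it is the norm of
  \<^term>\<open>cinner\<close>, because the real inner product is the real part of the complex one.\<close>

class chilbert_space = complex_inner + complete_space

instantiation complex :: chilbert_space
begin

definition scaleC_complex :: "complex \<Rightarrow> complex \<Rightarrow> complex"
  where "scaleC_complex c x = c * x"

definition cinner_complex :: "complex \<Rightarrow> complex \<Rightarrow> complex"
  where "cinner_complex x y = x * cnj y"

instance
  by standard (auto simp: scaleC_complex_def cinner_complex_def inner_complex_def
      scaleR_conv_of_real algebra_simps)

end

lemma cinner_self: "cinner x x = complex_of_real ((norm (x::'a::complex_inner))\<^sup>2)"
proof (rule complex_eqI)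
  show "Re (cinner x x) = Re (complex_of_real ((norm x)\<^sup>2))"
    by (simp add: inner_eq_Re_cinner [symmetric] power2_norm_eq_inner)
  show "Im (cinner x x) = Im (complex_of_real ((norm x)\<^sup>2))"
    using arg_cong [OF cinner_commute [of x x], of Im] by simp
qed

lemma norm_scaleC: "norm (c *\<^sub>C (x::'a::complex_inner)) = cmod c * norm x"
proof -
  have "cinner (c *\<^sub>C x) (c *\<^sub>C x) = c * cnj c * cinner x x"
    by (subst cinner_scaleC_left, subst cinner_commute, subst cinner_scaleC_left)
      (simp add: cinner_self)
  then have "complex_of_real ((norm (c *\<^sub>C x))\<^sup>2) = complex_of_real ((cmod c * norm x)\<^sup>2)"
    unfolding cinner_self by (simp add: complex_norm_square [symmetric] power_mult_distrib)
  then have "(norm (c *\<^sub>C x))\<^sup>2 = (cmod c * norm x)\<^sup>2"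
    by (simp only: of_real_eq_iff)
  then show ?thesis
    by (simp add: power2_eq_iff_nonneg)
qed

lemma cmod_cinner_le: "cmod (cinner x y) \<le> norm x * norm (y::'a::complex_inner)"
proof (cases "cinner x y = 0")
  case False
  define c where "c = cnj (sgn (cinner x y))"
  have c: "cmod c = 1" using False by (simp add: c_def norm_sgn)
  have "cinner (c *\<^sub>C x) y = complex_of_real (cmod (cinner x y))"
    using False
    by (simp add: cinner_scaleC_left c_def sgn_div_norm scaleR_conv_of_real field_simps
        complex_norm_square [symmetric] power2_eq_square)
  then have "cmod (cinner x y) = inner (c *\<^sub>C x) y"
    by (simp add: inner_eq_Re_cinner)
  also have "\<dots> \<le> norm (c *\<^sub>C x) * norm y" by (rule norm_cauchy_schwarz)
  finally show ?thesis by (simp add: norm_scaleC c)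
qed simp

section \<open>The Hilbert space of square-summable families of vectors\<close>

typedef (overloaded) ('i, 'h) l2 =
  "{f :: 'i \<Rightarrow> 'h::complex_inner. (\<lambda>i. (norm (f i))\<^sup>2) summable_on UNIV}"
  morphisms l2_apply Abs_l2
  by (rule exI [of _ "\<lambda>_. 0"]) simp

setup_lifting type_definition_l2

lemma l2_summable: "(\<lambda>i. (norm (l2_apply f i))\<^sup>2) summable_on UNIV"
  using l2_apply [of f] by simp

lemma l2_eqI: "(\<And>i. l2_apply f i = l2_apply g i) \<Longrightarrow> f = g"
  by (simp add: l2_apply_inject [symmetric] fun_eq_iff)

lemma norm_add_sq_le: "(norm (x + y))\<^sup>2 \<le> 2 * (norm x)\<^sup>2 + 2 * (norm (y::'a::real_normed_vector))\<^sup>2"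
proof -
  have "(norm (x + y))\<^sup>2 \<le> (norm x + norm y)\<^sup>2"
    by (intro power_mono norm_triangle_ineq) simp
  also have "\<dots> \<le> 2 * (norm x)\<^sup>2 + 2 * (norm y)\<^sup>2"
    using zero_le_power2 [of "norm x - norm y"] by (simp add: power2_eq_square algebra_simps)
  finally show ?thesis .
qed

lemma sq_summable_add:
  fixes f g :: "'i \<Rightarrow> 'h::real_normed_vector"
  assumes "(\<lambda>i. (norm (f i))\<^sup>2) summable_on UNIV" "(\<lambda>i. (norm (g i))\<^sup>2) summable_on UNIV"
  shows "(\<lambda>i. (norm (f i + g i))\<^sup>2) summable_on UNIV"
  by (rule summable_on_comparison_test
      [where f = "\<lambda>i. 2 * (norm (f i))\<^sup>2 + 2 * (norm (g i))\<^sup>2"])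
    (auto intro!: summable_on_add summable_on_cmult_right assms norm_add_sq_le)

lemma sq_summable_scale:
  fixes f g :: "'i \<Rightarrow> 'h::real_normed_vector"
  assumes "(\<lambda>i. (norm (f i))\<^sup>2) summable_on UNIV" "\<And>i. norm (g i) \<le> c * norm (f i)"
  shows "(\<lambda>i. (norm (g i))\<^sup>2) summable_on UNIV"
proof (rule summable_on_comparison_test [where f = "\<lambda>i. c\<^sup>2 * (norm (f i))\<^sup>2"])
  show "(norm (g i))\<^sup>2 \<le> c\<^sup>2 * (norm (f i))\<^sup>2" for i
    using power_mono [OF assms(2) [of i], of 2] by (simp add: power_mult_distrib)
qed (auto intro!: summable_on_cmult_right assms(1))

lemma cinner_abs_summable:
  "(\<lambda>i. norm (cinner (l2_apply f i) (l2_apply g i))) summable_on UNIV"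
proof (rule summable_on_comparison_test
    [where f = "\<lambda>i. (norm (l2_apply f i))\<^sup>2 + (norm (l2_apply g i))\<^sup>2"])
  fix i
  have "2 * (norm (l2_apply f i) * norm (l2_apply g i))
      \<le> (norm (l2_apply f i))\<^sup>2 + (norm (l2_apply g i))\<^sup>2"
    using zero_le_power2 [of "norm (l2_apply f i) - norm (l2_apply g i)"]
    by (simp add: power2_eq_square algebra_simps)
  moreover have "0 \<le> norm (l2_apply f i) * norm (l2_apply g i)" by simp
  ultimately show "norm (cinner (l2_apply f i) (l2_apply g i))
      \<le> (norm (l2_apply f i))\<^sup>2 + (norm (l2_apply g i))\<^sup>2"
    using cmod_cinner_le [of "l2_apply f i" "l2_apply g i"] by linarith
qed (auto intro!: summable_on_add l2_summable)

lemma cinner_summable: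
  "(\<lambda>i. cinner (l2_apply f i) (l2_apply g i)) summable_on UNIV"
  by (rule abs_summable_summable [OF cinner_abs_summable])

instantiation l2 :: (type, complex_inner) complex_inner
begin

lift_definition zero_l2 :: "('a, 'b) l2" is "\<lambda>_. 0" by simp

lift_definition plus_l2 :: "('a, 'b) l2 \<Rightarrow> ('a, 'b) l2 \<Rightarrow> ('a, 'b) l2"
  is "\<lambda>f g i. f i + g i" by (rule sq_summable_add)

lift_definition uminus_l2 :: "('a, 'b) l2 \<Rightarrow> ('a, 'b) l2" is "\<lambda>f i. - f i" by simp

definition minus_l2 :: "('a, 'b) l2 \<Rightarrow> ('a, 'b) l2 \<Rightarrow> ('a, 'b) l2"
  where "minus_l2 f g = f + (- g)"

lift_definition scaleR_l2 :: "real \<Rightarrow> ('a, 'b) l2 \<Rightarrow> ('a, 'b) l2"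
  is "\<lambda>r f i. r *\<^sub>R f i" by (erule sq_summable_scale) (rule eq_refl, rule norm_scaleR)

lift_definition scaleC_l2 :: "complex \<Rightarrow> ('a, 'b) l2 \<Rightarrow> ('a, 'b) l2"
  is "\<lambda>c f i. c *\<^sub>C f i" by (erule sq_summable_scale) (rule eq_refl, rule norm_scaleC)

definition cinner_l2 :: "('a, 'b) l2 \<Rightarrow> ('a, 'b) l2 \<Rightarrow> complex"
  where "cinner_l2 f g = (\<Sum>\<^sub>\<infinity>i. cinner (l2_apply f i) (l2_apply g i))"

definition inner_l2 :: "('a, 'b) l2 \<Rightarrow> ('a, 'b) l2 \<Rightarrow> real"
  where "inner_l2 f g = Re (cinner f g)"

definition norm_l2 :: "('a, 'b) l2 \<Rightarrow> real"
  where "norm_l2 f = sqrt (inner f f)"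

definition sgn_l2 :: "('a, 'b) l2 \<Rightarrow> ('a, 'b) l2"
  where "sgn_l2 f = inverse (norm f) *\<^sub>R f"

definition dist_l2 :: "('a, 'b) l2 \<Rightarrow> ('a, 'b) l2 \<Rightarrow> real"
  where "dist_l2 f g = norm (f - g)"

definition uniformity_l2 :: "(('a, 'b) l2 \<times> ('a, 'b) l2) filter"
  where "uniformity_l2 = (INF e\<in>{0<..}. principal {(x, y). dist x y < e})"

definition open_l2 :: "('a, 'b) l2 set \<Rightarrow> bool"
  where "open_l2 U \<longleftrightarrow> (\<forall>x\<in>U. eventually (\<lambda>(x', y). x' = x \<longrightarrow> y \<in> U) uniformity)"

lemma inner_l2_self:
  "inner f f = (\<Sum>\<^sub>\<infinity>i. (norm (l2_apply f i))\<^sup>2)" for f :: "('a, 'b) l2"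
  unfolding inner_l2_def cinner_l2_def
  by (subst infsum_Re [symmetric, OF cinner_summable]) (simp add: cinner_self del: of_real_power)

instance
proof
  fix f g h :: "('a, 'b) l2" and r s :: real and c d :: complex
  show "f + g + h = f + (g + h)" "f + g = g + f" "0 + f = f" "- f + f = 0"
    by (transfer, simp add: algebra_simps)+
  show "f - g = f + - g" by (rule minus_l2_def)
  show "r *\<^sub>R (f + g) = r *\<^sub>R f + r *\<^sub>R g" "(r + s) *\<^sub>R f = r *\<^sub>R f + s *\<^sub>R f"
    "r *\<^sub>R s *\<^sub>R f = (r * s) *\<^sub>R f" "1 *\<^sub>R f = f"
    by (transfer, simp add: algebra_simps)+
  show "c *\<^sub>C (f + g) = c *\<^sub>C f + c *\<^sub>C g" "(c + d) *\<^sub>C f = c *\<^sub>C f + d *\<^sub>C f"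
    "c *\<^sub>C d *\<^sub>C f = (c * d) *\<^sub>C f" "r *\<^sub>R f = complex_of_real r *\<^sub>C f"
    by (transfer, simp add: scaleC_add_right scaleC_add_left scaleC_scaleC scaleR_scaleC)+
  show "sgn f = inverse (norm f) *\<^sub>R f" by (rule sgn_l2_def)
  show "dist f g = norm (f - g)" by (rule dist_l2_def)
  show "(uniformity :: (('a, 'b) l2 \<times> ('a, 'b) l2) filter)
      = (INF e\<in>{0<..}. principal {(x, y). dist x y < e})" by (rule uniformity_l2_def)
  show "open U = (\<forall>x\<in>U. \<forall>\<^sub>F (x', y) in uniformity. x' = x \<longrightarrow> y \<in> U)"
    for U :: "('a, 'b) l2 set" by (rule open_l2_def)
  show comm: "cinner f g = cnj (cinner g f)" for f g :: "('a, 'b) l2"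
    unfolding cinner_l2_def infsum_cnj [symmetric] by (subst cinner_commute) simp
  show add: "cinner (f + g) h = cinner f h + cinner g h"
    unfolding cinner_l2_def
    by (subst infsum_add [symmetric, OF cinner_summable cinner_summable])
      (simp add: plus_l2.rep_eq cinner_add_left)
  show scale: "cinner (c *\<^sub>C f) g = c * cinner f g" for c :: complex
    unfolding cinner_l2_def
    by (subst infsum_cmult_right' [symmetric]) (simp add: scaleC_l2.rep_eq cinner_scaleC_left)
  show "inner f g = Re (cinner f g)" by (rule inner_l2_def)
  show "inner f g = inner g f" unfolding inner_l2_def by (subst comm) simp
  show "inner (f + g) h = inner f h + inner g h" unfolding inner_l2_def add by simp
  show "inner (r *\<^sub>R f) g = r * inner f g"
  proof -
    have "r *\<^sub>R f = complex_of_real r *\<^sub>C f" by transfer (simp add: scaleR_scaleC)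
    then show ?thesis unfolding inner_l2_def by (simp add: scale)
  qed
  show "0 \<le> inner f f" unfolding inner_l2_self by (rule infsum_nonneg) simp
  show "norm f = sqrt (inner f f)" by (rule norm_l2_def)
  show "inner f f = 0 \<longleftrightarrow> f = 0"
  proof
    assume "inner f f = 0"
    then have z: "(\<Sum>\<^sub>\<infinity>i. (norm (l2_apply f i))\<^sup>2) = 0" by (simp add: inner_l2_self)
    have "(norm (l2_apply f i))\<^sup>2 = 0" for i
      by (rule nonneg_infsum_le_0D [where A = UNIV]) (use z l2_summable in auto)
    then show "f = 0" by (intro l2_eqI) (simp add: zero_l2.rep_eq)
  next
    assume "f = 0"
    then show "inner f f = 0" by (simp add: inner_l2_self zero_l2.rep_eq)
  qed
qed

end

lemma norm_l2_sq: "(norm f)\<^sup>2 = (\<Sum>\<^sub>\<infinity>i. (norm (l2_apply f i))\<^sup>2)"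
  by (simp add: power2_norm_eq_inner inner_l2_self)

lemma l2_apply_add [simp]: "l2_apply (f + g) i = l2_apply f i + l2_apply g i"
  by (simp add: plus_l2.rep_eq)

lemma l2_apply_diff [simp]: "l2_apply (f - g) i = l2_apply f i - l2_apply g i"
  by (simp only: minus_l2_def plus_l2.rep_eq uminus_l2.rep_eq) simp

lemma l2_apply_scaleR [simp]: "l2_apply (r *\<^sub>R f) i = r *\<^sub>R l2_apply f i"
  by (simp add: scaleR_l2.rep_eq)

lemma l2_apply_scaleC [simp]: "l2_apply (c *\<^sub>C f) i = c *\<^sub>C l2_apply f i"
  by (simp add: scaleC_l2.rep_eq)

lemma sum_norm_l2_le: "finite F \<Longrightarrow> (\<Sum>i\<in>F. (norm (l2_apply f i))\<^sup>2) \<le> (norm f)\<^sup>2"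
  unfolding norm_l2_sq by (rule finite_sum_le_infsum) (auto intro: l2_summable)

lemma norm_l2_apply_le: "norm (l2_apply f i) \<le> norm f"
  using sum_norm_l2_le [of "{i}" f] by (simp add: power2_le_iff_abs_le)

instance l2 :: (type, chilbert_space) chilbert_space
proof
  fix X :: "nat \<Rightarrow> ('a, 'b) l2"
  assume X: "Cauchy X"
  have "Cauchy (\<lambda>n. l2_apply (X n) i)" for i
    unfolding Cauchy_iff
  proof (intro allI impI)
    fix e :: real assume "0 < e"
    then obtain M where M: "\<And>m n. m \<ge> M \<Longrightarrow> n \<ge> M \<Longrightarrow> norm (X m - X n) < e"
      using X unfolding Cauchy_iff by blast
    have "norm (l2_apply (X m) i - l2_apply (X n) i) < e" if "m \<ge> M" "n \<ge> M" for m n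
      using norm_l2_apply_le [of "X m - X n" i] M [OF that] by simp
    then show "\<exists>M. \<forall>m\<ge>M. \<forall>n\<ge>M. norm (l2_apply (X m) i - l2_apply (X n) i) < e"
      by blast
  qed
  then have "\<exists>l. (\<lambda>n. l2_apply (X n) i) \<longlonglongrightarrow> l" for i
    unfolding convergent_def [symmetric] by (rule Cauchy_convergent)
  then obtain l where l: "\<And>i. (\<lambda>n. l2_apply (X n) i) \<longlonglongrightarrow> l i" by metis
  have bound: "(\<Sum>i\<in>F. (norm (l2_apply (X n) i - l i))\<^sup>2) \<le> e\<^sup>2"
    if "finite F" and M: "\<And>m. m \<ge> M \<Longrightarrow> norm (X n - X m) < e" for F n M e
  proof (rule LIMSEQ_le_const2)
    show "(\<lambda>m. \<Sum>i\<in>F. (norm (l2_apply (X n) i - l2_apply (X m) i))\<^sup>2)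
        \<longlonglongrightarrow> (\<Sum>i\<in>F. (norm (l2_apply (X n) i - l i))\<^sup>2)"
      by (intro tendsto_intros l)
    show "\<exists>N. \<forall>m\<ge>N. (\<Sum>i\<in>F. (norm (l2_apply (X n) i - l2_apply (X m) i))\<^sup>2) \<le> e\<^sup>2"
    proof (intro exI [of _ M] allI impI)
      fix m assume "M \<le> m"
      have "(\<Sum>i\<in>F. (norm (l2_apply (X n) i - l2_apply (X m) i))\<^sup>2) \<le> (norm (X n - X m))\<^sup>2"
        using sum_norm_l2_le [OF \<open>finite F\<close>, of "X n - X m"] by simp
      also have "\<dots> \<le> e\<^sup>2" using M [OF \<open>M \<le> m\<close>] by (intro power_mono) auto
      finally show "(\<Sum>i\<in>F. (norm (l2_apply (X n) i - l2_apply (X m) i))\<^sup>2) \<le> e\<^sup>2" .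
    qed
  qed
  have summable: "(\<lambda>i. (norm (l2_apply (X n) i - l i))\<^sup>2) summable_on UNIV"
    if M: "\<And>m. m \<ge> M \<Longrightarrow> norm (X n - X m) < e" for n M e
    by (rule nonneg_bdd_above_summable_on)
      (auto intro!: bdd_aboveI2 [where M = "e\<^sup>2"] bound [OF _ M])
  obtain M1 where M1: "\<And>m n. m \<ge> M1 \<Longrightarrow> n \<ge> M1 \<Longrightarrow> norm (X m - X n) < 1"
    using X [unfolded Cauchy_iff, rule_format, of 1] by auto
  have "(\<lambda>i. (norm (l2_apply (X M1) i - l i))\<^sup>2) summable_on UNIV"
    by (rule summable [of M1 _ 1]) (use M1 in auto)
  then have "(\<lambda>i. (norm (l i - l2_apply (X M1) i))\<^sup>2) summable_on UNIV"
    by (simp add: norm_minus_commute)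
  from sq_summable_add [OF this l2_summable [of "X M1"]]
  have "(\<lambda>i. (norm (l i))\<^sup>2) summable_on UNIV" by simp
  then have L: "l2_apply (Abs_l2 l) = l" by (simp add: Abs_l2_inverse)
  have "X \<longlonglongrightarrow> Abs_l2 l"
    unfolding LIMSEQ_iff
  proof (intro allI impI)
    fix e :: real assume "0 < e"
    then obtain M where M: "\<And>m n. m \<ge> M \<Longrightarrow> n \<ge> M \<Longrightarrow> norm (X m - X n) < e / 2"
      using X [unfolded Cauchy_iff, rule_format, of "e / 2"] by auto
    show "\<exists>M. \<forall>n\<ge>M. norm (X n - Abs_l2 l) < e"
    proof (intro exI [of _ M] allI impI)
      fix n assume n: "M \<le> n"
      have "(norm (X n - Abs_l2 l))\<^sup>2 \<le> (e / 2)\<^sup>2"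
        unfolding norm_l2_sq l2_apply_diff L
        by (rule infsum_le_finite_sums [OF summable [of M n "e/2"] bound [of _ M]]) (use M n in auto)
      then have "norm (X n - Abs_l2 l) \<le> e / 2"
        using \<open>0 < e\<close> by (simp add: power2_le_iff_abs_le)
      then show "norm (X n - Abs_l2 l) < e" using \<open>0 < e\<close> by simp
    qed
  qed
  then show "convergent X" by (auto simp: convergent_def)
qed

section \<open>Operators\<close>

type_synonym 'h operator = "'h \<Rightarrow>\<^sub>L 'h"

text \<open>\<^typ>\<open>'h operator\<close> consists of the bounded real-linear maps, with the operator norm.\<close>

definition bounded_ops :: "'h::complex_inner operator set"
  where "bounded_ops = {T :: 'h operator. \<forall>c x. T (c *\<^sub>C x) = c *\<^sub>C T x}"

definition adj :: "'h::complex_inner operator \<Rightarrow> 'h operator"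
  where "adj T = (THE S :: 'h operator. \<forall>x y. cinner (T x) y = cinner x (S y))"

definition compact_ops :: "'h::complex_inner operator set"
  where "compact_ops = {T \<in> bounded_ops. compact (closure (T ` cball 0 1))}"

section \<open>Projections, stable finiteness\<close>

text \<open>From here on a \<open>C\<^sup>*\<close>-algebra is a norm-closed \<open>*\<close>-subalgebra \<open>A\<close> of
  \<^const>\<open>bounded_ops\<close> on some Hilbert space.\<close>

definition projections :: "'h::complex_inner operator set \<Rightarrow> 'h operator set"
  where "projections A = {p \<in> A. p o\<^sub>L p = p \<and> adj p = p}"

definition murray_von_neumann_equiv ::
    "'h::complex_inner operator set \<Rightarrow> 'h operator \<Rightarrow> 'h operator \<Rightarrow> bool"
  where "murray_von_neumann_equiv A p q \<longleftrightarrow> (\<exists>v\<in>A. adj v o\<^sub>L v = p \<and> v o\<^sub>L adj v = q)"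

definition infinite_projection :: "'h::complex_inner operator set \<Rightarrow> 'h operator \<Rightarrow> bool"
  where "infinite_projection A p \<longleftrightarrow> p \<in> projections A \<and>
    (\<exists>q\<in>projections A. p o\<^sub>L q = q \<and> q \<noteq> p \<and> murray_von_neumann_equiv A p q)"

definition l2_tensor :: "('i, complex) l2 \<Rightarrow> 'h::complex_inner \<Rightarrow> ('i, 'h) l2"
  where "l2_tensor \<xi> h = Abs_l2 (\<lambda>i. l2_apply \<xi> i *\<^sub>C h)"

text \<open>\<open>a \<otimes> k\<close> on \<open>H \<otimes> \<ell>\<^sup>2(I) = \<ell>\<^sup>2(I, H)\<close>.\<close>

definition op_tensor ::
    "'h::complex_inner operator \<Rightarrow> ('i, complex) l2 operator \<Rightarrow> ('i, 'h) l2 operator"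
  where "op_tensor a k = (THE T :: ('i, 'h) l2 operator. \<forall>\<xi> h. T (l2_tensor \<xi> h) = l2_tensor (k \<xi>) (a h))"

text \<open>\<open>A \<otimes> \<K>\<close>, as the spatial tensor product; all \<open>C\<^sup>*\<close>-tensor norms agree because \<open>\<K>\<close> is nuclear.\<close>

definition stabilization :: "'h::complex_inner operator set \<Rightarrow> (nat, 'h) l2 operator set"
  where "stabilization A =
    closure {\<Sum>i<n. op_tensor (a i) (k i) | (n::nat) a k. \<forall>i<n. a i \<in> A \<and> k i \<in> compact_ops}"

definition stably_finite :: "'h::complex_inner operator set \<Rightarrow> bool"
  where "stably_finite A \<longleftrightarrow> \<not> (\<exists>p. infinite_projection (stabilization A) p)"

section \<open>Functional calculus and traces\<close>

definition spectrum :: "'h::complex_inner operator \<Rightarrow> complex set"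
  where "spectrum T = {z. \<not> (\<exists>S\<in>bounded_ops.
    \<forall>x. S (T x - z *\<^sub>C x) = x \<and> T (S x) - z *\<^sub>C S x = x)}"

definition op_poly :: "real poly \<Rightarrow> 'h::complex_inner operator \<Rightarrow> 'h operator"
  where "op_poly p T = (\<Sum>i\<le>degree p. coeff p i *\<^sub>R (((o\<^sub>L) T ^^ i) id_blinfun))"

text \<open>\<open>f(T)\<close> for self-adjoint \<open>T\<close> and continuous \<open>f\<close>: the norm limit of \<open>p\<^sub>n(T)\<close> for any
  polynomials \<open>p\<^sub>n\<close> converging to \<open>f\<close> uniformly on the spectrum of \<open>T\<close>.\<close>

definition fun_calc :: "(real \<Rightarrow> real) \<Rightarrow> 'h::complex_inner operator \<Rightarrow> 'h operator"
  where "fun_calc f T = (THE S. \<forall>p :: nat \<Rightarrow> real poly.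
    uniform_limit {t. complex_of_real t \<in> spectrum T} (\<lambda>n. poly (p n)) f sequentially
      \<longrightarrow> (\<lambda>n. op_poly (p n) T) \<longlonglongrightarrow> S)"

text \<open>\<open>(a - \<epsilon>)\<^sub>+\<close>. Since the function vanishes at \<open>0\<close> when \<open>\<epsilon> > 0\<close>, the result lies in every
  \<open>C\<^sup>*\<close>-algebra containing \<open>a\<close>, unital or not.\<close>

definition cut_down :: "'h::complex_inner operator \<Rightarrow> real \<Rightarrow> 'h operator"
  where "cut_down a \<epsilon> = fun_calc (\<lambda>t. max (t - \<epsilon>) 0) a"

definition pos_cone :: "'h::complex_inner operator set \<Rightarrow> 'h operator set"
  where "pos_cone A = {adj x o\<^sub>L x | x. x \<in> A}"

text \<open>\<open>T\<^sup>+(A)\<close>. Only the values of \<open>\<tau>\<close> on \<open>A\<^sup>+\<close> are relevant. In \<^typ>\<open>ennreal\<close> we have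
  \<open>0 * \<infinity> = 0\<close>, so that \<open>\<tau> 0 = 0\<close>.\<close>

definition traces :: "'h::complex_inner operator set \<Rightarrow> ('h operator \<Rightarrow> ennreal) set"
  where "traces A = {\<tau>.
    (\<forall>a\<in>pos_cone A. \<forall>b\<in>pos_cone A. \<tau> (a + b) = \<tau> a + \<tau> b) \<and>
    (\<forall>r\<ge>0. \<forall>a\<in>pos_cone A. \<tau> (r *\<^sub>R a) = ennreal r * \<tau> a) \<and>
    (\<forall>x\<in>A. \<tau> (adj x o\<^sub>L x) = \<tau> (x o\<^sub>L adj x))}"

definition lower_semicontinuous_trace ::
    "'h::complex_inner operator set \<Rightarrow> ('h operator \<Rightarrow> ennreal) \<Rightarrow> bool"
  where "lower_semicontinuous_trace A \<tau> \<longleftrightarrow> \<tau> \<in> traces A \<and>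
    (\<forall>a\<in>pos_cone A. \<tau> a = (SUP \<epsilon>\<in>{0<..}. \<tau> (cut_down a \<epsilon>)))"

section \<open>Groups and reduced crossed products\<close>

text \<open>A group is a type of class \<^class>\<open>group_add\<close>; the operation is written additively but is
  not assumed to be commutative.\<close>

definition generated_subgroup :: "'g::group_add set \<Rightarrow> 'g set"
  where "generated_subgroup S = (\<lambda>H. 0 \<in> H \<and> (\<forall>x\<in>H. \<forall>y\<in>H. x + y \<in> H) \<and> (\<forall>x\<in>H. - x \<in> H)) hull S"

definition locally_finite_group :: "'g::group_add itself \<Rightarrow> bool"
  where "locally_finite_group _ \<longleftrightarrow> (\<forall>S :: 'g set. finite S \<longrightarrow> finite (generated_subgroup S))"

definition diag_op :: "('i \<Rightarrow> 'h::complex_inner operator) \<Rightarrow> ('i, 'h) l2 operator"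
  where "diag_op a = (THE T :: ('i, 'h) l2 operator. \<forall>\<xi> i. l2_apply (T \<xi>) i = a i (l2_apply \<xi> i))"

definition shift_op :: "'g::group_add \<Rightarrow> ('g, 'h::complex_inner) l2 operator"
  where "shift_op s = (THE T :: ('g, 'h) l2 operator. \<forall>\<xi> t. l2_apply (T \<xi>) t = l2_apply \<xi> (- s + t))"

lemma blinfun_l2_eqI:
  fixes S T :: "('i, 'h::complex_inner) l2 operator"
  shows "(\<And>\<xi> i. l2_apply (S \<xi>) i = l2_apply (T \<xi>) i) \<Longrightarrow> S = T"
  by (rule blinfun_eqI, rule l2_eqI) blast

lemma diag_op_apply:
  fixes a :: "'i \<Rightarrow> 'h::complex_inner operator"
  assumes "bounded (range a)"
  shows "l2_apply (diag_op a \<xi>) i = a i (l2_apply \<xi> i)"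
proof -
  obtain K where K: "\<And>i. norm (a i) \<le> K" using assms by (auto simp: bounded_iff)
  have le: "norm (a i x) \<le> K * norm x" for i x
    by (rule order_trans [OF norm_blinfun mult_right_mono [OF K norm_ge_zero]])
  have K0: "0 \<le> K" by (rule order_trans [OF norm_ge_zero K [of undefined]])
  define T where "T \<xi> = Abs_l2 (\<lambda>i. a i (l2_apply \<xi> i))" for \<xi>
  have T: "l2_apply (T \<xi>) i = a i (l2_apply \<xi> i)" for \<xi> i
    unfolding T_def by (subst Abs_l2_inverse) (auto intro: sq_summable_scale [OF l2_summable le])
  have "bounded_linear T"
  proof (rule bounded_linear_intro [where K = K])
    show "T (x + y) = T x + T y" "T (r *\<^sub>R x) = r *\<^sub>R T x" for x y r
      by (auto intro!: l2_eqI simp: T blinfun.bilinear_simps)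
    fix x
    have "(norm (T x))\<^sup>2 \<le> (norm x * K)\<^sup>2"
      unfolding norm_l2_sq [of "T x"]
    proof (rule infsum_le_finite_sums [OF l2_summable])
      fix F :: "'i set" assume "finite F"
      have "(\<Sum>i\<in>F. (norm (l2_apply (T x) i))\<^sup>2) \<le> (\<Sum>i\<in>F. K\<^sup>2 * (norm (l2_apply x i))\<^sup>2)"
        unfolding T power_mult_distrib [symmetric] by (intro sum_mono power_mono le) simp
      also have "\<dots> \<le> K\<^sup>2 * (norm x)\<^sup>2"
        unfolding sum_distrib_left [symmetric]
        by (intro mult_left_mono sum_norm_l2_le \<open>finite F\<close>) simp
      finally show "(\<Sum>i\<in>F. (norm (l2_apply (T x) i))\<^sup>2) \<le> (norm x * K)\<^sup>2"
        by (simp add: power_mult_distrib mult.commute)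
    qed
    then show "norm (T x) \<le> norm x * K"
      by (rule power2_le_imp_le) (simp add: K0)
  qed
  then have E: "\<forall>\<xi> i. l2_apply (Blinfun T \<xi>) i = a i (l2_apply \<xi> i)"
    by (simp add: bounded_linear_Blinfun_apply T)
  have "\<forall>\<xi> i. l2_apply (diag_op a \<xi>) i = a i (l2_apply \<xi> i)"
    unfolding diag_op_def
  proof (rule theI [where a = "Blinfun T"], rule E)
    fix S :: "('i, 'h) l2 operator"
    assume S: "\<forall>\<xi> i. l2_apply (S \<xi>) i = a i (l2_apply \<xi> i)"
    show "S = Blinfun T"
      by (rule blinfun_l2_eqI) (simp only: S E)
  qed
  then show ?thesis by (elim allE)
qed

lemma shift_op_apply: "l2_apply (shift_op s \<xi>) t = l2_apply \<xi> (- s + t)"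
  for \<xi> :: "('g::group_add, 'h::complex_inner) l2"
proof -
  have bij: "bij_betw (\<lambda>t. - s + t) UNIV UNIV"
    by (rule bij_betw_byWitness [where f' = "\<lambda>t. s + t"]) (auto simp: add.assoc [symmetric])
  define T :: "('g, 'h) l2 \<Rightarrow> ('g, 'h) l2" where "T \<xi> = Abs_l2 (\<lambda>t. l2_apply \<xi> (- s + t))" for \<xi>
  have T: "l2_apply (T \<xi>) t = l2_apply \<xi> (- s + t)" for \<xi> t
    unfolding T_def
    by (subst Abs_l2_inverse)
      (auto simp: summable_on_reindex_bij_betw [OF bij, of "\<lambda>i. (norm (l2_apply \<xi> i))\<^sup>2"] l2_summable)
  have "bounded_linear T"
  proof (rule bounded_linear_intro [where K = 1])
    show "T (x + y) = T x + T y" "T (r *\<^sub>R x) = r *\<^sub>R T x" for x y r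
      by (auto intro!: l2_eqI simp: T)
    have "(norm (T x))\<^sup>2 = (norm x)\<^sup>2" for x
      unfolding norm_l2_sq T
      by (rule infsum_reindex_bij_betw [OF bij, of "\<lambda>i. (norm (l2_apply x i))\<^sup>2"])
    then show "norm (T x) \<le> norm x * 1" for x by (simp add: power2_eq_iff_nonneg)
  qed
  then have E: "\<forall>\<xi> t. l2_apply (Blinfun T \<xi>) t = l2_apply \<xi> (- s + t)"
    by (simp add: bounded_linear_Blinfun_apply T)
  have "\<forall>\<xi> t. l2_apply ((shift_op s :: ('g, 'h) l2 operator) \<xi>) t = l2_apply \<xi> (- s + t)"
    unfolding shift_op_def
  proof (rule theI [where a = "Blinfun T"], rule E)
    fix S :: "('g, 'h) l2 operator"
    assume S: "\<forall>\<xi> i. l2_apply (S \<xi>) i = l2_apply \<xi> (- s + i)"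
    show "S = Blinfun T"
      by (rule blinfun_l2_eqI) (simp only: S E)
  qed
  then show ?thesis by (elim allE)
qed

text \<open>For an action \<open>\<alpha>\<close> of \<open>G\<close> on \<open>A \<subseteq> B(H)\<close>, the regular representation of \<open>A\<close> on \<open>\<ell>\<^sup>2(G, H)\<close> is
  \<open>(\<pi>(a)\<xi>)(t) = \<alpha>\<^bsub>t\<^sup>-\<^sup>1\<^esub>(a) \<xi>(t)\<close>, and \<open>G\<close> is represented by the translations \<^const>\<open>shift_op\<close>.\<close>

definition regular_rep ::
    "('g::group_add \<Rightarrow> 'h::complex_inner operator \<Rightarrow> 'h operator) \<Rightarrow> 'h operator \<Rightarrow> ('g, 'h) l2 operator"
  where "regular_rep \<alpha> a = diag_op (\<lambda>t. \<alpha> (- t) a)"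

definition reduced_crossed_product ::
    "'h::complex_inner operator set \<Rightarrow> ('g::group_add \<Rightarrow> 'h operator \<Rightarrow> 'h operator)
      \<Rightarrow> ('g, 'h) l2 operator set"
  where "reduced_crossed_product A \<alpha> =
    closure {\<Sum>s\<in>F. regular_rep \<alpha> (a s) o\<^sub>L shift_op s | F a. finite F \<and> (\<forall>s\<in>F. a s \<in> A)}"

text \<open>\<open>\<ell>\<^sup>\<infinity>(G, \<K>(H))\<close>, faithfully represented by diagonal operators on \<open>\<ell>\<^sup>2(G, H)\<close>.\<close>

definition linf_compact :: "('g, 'h::complex_inner) l2 operator set"
  where "linf_compact = {diag_op a | a. bounded (range a) \<and> (\<forall>t. a t \<in> compact_ops)}"

definition left_translation ::
    "'g::group_add \<Rightarrow> ('g, 'h::complex_inner) l2 operator \<Rightarrow> ('g, 'h) l2 operator"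
  where "left_translation s T = shift_op s o\<^sub>L T o\<^sub>L shift_op (- s)"

lemma left_translation_diag_op:
  assumes "bounded (range a)"
  shows "left_translation s (diag_op a) = diag_op (\<lambda>t. a (- s + t))"
proof (rule blinfun_l2_eqI)
  have "bounded (range (\<lambda>t. a (- s + t)))"
    by (rule bounded_subset [OF assms]) auto
  then show "l2_apply (left_translation s (diag_op a) \<xi>) t
      = l2_apply (diag_op (\<lambda>t. a (- s + t)) \<xi>) t" for \<xi> t
    by (simp add: left_translation_def shift_op_apply diag_op_apply assms add.assoc [symmetric])
qed

definition roe_algebra :: "('g::group_add, ('g, 'h::complex_inner) l2) l2 operator set"
  where "roe_algebra = reduced_crossed_product linf_compact left_translation"

end

theory Submission
  imports Defs "HOL-Computational_Algebra.Fundamental_Theorem_Algebra"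
begin

text \<open>
  For a positive operator \<open>a\<close>, a subspace \<open>L\<close> and \<open>\<epsilon> > 0\<close> put \<open>\<phi>\<^bsub>L,\<epsilon>\<^esub>(a) = sup\<^sub>B \<Sum>\<^bsub>b\<in>B\<^esub> (\<langle>a b, b\<rangle> - \<epsilon>)\<close>,
  the supremum running over the finite orthonormal \<open>B \<subseteq> L\<close>. Without any spectral theory one has
  \<open>\<phi>\<^bsub>L,\<epsilon>\<^esub>(a) + \<phi>\<^bsub>L,\<epsilon>\<^esub>(b) \<le> \<phi>\<^bsub>L,\<epsilon>\<^esub>(a + b)\<close> and \<open>\<phi>\<^bsub>L,2\<epsilon>\<^esub>(a + b) \<le> \<phi>\<^bsub>L,\<epsilon>\<^esub>(a) + \<phi>\<^bsub>L,\<epsilon>\<^esub>(b)\<close>, as well as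
  \<open>\<phi>\<^bsub>L,\<epsilon>\<^esub>(y\<^sup>*y) = \<phi>\<^bsub>L,\<epsilon>\<^esub>(yy\<^sup>*)\<close> if \<open>L\<close> is invariant under \<open>y\<close> and \<open>y\<^sup>*\<close>. For a finite subgroup \<open>H\<close> let \<open>L\<^sub>H\<close> be
  the vectors supported on one \<open>H\<close>-orbit at which \<open>p\<close> does not vanish. Every element of the Roe
  algebra is a norm limit of operators leaving \<open>L\<^sub>H\<close> invariant for all large \<open>H\<close>. Divide \<open>\<phi>\<^bsub>L,\<epsilon>\<^esub>\<close> with
  \<open>L = L\<^sub>H\<close> by the rank of \<open>p\<close> on \<open>L\<^sub>H\<close> and pass to a cluster point as \<open>H\<close> grows; the supremum of the
  resulting functionals over \<open>\<epsilon>\<close> is then a trace, and it is lower semicontinuous by construction.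

  Stable finiteness is a dimension count on such finite blocks, on which all operators in question
  are compact.
\<close>

section \<open>Orthonormal sets\<close>

text \<open>The trace is not continuous in the operator norm, whereas locality is available only for
  norm approximants. The cut \<epsilon> repairs this: an error of size \<eta> in the quadratic form
  of an operator is absorbed by raising the cut by \<eta>, and the supremum over all cuts forgets
  the loss. The price is that no single cut is additive; the two one-sided estimates are enough in
  the supremum.

  Local finiteness enters through one fact: finitely many group elements generate a finite subgroup,
  so one orbit can be finite and exactly invariant at the same time. Invariance gives the trace
  identity; finiteness makes the restrictions of elements of the Roe algebra compact, so that the
  rank of \<open>p\<close> is finite and can serve as a normalisation.

  Orthonormality refers to the real inner product. All dimensions are therefore real ones, which is
  harmless because they occur only in quotients and comparisons. Spectral theory is needed only
  because lower semicontinuity is formulated with \<open>cut_down\<close>, and all that is taken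
  from it is that \<open>cut_down a \<epsilon>\<close> lies between a - \<epsilon> and a as a
  quadratic form.\<close>

definition orthonormal :: "'a::real_inner set \<Rightarrow> bool"
  where "orthonormal B \<longleftrightarrow> finite B \<and> (\<forall>x\<in>B. \<forall>y\<in>B. inner x y = (if x = y then 1 else 0))"

lemma orthonormal_finite: "orthonormal B \<Longrightarrow> finite B"
  by (simp add: orthonormal_def)

lemma orthonormal_norm: "orthonormal B \<Longrightarrow> b \<in> B \<Longrightarrow> norm b = 1"
  by (simp add: orthonormal_def norm_eq_sqrt_inner)

lemma orthonormal_empty [simp]: "orthonormal {}"
  by (simp add: orthonormal_def)

lemma orthonormal_inner_sum:
  assumes "orthonormal B" "b \<in> B"
  shows "inner (\<Sum>c\<in>B. f c *\<^sub>R c) b = f b"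
proof -
  have "inner (\<Sum>c\<in>B. f c *\<^sub>R c) b = (\<Sum>c\<in>B. if c = b then f c else 0)"
    unfolding inner_sum_left using assms by (intro sum.cong) (auto simp: orthonormal_def)
  then show ?thesis using assms by (simp add: orthonormal_def)
qed

lemma orthonormal_residual:
  assumes "orthonormal B" "z \<in> span B"
  shows "inner (x - (\<Sum>c\<in>B. inner x c *\<^sub>R c)) z = 0"
  using assms(2)
proof (induction z rule: span_induct_alt)
  case (step c b y)
  then show ?case
    using orthonormal_inner_sum [OF assms(1), of b] by (simp add: inner_diff_left inner_add_right)
qed simp

lemma orthonormal_expand:
  assumes "orthonormal B" "x \<in> span B"
  shows "(\<Sum>b\<in>B. inner x b *\<^sub>R b) = x"
proof -
  let ?y = "x - (\<Sum>b\<in>B. inner x b *\<^sub>R b)"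
  have "?y \<in> span B"
    by (intro span_diff assms(2) span_sum span_scale span_base)
  from orthonormal_residual [OF assms(1) this, of x] show ?thesis by simp
qed

lemma orthonormal_norm_sum:
  assumes "orthonormal B"
  shows "(norm (\<Sum>b\<in>B. f b *\<^sub>R b))\<^sup>2 = (\<Sum>b\<in>B. (f b)\<^sup>2)"
  unfolding power2_norm_eq_inner inner_sum_right
  by (rule sum.cong) (simp_all add: orthonormal_inner_sum [OF assms] power2_eq_square)

lemma orthonormal_parseval:
  assumes "orthonormal B" "x \<in> span B"
  shows "(\<Sum>b\<in>B. (inner x b)\<^sup>2) = (norm x)\<^sup>2"
  using orthonormal_norm_sum [OF assms(1), of "inner x"] orthonormal_expand [OF assms] by simp

lemma orthonormal_bessel:
  assumes "orthonormal B"
  shows "(\<Sum>b\<in>B. (inner x b)\<^sup>2) \<le> (norm x)\<^sup>2"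
proof -
  let ?s = "\<Sum>b\<in>B. inner x b *\<^sub>R b"
  have "inner (x - ?s) ?s = 0"
    by (rule orthonormal_residual [OF assms]) (intro span_sum span_scale span_base)
  then have "(norm x)\<^sup>2 = (norm (x - ?s))\<^sup>2 + (norm ?s)\<^sup>2"
    by (simp add: power2_norm_eq_inner inner_diff_left inner_diff_right inner_commute)
  then show ?thesis using orthonormal_norm_sum [OF assms, of "inner x"] by simp
qed

lemma orthonormal_independent:
  assumes "orthonormal B"
  shows "independent B"
proof -
  have "0 \<notin> B" using orthonormal_norm [OF assms] by force
  then show ?thesis
    by (intro pairwise_orthogonal_independent)
      (use assms in \<open>auto simp: orthonormal_def pairwise_def orthogonal_def\<close>)
qed

lemma gram_schmidt:
  fixes S :: "'a::real_inner set"
  assumes "finite S"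
  shows "\<exists>B. orthonormal B \<and> span B = span S \<and> card B \<le> card S"
proof -
  obtain C where C: "finite C" "card C \<le> card S" "span C = span S" "pairwise orthogonal C"
    using basis_orthogonal [OF assms] by blast
  let ?B = "(\<lambda>c. inverse (norm c) *\<^sub>R c) ` (C - {0})"
  have "inner (inverse (norm c) *\<^sub>R c) (inverse (norm d) *\<^sub>R d) = (if c = d then 1 else 0)"
    if "c \<in> C - {0}" "d \<in> C - {0}" for c d
  proof (cases "c = d")
    case True
    then show ?thesis using that
      by (simp add: power2_norm_eq_inner [symmetric] power2_eq_square)
  next
    case False
    then show ?thesis using that C(4) by (auto simp: pairwise_def orthogonal_def)
  qed
  note in1 = this
  have "orthonormal ?B"
    unfolding orthonormal_def
  proof (intro conjI ballI)
    show "finite ?B" using C by simp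
    fix x y assume "x \<in> ?B" "y \<in> ?B"
    then obtain c d where cd: "c \<in> C - {0}" "d \<in> C - {0}" "x = inverse (norm c) *\<^sub>R c"
        "y = inverse (norm d) *\<^sub>R d" by blast
    show "inner x y = (if x = y then 1 else 0)"
      using in1 [OF cd(1,2)] in1 [OF cd(1,1)] cd(3,4) by (metis zero_neq_one)
  qed
  moreover have "span ?B = span C"
  proof (rule span_eq [THEN iffD2], intro conjI subsetI)
    show "x \<in> span C" if "x \<in> ?B" for x using that by (auto intro: span_scale span_base)
    show "x \<in> span ?B" if "x \<in> C" for x
    proof (cases "x = 0")
      case False
      then have "norm x *\<^sub>R inverse (norm x) *\<^sub>R x \<in> span ?B"
        using that by (intro span_scale span_base) blast
      then show ?thesis using False by simp
    qed (simp add: span_zero)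
  qed
  moreover have "card ?B \<le> card S"
    using card_image_le [of "C - {0}" "\<lambda>c. inverse (norm c) *\<^sub>R c"] card_mono [of C "C - {0}"] C(1,2)
    by auto
  ultimately show ?thesis using C(3) by blast
qed

text \<open>The bound on \<open>card G\<close> matters as much as the extension: every vector of a
  test family costs \<epsilon>, so in \<open>cut_trace_superadd\<close> the merged family must not
  outnumber the two given ones together.\<close>

lemma orthonormal_extend:
  fixes E S :: "'a::real_inner set"
  assumes E: "orthonormal E" and "finite S"
  shows "\<exists>G. orthonormal G \<and> E \<subseteq> G \<and> span G = span (E \<union> S) \<and> card G \<le> card E + card S"
proof -
  define r where "r x = x - (\<Sum>e\<in>E. inner x e *\<^sub>R e)" for x
  have sE: "(\<Sum>e\<in>E. inner x e *\<^sub>R e) \<in> span E" for x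
    by (intro span_sum span_scale span_base)
  obtain C where C: "orthonormal C" "span C = span (r ` S)" "card C \<le> card (r ` S)"
    using gram_schmidt [of "r ` S"] assms by blast
  have "inner z e = 0" if "e \<in> E" "z \<in> span (r ` S)" for e z
    using that(2)
  proof (induction z rule: span_induct_alt)
    case (step c b y)
    then show ?case
      using orthonormal_residual [OF E span_base [OF that(1)]] by (auto simp: inner_add_left r_def)
  qed simp
  then have ortho: "inner c e = 0" "inner e c = 0" if "e \<in> E" "c \<in> C" for e c
    using that span_base C(2) by (force simp: inner_commute)+
  have G: "orthonormal (E \<union> C)"
    using E C(1) ortho unfolding orthonormal_def
    by (metis (no_types, lifting) Un_iff finite_UnI inner_eq_zero_iff zero_neq_one)
  have proj: "(\<Sum>e\<in>E. inner x e *\<^sub>R e) \<in> span (E \<union> X)" for x X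
    using sE [of x] span_mono [of E "E \<union> X"] by auto
  have "r x \<in> span (E \<union> S)" if "x \<in> S" for x
    unfolding r_def using that by (intro span_diff proj) (simp add: span_base)
  moreover have "x \<in> span (E \<union> r ` S)" if "x \<in> S" for x
  proof -
    have "r x + (\<Sum>e\<in>E. inner x e *\<^sub>R e) \<in> span (E \<union> r ` S)"
      using that by (intro span_add proj) (simp add: span_base)
    then show ?thesis by (simp add: r_def)
  qed
  ultimately have "span (E \<union> r ` S) = span (E \<union> S)"
    unfolding span_eq by (auto intro: span_base)
  then have "span (E \<union> C) = span (E \<union> S)" by (simp add: span_Un C(2))
  moreover have "card (E \<union> C) \<le> card E + card S"
    using card_Un_le [of E C] C(3) card_image_le [of S r] assms(2) by linarith
  ultimately show ?thesis using G by blast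
qed

text \<open>\<open>A\<close> need not map the span to itself: both sides are the trace of its
  compression to the common span.\<close>

lemma trace_basis_independent:
  fixes A :: "'a::real_inner \<Rightarrow> 'a"
  assumes "orthonormal B" "orthonormal C" "span B = span C" "linear A"
  shows "(\<Sum>b\<in>B. inner (A b) b) = (\<Sum>c\<in>C. inner (A c) c)"
proof -
  have "(\<Sum>b\<in>B. inner (A b) b) = (\<Sum>b\<in>B. inner (A b) (\<Sum>c\<in>C. inner b c *\<^sub>R c))"
    using orthonormal_expand [OF assms(2)] assms(3) span_base by (metis (no_types, lifting) sum.cong)
  also have "\<dots> = (\<Sum>c\<in>C. \<Sum>b\<in>B. inner b c * inner (A b) c)"
    unfolding inner_sum_right by (subst sum.swap) simp
  also have "\<dots> = (\<Sum>c\<in>C. inner (A (\<Sum>b\<in>B. inner c b *\<^sub>R b)) c)"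
    by (simp add: linear_sum [OF assms(4)] linear_scale [OF assms(4)] inner_sum_left inner_sum_right inner_commute)
  also have "\<dots> = (\<Sum>c\<in>C. inner (A c) c)"
    using orthonormal_expand [OF assms(1)] assms(3) span_base by (metis (no_types, lifting) sum.cong)
  finally show ?thesis .
qed

section \<open>Approximately finite-dimensional maps\<close>

text \<open>Compactness of \<open>T\<close> on \<open>L\<close>, phrased by finite-dimensional
  approximation. The approximant \<open>y\<close> may depend on \<open>x\<close> in any way and the
  error is relative to \<open>norm x\<close>, so sums, norm limits and compositions are handled
  without compact sets.\<close>

definition fin_approx :: "'a::real_normed_vector set \<Rightarrow> ('a \<Rightarrow> 'b::real_normed_vector) \<Rightarrow> bool"
  where "fin_approx L T \<longleftrightarrow>
    (\<forall>\<eta>>0. \<exists>C. finite C \<and> (\<forall>x\<in>L. \<exists>y\<in>span C. norm (T x - y) \<le> \<eta> * norm x))"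

lemma fin_approxI:
  "(\<And>\<eta>. \<eta> > 0 \<Longrightarrow> \<exists>C. finite C \<and> (\<forall>x\<in>L. \<exists>y\<in>span C. norm (T x - y) \<le> \<eta> * norm x))
    \<Longrightarrow> fin_approx L T"
  by (simp add: fin_approx_def)

lemma fin_approxE:
  assumes "fin_approx L T" "\<eta> > 0"
  obtains C where "finite C" "\<And>x. x \<in> L \<Longrightarrow> \<exists>y\<in>span C. norm (T x - y) \<le> \<eta> * norm x"
  using assms by (auto simp: fin_approx_def)

lemma fin_approx_zero: "fin_approx L (\<lambda>_. 0)"
  by (rule fin_approxI, rule exI [of _ "{}"]) simp

lemma fin_approx_add:
  assumes "fin_approx L S" "fin_approx L T"
  shows "fin_approx L (\<lambda>x. S x + T x)"
proof (rule fin_approxI)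
  fix \<eta> :: real assume "\<eta> > 0"
  then have e: "\<eta> / 2 > 0" by simp
  obtain C where C: "finite C" "\<And>x. x \<in> L \<Longrightarrow> \<exists>y\<in>span C. norm (S x - y) \<le> \<eta> / 2 * norm x"
    by (rule fin_approxE [OF assms(1) e]) blast
  obtain D where D: "finite D" "\<And>x. x \<in> L \<Longrightarrow> \<exists>y\<in>span D. norm (T x - y) \<le> \<eta> / 2 * norm x"
    by (rule fin_approxE [OF assms(2) e]) blast
  have "\<exists>z\<in>span (C \<union> D). norm (S x + T x - z) \<le> \<eta> * norm x" if xL: "x \<in> L" for x
  proof -
    obtain y z where yz: "y \<in> span C" "norm (S x - y) \<le> \<eta> / 2 * norm x"
        "z \<in> span D" "norm (T x - z) \<le> \<eta> / 2 * norm x"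
      using C(2) [OF xL] D(2) [OF xL] by blast
    have "y + z \<in> span (C \<union> D)"
      using yz span_mono [of C "C \<union> D"] span_mono [of D "C \<union> D"] by (intro span_add) auto
    moreover have "norm (S x + T x - (y + z)) \<le> \<eta> * norm x"
      using norm_triangle_ineq [of "S x - y" "T x - z"] yz by (simp add: algebra_simps)
    ultimately show ?thesis by blast
  qed
  then show "\<exists>C. finite C \<and> (\<forall>x\<in>L. \<exists>y\<in>span C. norm (S x + T x - y) \<le> \<eta> * norm x)"
    using C(1) D(1) by (intro exI [of _ "C \<union> D"]) auto
qed

lemma fin_approx_sum:
  "(\<And>i. i \<in> I \<Longrightarrow> fin_approx L (T i)) \<Longrightarrow> fin_approx L (\<lambda>x. \<Sum>i\<in>I. T i x)"
  by (induction I rule: infinite_finite_induct) (auto intro: fin_approx_zero fin_approx_add)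

lemma fin_approx_limit:
  assumes "\<And>\<eta>. \<eta> > 0 \<Longrightarrow> \<exists>S. fin_approx L S \<and> (\<forall>x\<in>L. norm (T x - S x) \<le> \<eta> * norm x)"
  shows "fin_approx L T"
proof (rule fin_approxI)
  fix \<eta> :: real assume "\<eta> > 0"
  then have e: "\<eta> / 2 > 0" by simp
  obtain S where S: "fin_approx L S" "\<And>x. x \<in> L \<Longrightarrow> norm (T x - S x) \<le> \<eta> / 2 * norm x"
    using assms [OF e] by blast
  obtain C where C: "finite C" "\<And>x. x \<in> L \<Longrightarrow> \<exists>y\<in>span C. norm (S x - y) \<le> \<eta> / 2 * norm x"
    by (rule fin_approxE [OF S(1) e]) blast
  have "\<exists>y\<in>span C. norm (T x - y) \<le> \<eta> * norm x" if xL: "x \<in> L" for x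
  proof -
    obtain y where y: "y \<in> span C" "norm (S x - y) \<le> \<eta> / 2 * norm x" using C(2) [OF xL] by blast
    have "norm (T x - y) \<le> \<eta> * norm x"
      using norm_triangle_ineq [of "T x - S x" "S x - y"] y(2) S(2) [OF xL] by simp
    then show ?thesis using y(1) by blast
  qed
  then show "\<exists>C. finite C \<and> (\<forall>x\<in>L. \<exists>y\<in>span C. norm (T x - y) \<le> \<eta> * norm x)"
    using C(1) by blast
qed

lemma blinfun_norm_le:
  assumes "norm T \<le> K"
  shows "norm (blinfun_apply T x) \<le> K * norm x"
  by (rule order_trans [OF norm_blinfun mult_right_mono [OF assms norm_ge_zero]])

lemma fin_approx_closure:
  fixes w :: "'a::real_normed_vector \<Rightarrow>\<^sub>L 'b::real_normed_vector"
  assumes "w \<in> closure Y" "\<And>y. y \<in> Y \<Longrightarrow> fin_approx L y"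
  shows "fin_approx L w"
proof (rule fin_approx_limit)
  fix \<eta> :: real assume "\<eta> > 0"
  then obtain y where y: "y \<in> Y" "dist y w < \<eta>"
    using assms(1) unfolding closure_approachable by blast
  have "norm (w x - y x) \<le> \<eta> * norm x" for x
    using blinfun_norm_le [of "w - y" \<eta> x] y(2)
    by (simp add: blinfun.diff_left dist_norm norm_minus_commute)
  then show "\<exists>S. fin_approx L S \<and> (\<forall>x\<in>L. norm (w x - S x) \<le> \<eta> * norm x)"
    using assms(2) [OF y(1)] by blast
qed

lemma fin_approx_compose_left:
  assumes "fin_approx L T" "bounded_linear B"
  shows "fin_approx L (\<lambda>x. B (T x))"
proof (rule fin_approxI)
  fix \<eta> :: real assume "\<eta> > 0"
  obtain K where K: "K > 0" "\<And>x. norm (B x) \<le> norm x * K"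
    using bounded_linear.pos_bounded [OF assms(2)] by blast
  have e: "\<eta> / K > 0" using \<open>\<eta> > 0\<close> K(1) by simp
  obtain C where C: "finite C" "\<And>x. x \<in> L \<Longrightarrow> \<exists>y\<in>span C. norm (T x - y) \<le> \<eta> / K * norm x"
    by (rule fin_approxE [OF assms(1) e]) blast
  have lB: "linear B" by (rule bounded_linear.linear [OF assms(2)])
  have "\<exists>y\<in>span (B ` C). norm (B (T x) - y) \<le> \<eta> * norm x" if xL: "x \<in> L" for x
  proof -
    obtain y where y: "y \<in> span C" "norm (T x - y) \<le> \<eta> / K * norm x" using C(2) [OF xL] by blast
    have "norm (B (T x) - B y) \<le> norm (T x - y) * K"
      using K(2) [of "T x - y"] by (simp add: linear_diff [OF lB])
    also have "\<dots> \<le> \<eta> * norm x" using y(2) K(1) by (simp add: field_simps)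
    finally show ?thesis using y(1) by (auto simp: linear_span_image [OF lB])
  qed
  then show "\<exists>C. finite C \<and> (\<forall>x\<in>L. \<exists>y\<in>span C. norm (B (T x) - y) \<le> \<eta> * norm x)"
    using C(1) by (intro exI [of _ "B ` C"]) auto
qed

lemma fin_approx_compose_right:
  assumes "fin_approx M T" "\<And>x. x \<in> L \<Longrightarrow> R x \<in> M" "\<And>x. x \<in> L \<Longrightarrow> norm (R x) \<le> K * norm x"
  shows "fin_approx L (\<lambda>x. T (R x))"
proof (rule fin_approxI)
  fix \<eta> :: real assume "\<eta> > 0"
  then have e: "\<eta> / (\<bar>K\<bar> + 1) > 0" by simp
  obtain C where C: "finite C"
      "\<And>x. x \<in> M \<Longrightarrow> \<exists>y\<in>span C. norm (T x - y) \<le> \<eta> / (\<bar>K\<bar> + 1) * norm x"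
    by (rule fin_approxE [OF assms(1) e]) blast
  have "\<exists>y\<in>span C. norm (T (R x) - y) \<le> \<eta> * norm x" if xL: "x \<in> L" for x
  proof -
    obtain y where y: "y \<in> span C" "norm (T (R x) - y) \<le> \<eta> / (\<bar>K\<bar> + 1) * norm (R x)"
      using C(2) assms(2) xL by blast
    have "norm (R x) \<le> (\<bar>K\<bar> + 1) * norm x"
      using assms(3) [OF xL] mult_right_mono [of K "\<bar>K\<bar> + 1" "norm x"] abs_ge_self [of K]
      by (meson norm_ge_zero order_trans le_add_same_cancel1 zero_le_one)
    then have "\<eta> / (\<bar>K\<bar> + 1) * norm (R x) \<le> \<eta> / (\<bar>K\<bar> + 1) * ((\<bar>K\<bar> + 1) * norm x)"
      using e by (intro mult_left_mono) auto
    also have "\<dots> = \<eta> * norm x" by (simp add: field_simps)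
    finally have "norm (T (R x) - y) \<le> \<eta> * norm x" using y(2) by linarith
    then show ?thesis using y(1) by blast
  qed
  then show "\<exists>C. finite C \<and> (\<forall>x\<in>L. \<exists>y\<in>span C. norm (T (R x) - y) \<le> \<eta> * norm x)"
    using C(1) by blast
qed

text \<open>Orthogonal projection onto a finite-dimensional space approximating the values of
  \<open>P\<close> is injective on \<open>span B\<close>: a vector orthogonal to that space has
  distance at least \<open>norm x\<close> from it, but here the distance is at most 1/2 + 1/4 of
  \<open>norm x\<close>. Vectors need only be moved little by \<open>P\<close>, not fixed; stable
  finiteness depends on this, because there the invariance of a block holds only for
  approximants.\<close>

lemma fin_approx_card_bound:
  fixes P :: "'a::real_inner \<Rightarrow> 'a"
  assumes "fin_approx L P"
  shows "\<exists>n. \<forall>B. independent B \<and> finite B \<and> span B \<subseteq> L \<and>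
    (\<forall>x\<in>span B. norm (x - P x) \<le> 1 / 2 * norm x) \<longrightarrow> card B \<le> n"
proof -
  have e: "(1::real) / 4 > 0" by simp
  obtain C0 where C0: "finite C0" "\<And>x. x \<in> L \<Longrightarrow> \<exists>y\<in>span C0. norm (P x - y) \<le> 1 / 4 * norm x"
    by (rule fin_approxE [OF assms e]) blast
  obtain C where C: "orthonormal C" "span C = span C0" using gram_schmidt [OF C0(1)] by blast
  define f where "f x = (\<Sum>c\<in>C. inner x c *\<^sub>R c)" for x :: 'a
  have lf: "linear f"
    by (rule linearI) (simp_all only: f_def inner_add_left inner_scaleR_left scaleR_add_left
        sum.distrib scaleR_sum_right scaleR_scaleR)
  have "card B \<le> card C" if B: "independent B" "finite B" "span B \<subseteq> L"
    "\<forall>x\<in>span B. norm (x - P x) \<le> 1 / 2 * norm x" for B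
  proof -
    have z: "x = 0" if xB: "x \<in> span B" "f x = 0" for x
    proof -
      obtain y where y: "y \<in> span C" "norm (P x - y) \<le> 1 / 4 * norm x"
        using C0(2) [OF subsetD [OF B(3) xB(1)]] unfolding C(2) by (elim bexE)
      have "inner x y = 0"
        using orthonormal_residual [OF C(1) y(1), of x] xB(2) by (simp add: f_def)
      then have "(norm (x - y))\<^sup>2 = (norm x)\<^sup>2 + (norm y)\<^sup>2"
        by (simp add: power2_norm_eq_inner inner_diff_left inner_diff_right inner_commute)
      then have "(norm x)\<^sup>2 \<le> (norm (x - y))\<^sup>2" by simp
      then have "norm x \<le> norm (x - y)" by (rule power2_le_imp_le) simp
      also have "\<dots> \<le> norm (x - P x) + norm (P x - y)"
        using norm_triangle_ineq [of "x - P x" "P x - y"] by simp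
      also have "\<dots> \<le> 3 / 4 * norm x" using bspec [OF B(4) xB(1)] y(2) by simp
      finally show "x = 0" by simp
    qed
    have inj: "inj_on f (span B)"
    proof (rule inj_onI)
      fix x y assume "x \<in> span B" "y \<in> span B" "f x = f y"
      then show "x = y" using z [of "x - y"] by (simp add: linear_diff [OF lf] span_diff)
    qed
    have ind: "independent (f ` B)"
      by (rule linear_independent_injective_image [OF lf B(1) inj])
    have "f ` B \<subseteq> span C"
      by (auto simp: f_def intro!: span_sum span_scale intro: span_base)
    then have "card (f ` B) \<le> card C"
      using independent_span_bound [OF orthonormal_finite [OF C(1)] ind] by blast
    moreover have "card (f ` B) = card B"
      by (rule card_image) (rule inj_on_subset [OF inj span_superset])
    ultimately show ?thesis by simp
  qed
  then show ?thesis by blast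
qed

section \<open>Truncated traces\<close>

text \<open>For a subspace \<open>L\<close> and a symmetric \<open>a\<close> this is the trace of
  the positive part of a - \<epsilon>, compressed to \<open>L\<close>, in variational form. Only the
  quadratic form on \<open>L\<close> is seen, so \<open>a\<close> need not preserve
  \<open>L\<close>. The conversion to \<open>ennreal\<close> replaces negative sums by 0, which is
  the value at the empty family.\<close>

definition cut_trace :: "'a::real_inner set \<Rightarrow> ('a \<Rightarrow> 'a) \<Rightarrow> real \<Rightarrow> ennreal"
  where "cut_trace L a \<epsilon> = (SUP B\<in>{B. orthonormal B \<and> B \<subseteq> L}. ennreal (\<Sum>b\<in>B. inner (a b) b - \<epsilon>))"

lemma cut_trace_upper:
  "orthonormal B \<Longrightarrow> B \<subseteq> L \<Longrightarrow> ennreal (\<Sum>b\<in>B. inner (a b) b - \<epsilon>) \<le> cut_trace L a \<epsilon>"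
  unfolding cut_trace_def by (rule SUP_upper) simp

lemma cut_trace_least:
  "(\<And>B. orthonormal B \<Longrightarrow> B \<subseteq> L \<Longrightarrow> ennreal (\<Sum>b\<in>B. inner (a b) b - \<epsilon>) \<le> u) \<Longrightarrow> cut_trace L a \<epsilon> \<le> u"
  unfolding cut_trace_def by (rule SUP_least) simp

text \<open>Norm approximation enters here: the two operators are compared at different cuts, so a
  perturbation of the form on unit vectors of \<open>L\<close> is paid for by a shift of the
  cut.\<close>

lemma cut_trace_mono:
  assumes "\<And>x. x \<in> L \<Longrightarrow> norm x = 1 \<Longrightarrow> inner (a x) x - \<epsilon> \<le> inner (b x) x - \<delta>"
  shows "cut_trace L a \<epsilon> \<le> cut_trace L b \<delta>"
proof (rule cut_trace_least)
  fix B assume B: "orthonormal B" "B \<subseteq> L"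
  have "(\<Sum>x\<in>B. inner (a x) x - \<epsilon>) \<le> (\<Sum>x\<in>B. inner (b x) x - \<delta>)"
    using B orthonormal_norm [OF B(1)] by (intro sum_mono assms) auto
  then show "ennreal (\<Sum>x\<in>B. inner (a x) x - \<epsilon>) \<le> cut_trace L b \<delta>"
    using cut_trace_upper [OF B, of b \<delta>] ennreal_leI order_trans by blast
qed

lemma cut_trace_antimono: "\<epsilon> \<le> \<delta> \<Longrightarrow> cut_trace L a \<delta> \<le> cut_trace L a \<epsilon>"
  by (rule cut_trace_mono) simp

lemma cut_trace_zero: "\<epsilon> \<ge> 0 \<Longrightarrow> cut_trace L (\<lambda>_. 0) \<epsilon> = 0"
  by (rule antisym [OF cut_trace_least]) (auto simp: ennreal_eq_0_iff intro!: mult_nonneg_nonneg)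

lemma cut_trace_scale:
  assumes "r > 0"
  shows "cut_trace L (\<lambda>x. r *\<^sub>R a x) (r * \<epsilon>) = ennreal r * cut_trace L a \<epsilon>"
proof -
  have "ennreal (\<Sum>b\<in>B. inner (r *\<^sub>R a b) b - r * \<epsilon>) = ennreal r * ennreal (\<Sum>b\<in>B. inner (a b) b - \<epsilon>)" for B
    using assms by (simp add: ennreal_mult' [symmetric] sum_distrib_left right_diff_distrib)
  then show ?thesis unfolding cut_trace_def by (simp add: SUP_mult_left_ennreal)
qed

lemma ennreal_add_le: "ennreal (x + y) \<le> ennreal x + ennreal y"
proof -
  have "ennreal (x + y) \<le> ennreal (max 0 x + max 0 y)" by (intro ennreal_leI add_mono) auto
  also have "\<dots> = ennreal (max 0 x) + ennreal (max 0 y)" by (rule ennreal_plus) auto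
  also have "\<dots> = ennreal x + ennreal y" by (simp add: max_def ennreal_neg)
  finally show ?thesis .
qed

lemma cut_trace_subadd:
  "cut_trace L (\<lambda>x. a x + b x) (\<epsilon> + \<delta>) \<le> cut_trace L a \<epsilon> + cut_trace L b \<delta>"
proof (rule cut_trace_least)
  fix B assume B: "orthonormal B" "B \<subseteq> L"
  have "ennreal (\<Sum>x\<in>B. inner (a x + b x) x - (\<epsilon> + \<delta>))
      = ennreal ((\<Sum>x\<in>B. inner (a x) x - \<epsilon>) + (\<Sum>x\<in>B. inner (b x) x - \<delta>))"
    by (simp add: inner_add_left sum.distrib [symmetric] algebra_simps)
  also have "\<dots> \<le> ennreal (\<Sum>x\<in>B. inner (a x) x - \<epsilon>) + ennreal (\<Sum>x\<in>B. inner (b x) x - \<delta>)"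
    by (rule ennreal_add_le)
  also have "\<dots> \<le> cut_trace L a \<epsilon> + cut_trace L b \<delta>"
    by (intro add_mono cut_trace_upper B)
  finally show "ennreal (\<Sum>x\<in>B. inner (a x + b x) x - (\<epsilon> + \<delta>)) \<le> cut_trace L a \<epsilon> + cut_trace L b \<delta>" .
qed

text \<open>Extend the test families \<open>B\<close> and \<open>C\<close> to orthonormal bases
  \<open>G\<close> and \<open>H\<close> of their joint span. By positivity both sums of diagonal
  entries only grow; the one for \<open>b\<close> can then be moved from \<open>H\<close> to
  \<open>G\<close>, and the penalty for \<open>G\<close> is at most that for \<open>B\<close> and
  \<open>C\<close> together.\<close>

lemma cut_trace_superadd:
  assumes L: "subspace L" and ab: "linear a" "linear b"
    and pos: "\<And>x. inner (a x) x \<ge> 0" "\<And>x. inner (b x) x \<ge> 0" and e: "\<epsilon> \<ge> 0"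
  shows "cut_trace L a \<epsilon> + cut_trace L b \<epsilon> \<le> cut_trace L (\<lambda>x. a x + b x) \<epsilon>" (is "_ \<le> ?R")
proof -
  have "ennreal (\<Sum>x\<in>B. inner (a x) x - \<epsilon>) + ennreal (\<Sum>x\<in>C. inner (b x) x - \<epsilon>) \<le> ?R"
    if B: "orthonormal B" "B \<subseteq> L" and C: "orthonormal C" "C \<subseteq> L" for B C
  proof (cases "(\<Sum>x\<in>B. inner (a x) x - \<epsilon>) \<ge> 0 \<and> (\<Sum>x\<in>C. inner (b x) x - \<epsilon>) \<ge> 0")
    case True
    obtain G where G: "orthonormal G" "B \<subseteq> G" "span G = span (B \<union> C)" "card G \<le> card B + card C"
      using orthonormal_extend [OF B(1) orthonormal_finite [OF C(1)]] by blast
    obtain H where H: "orthonormal H" "C \<subseteq> H" "span H = span (C \<union> B)"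
      using orthonormal_extend [OF C(1) orthonormal_finite [OF B(1)]] by blast
    have GL: "G \<subseteq> L"
    proof -
      have "span (B \<union> C) \<subseteq> L" using B C L by (intro span_minimal) auto
      then show ?thesis using G(3) span_superset [of G] by blast
    qed
    have "(\<Sum>x\<in>B. inner (a x) x) \<le> (\<Sum>x\<in>G. inner (a x) x)"
      by (rule sum_mono2) (use G pos orthonormal_finite in auto)
    moreover have "(\<Sum>x\<in>C. inner (b x) x) \<le> (\<Sum>x\<in>H. inner (b x) x)"
      by (rule sum_mono2) (use H pos orthonormal_finite in auto)
    moreover have "(\<Sum>x\<in>H. inner (b x) x) = (\<Sum>x\<in>G. inner (b x) x)"
      by (rule trace_basis_independent) (use G H ab in \<open>auto simp: Un_commute\<close>)
    moreover have "\<epsilon> * card G \<le> \<epsilon> * (card B + card C)"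
      using G(4) e by (intro mult_left_mono) auto
    ultimately have "(\<Sum>x\<in>B. inner (a x) x - \<epsilon>) + (\<Sum>x\<in>C. inner (b x) x - \<epsilon>)
        \<le> (\<Sum>x\<in>G. inner (a x + b x) x - \<epsilon>)"
      by (simp add: sum_subtractf inner_add_left sum.distrib algebra_simps)
    then have "ennreal ((\<Sum>x\<in>B. inner (a x) x - \<epsilon>) + (\<Sum>x\<in>C. inner (b x) x - \<epsilon>)) \<le> ?R"
      using cut_trace_upper [OF G(1) GL, of "\<lambda>x. a x + b x" \<epsilon>] ennreal_leI order_trans by blast
    then show ?thesis using True by simp
  next
    case False
    \<comment> \<open>A negative sum counts as 0 in \<open>ennreal\<close>, so monotonicity in each
      summand alone is enough here.\<close>
    have "cut_trace L a \<epsilon> \<le> ?R" "cut_trace L b \<epsilon> \<le> ?R"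
      by (auto intro!: cut_trace_mono simp: inner_add_left pos)
    then have "ennreal (\<Sum>x\<in>B. inner (a x) x - \<epsilon>) \<le> ?R" "ennreal (\<Sum>x\<in>C. inner (b x) x - \<epsilon>) \<le> ?R"
      using cut_trace_upper [OF B, of a \<epsilon>] cut_trace_upper [OF C, of b \<epsilon>] order_trans by blast+
    then show ?thesis using False by (auto simp: not_le ennreal_neg)
  qed
  then have "(SUP C\<in>{C. orthonormal C \<and> C \<subseteq> L}. ennreal (\<Sum>x\<in>B. inner (a x) x - \<epsilon>) + ennreal (\<Sum>x\<in>C. inner (b x) x - \<epsilon>)) \<le> ?R"
    if "orthonormal B" "B \<subseteq> L" for B
    using that by (intro SUP_least) auto
  moreover have ne: "{C::'a set. orthonormal C \<and> C \<subseteq> L} \<noteq> {}" by (auto intro: exI [of _ "{}"])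
  ultimately have "ennreal (\<Sum>x\<in>B. inner (a x) x - \<epsilon>) + cut_trace L b \<epsilon> \<le> ?R"
    if "orthonormal B" "B \<subseteq> L" for B
    using that unfolding cut_trace_def [of L b] by (subst ennreal_SUP_add_right) auto
  then have "(SUP B\<in>{B. orthonormal B \<and> B \<subseteq> L}. ennreal (\<Sum>x\<in>B. inner (a x) x - \<epsilon>) + cut_trace L b \<epsilon>) \<le> ?R"
    by (intro SUP_least) auto
  then show ?thesis
    using ne unfolding cut_trace_def [of L a] by (subst (asm) ennreal_SUP_add_left) auto
qed

text \<open>An orthonormal basis \<open>C\<close> of the span of the image of \<open>B\<close> under
  \<open>y\<close> is the test family on the right. Parseval expands every \<open>y b\<close> along
  \<open>C\<close>, the double sum is swapped, and Bessel collapses it to the vectors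
  \<open>y' c\<close>. Since \<open>C\<close> is no larger than \<open>B\<close>, the penalty does
  not grow. For this direction \<open>L\<close> has to be invariant under \<open>y\<close> only,
  which keeps \<open>C\<close> inside \<open>L\<close>.\<close>

lemma cut_trace_commute_le:
  assumes L: "subspace L" and y: "linear y" "\<And>x. x \<in> L \<Longrightarrow> y x \<in> L"
    and adj: "\<And>x z. inner (y x) z = inner x (y' z)" and e: "\<epsilon> \<ge> 0"
  shows "cut_trace L (\<lambda>x. y' (y x)) \<epsilon> \<le> cut_trace L (\<lambda>x. y (y' x)) \<epsilon>"
proof (rule cut_trace_least)
  fix B assume B: "orthonormal B" "B \<subseteq> L"
  obtain C where C: "orthonormal C" "span C = span (y ` B)" "card C \<le> card (y ` B)"
    using gram_schmidt [of "y ` B"] orthonormal_finite [OF B(1)] by blast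
  have CL: "C \<subseteq> L"
  proof -
    have "span (y ` B) \<subseteq> L" using B y(2) L by (intro span_minimal) auto
    then show ?thesis using C(2) span_superset [of C] by blast
  qed
  have card: "card C \<le> card B"
    using C(3) card_image_le [OF orthonormal_finite [OF B(1)], of y] by simp
  have "(\<Sum>b\<in>B. inner (y' (y b)) b) = (\<Sum>b\<in>B. (norm (y b))\<^sup>2)"
    by (intro sum.cong refl) (metis adj inner_commute power2_norm_eq_inner)
  also have "\<dots> = (\<Sum>b\<in>B. \<Sum>c\<in>C. (inner (y b) c)\<^sup>2)"
    by (intro sum.cong refl orthonormal_parseval [symmetric, OF C(1)]) (auto simp: C(2) intro: span_base)
  also have "\<dots> = (\<Sum>c\<in>C. \<Sum>b\<in>B. (inner (y' c) b)\<^sup>2)"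
    by (subst sum.swap, intro sum.cong refl) (metis adj inner_commute)
  also have "\<dots> \<le> (\<Sum>c\<in>C. (norm (y' c))\<^sup>2)"
    by (intro sum_mono orthonormal_bessel B)
  also have "\<dots> = (\<Sum>c\<in>C. inner (y (y' c)) c)"
    by (intro sum.cong refl) (simp add: adj power2_norm_eq_inner)
  finally have "(\<Sum>b\<in>B. inner (y' (y b)) b - \<epsilon>) \<le> (\<Sum>c\<in>C. inner (y (y' c)) c - \<epsilon>)"
    using mult_left_mono [OF of_nat_mono [OF card, where 'a = real] e]
    by (simp add: sum_subtractf algebra_simps)
  then show "ennreal (\<Sum>b\<in>B. inner (y' (y b)) b - \<epsilon>) \<le> cut_trace L (\<lambda>x. y (y' x)) \<epsilon>"
    using cut_trace_upper [OF C(1) CL, of "\<lambda>x. y (y' x)" \<epsilon>] ennreal_leI order_trans by blast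
qed

text \<open>The number \<open>n\<close> is the rank of \<open>P\<close> on \<open>L\<close>,
  obtained as the size of a largest orthonormal family in \<open>L\<close> fixed by
  \<open>P\<close>. Such a family exists by \<open>fin_approx_card_bound\<close>, and it spans the
  image of \<open>L\<close>, since otherwise some \<open>P x\<close> would enlarge it.\<close>

lemma cut_trace_projection:
  assumes L: "subspace L" and P: "linear P" "\<And>x. P (P x) = P x" "\<And>x y. inner (P x) y = inner x (P y)"
    and PL: "\<And>x. x \<in> L \<Longrightarrow> P x \<in> L" and fin: "fin_approx L P" and nz: "x0 \<in> L" "P x0 \<noteq> 0"
  shows "\<exists>n>0. \<forall>\<epsilon>. 0 < \<epsilon> \<and> \<epsilon> < 1 \<longrightarrow> cut_trace L P \<epsilon> = ennreal ((1 - \<epsilon>) * real n)"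
proof -
  define Q where "Q B \<longleftrightarrow> orthonormal B \<and> B \<subseteq> L \<and> (\<forall>b\<in>B. P b = b)" for B
  have fix_span: "P x = x" if "x \<in> span B" "Q B" for x B
    using that(1)
    by (induction x rule: span_induct_alt)
      (use that(2) in \<open>auto simp: linear_0 [OF P(1)] linear_add [OF P(1)] linear_scale [OF P(1)] Q_def\<close>)
  have span_L: "span B \<subseteq> L" if "Q B" for B using that L by (intro span_minimal) (auto simp: Q_def)
  obtain m where m: "\<And>B. independent B \<Longrightarrow> finite B \<Longrightarrow> span B \<subseteq> L \<Longrightarrow>
      (\<forall>x\<in>span B. norm (x - P x) \<le> 1 / 2 * norm x) \<Longrightarrow> card B \<le> m"
    using fin_approx_card_bound [OF fin] by blast
  have "card B \<le> m" if "Q B" for B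
    using fix_span [OF _ that] span_L [OF that] that
    by (intro m) (auto simp: Q_def orthonormal_independent orthonormal_finite)
  moreover have "Q {}" by (simp add: Q_def)
  \<comment> \<open>\<open>Suc m\<close> because the maximality principle asks for a strict bound on
    the cardinalities.\<close>
  ultimately obtain C where C: "Q C" and max: "\<And>B. Q B \<Longrightarrow> card B \<le> card C"
    using ex_has_greatest_nat [of Q "{}" card "Suc m"] by (metis le_imp_less_Suc)
  have oC: "orthonormal C" and CL: "C \<subseteq> L" and PC: "\<And>c. c \<in> C \<Longrightarrow> P c = c" using C by (auto simp: Q_def)
  have range: "P x \<in> span C" if "x \<in> L" for x
  proof (rule ccontr)
    assume n: "P x \<notin> span C"
    obtain G where G: "orthonormal G" "C \<subseteq> G" "span G = span (C \<union> {P x})"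
      using orthonormal_extend [OF oC, of "{P x}"] by blast
    have "span (C \<union> {P x}) \<subseteq> {z \<in> L. P z = z}"
    proof (rule span_minimal)
      show "subspace {z \<in> L. P z = z}"
        using L by (auto simp: subspace_def linear_0 [OF P(1)] linear_add [OF P(1)] linear_scale [OF P(1)])
    qed (use CL PC PL [OF that] P(2) in auto)
    then have "Q G" using G span_superset [of G] by (auto simp: Q_def)
    then have "card G \<le> card C" by (rule max)
    then have "G = C" using card_seteq [OF orthonormal_finite [OF G(1)] G(2)] by simp
    then show False using n G(3) by (metis UnCI insertI1 span_base)
  qed
  have pos: "card C > 0"
    using range [OF nz(1)] nz(2) orthonormal_finite [OF oC] by (auto simp: card_gt_0_iff)
  have "cut_trace L P \<epsilon> = ennreal ((1 - \<epsilon>) * real (card C))" if e: "0 < \<epsilon>" "\<epsilon> < 1" for \<epsilon>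
  proof (rule antisym [OF cut_trace_least])
    fix B assume B: "orthonormal B" "B \<subseteq> L"
    have sq: "inner (P b) b = (norm (P b))\<^sup>2" for b
      by (metis P(2,3) power2_norm_eq_inner)
    have "(\<Sum>b\<in>B. inner (P b) b) = (\<Sum>b\<in>B. \<Sum>c\<in>C. (inner (P b) c)\<^sup>2)"
      unfolding sq using B by (intro sum.cong refl orthonormal_parseval [symmetric, OF oC] range) auto
    also have "\<dots> = (\<Sum>c\<in>C. \<Sum>b\<in>B. (inner c b)\<^sup>2)"
      by (subst sum.swap, intro sum.cong refl) (metis P(3) PC inner_commute)
    also have "\<dots> \<le> (\<Sum>c\<in>C. (norm c)\<^sup>2)"
      by (intro sum_mono orthonormal_bessel B)
    also have "\<dots> = real (card C)" by (simp add: orthonormal_norm [OF oC])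
    finally have 1: "(\<Sum>b\<in>B. inner (P b) b) \<le> real (card C)" .
    have "(norm (P b))\<^sup>2 \<le> norm (P b) * norm b" for b
      unfolding sq [symmetric] by (rule norm_cauchy_schwarz)
    then have "norm (P b) \<le> norm b" for b
      by (metis mult_le_cancel_left_pos norm_ge_zero order_le_less power2_eq_square)
    then have "(norm (P b))\<^sup>2 \<le> 1" if "b \<in> B" for b
      using orthonormal_norm [OF B(1) that] by (metis norm_ge_zero power_le_one)
    then have 2: "(\<Sum>b\<in>B. inner (P b) b) \<le> real (card B)"
      unfolding sq using sum_bounded_above [of B "\<lambda>b. (norm (P b))\<^sup>2" 1] by simp
    \<comment> \<open>The sum of the diagonal entries is at most the smaller of
      \<open>card B\<close> and \<open>card C\<close>. For small \<open>B\<close> the first bound is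
      used, for large \<open>B\<close> the second one together with the larger penalty; the extreme
      case is equality of the cardinalities.\<close>
    have "(\<Sum>b\<in>B. inner (P b) b - \<epsilon>) \<le> (1 - \<epsilon>) * real (card C)"
    proof (cases "card B \<le> card C")
      case True
      have "(\<Sum>b\<in>B. inner (P b) b - \<epsilon>) \<le> (1 - \<epsilon>) * real (card B)"
        using 2 by (simp add: sum_subtractf algebra_simps)
      also have "\<dots> \<le> (1 - \<epsilon>) * real (card C)" using True e by (intro mult_left_mono) auto
      finally show ?thesis .
    next
      case False
      then have "\<epsilon> * card C \<le> \<epsilon> * card B" using e by (intro mult_left_mono) auto
      then show ?thesis using 1 by (simp add: sum_subtractf algebra_simps)
    qed
    then show "ennreal (\<Sum>b\<in>B. inner (P b) b - \<epsilon>) \<le> ennreal ((1 - \<epsilon>) * real (card C))"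
      by (rule ennreal_leI)
  next
    have "(\<Sum>c\<in>C. inner (P c) c - \<epsilon>) = (\<Sum>c\<in>C. 1 - \<epsilon>)"
      by (intro sum.cong refl) (simp add: PC power2_norm_eq_inner [symmetric] orthonormal_norm [OF oC])
    then show "ennreal ((1 - \<epsilon>) * real (card C)) \<le> cut_trace L P \<epsilon>"
      using cut_trace_upper [OF oC CL, of P \<epsilon>] by (simp add: mult.commute)
  qed
  then show ?thesis using pos by blast
qed

section \<open>Complex-linear operators and adjoints\<close>

subclass (in chilbert_space) banach ..

lemma scaleC_zero_right [simp]: "c *\<^sub>C (0::'a::complex_inner) = 0"
  using scaleC_add_right [of c "0::'a" 0] by simp

lemma scaleC_minus_right [simp]: "c *\<^sub>C (- x) = - (c *\<^sub>C (x::'a::complex_inner))"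
  using scaleC_add_right [of c x "- x"] by (simp add: minus_unique)

lemma scaleC_diff_right: "c *\<^sub>C (x - y) = c *\<^sub>C x - c *\<^sub>C (y::'a::complex_inner)"
  using scaleC_add_right [of c x "- y"] by simp

lemma scaleC_scaleR: "c *\<^sub>C (r *\<^sub>R x) = r *\<^sub>R (c *\<^sub>C (x::'a::complex_inner))"
  by (simp add: scaleR_scaleC scaleC_scaleC mult.commute)

lemma scaleC_one [simp]: "1 *\<^sub>C (x::'a::complex_inner) = x"
  using scaleR_scaleC [of 1 x] by simp

lemma bounded_linear_scaleC: "bounded_linear ((*\<^sub>C) c :: 'a::complex_inner \<Rightarrow> 'a)"
  by (rule bounded_linear_intro [where K = "cmod c"])
    (simp_all add: scaleC_add_right scaleC_scaleR norm_scaleC mult.commute)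

lemma cinner_add_right: "cinner x (y + z) = cinner x y + cinner x (z::'a::complex_inner)"
  by (metis cinner_add_left cinner_commute complex_cnj_add)

lemma cinner_scaleC_right: "cinner x (c *\<^sub>C y) = cnj c * cinner x (y::'a::complex_inner)"
  by (metis cinner_scaleC_left cinner_commute complex_cnj_mult)

lemma cinner_eqI:
  assumes "\<And>x. inner x y = inner x (z::'a::complex_inner)"
  shows "y = z"
  using assms [of "y - z"] by (metis inner_diff_right inner_eq_zero_iff right_minus_eq)

text \<open>The imaginary part at \<open>x\<close> is, up to sign, the real part at
  \<open>\<i> *\<^sub>C x\<close>. Adjoints can thus be found with the real inner product.\<close>

lemma cinner_eq_of_inner_eq:
  fixes T :: "'a::complex_inner \<Rightarrow> 'b::complex_inner" and S :: "'b \<Rightarrow> 'a"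
  assumes "\<And>c x. T (c *\<^sub>C x) = c *\<^sub>C T x" "\<And>x. inner (T x) y = inner x z"
  shows "cinner (T x) y = cinner x z"
proof (rule complex_eqI)
  show "Re (cinner (T x) y) = Re (cinner x z)"
    using assms(2) by (simp add: inner_eq_Re_cinner)
  have "inner (T (\<i> *\<^sub>C x)) y = inner (\<i> *\<^sub>C x) z" by (rule assms(2))
  then show "Im (cinner (T x) y) = Im (cinner x z)"
    by (simp add: inner_eq_Re_cinner assms(1) cinner_scaleC_left)
qed

lemma bounded_opsD: "T \<in> bounded_ops \<Longrightarrow> T (c *\<^sub>C x) = c *\<^sub>C T x"
  by (simp add: bounded_ops_def)

lemma zero_bounded_ops: "0 \<in> bounded_ops"
  by (simp add: bounded_ops_def)

lemma id_bounded_ops: "id_blinfun \<in> bounded_ops"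
  by (simp add: bounded_ops_def)

lemma add_bounded_ops: "S \<in> bounded_ops \<Longrightarrow> T \<in> bounded_ops \<Longrightarrow> S + T \<in> bounded_ops"
  by (simp add: bounded_ops_def blinfun.add_left scaleC_add_right)

lemma diff_bounded_ops: "S \<in> bounded_ops \<Longrightarrow> T \<in> bounded_ops \<Longrightarrow> S - T \<in> bounded_ops"
  by (simp add: bounded_ops_def blinfun.diff_left scaleC_diff_right)

lemma scaleR_bounded_ops: "T \<in> bounded_ops \<Longrightarrow> r *\<^sub>R T \<in> bounded_ops"
  by (simp add: bounded_ops_def blinfun.scaleR_left scaleC_scaleR)

lemma compose_bounded_ops: "S \<in> bounded_ops \<Longrightarrow> T \<in> bounded_ops \<Longrightarrow> S o\<^sub>L T \<in> bounded_ops"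
  by (simp add: bounded_ops_def)

lemma sum_bounded_ops: "(\<And>i. i \<in> I \<Longrightarrow> T i \<in> bounded_ops) \<Longrightarrow> (\<Sum>i\<in>I. T i) \<in> bounded_ops"
  by (induction I rule: infinite_finite_induct) (simp_all add: zero_bounded_ops add_bounded_ops)

lemma closed_bounded_ops: "closed (bounded_ops :: 'a::complex_inner operator set)"
proof -
  have eq: "(bounded_ops :: 'a operator set) = (\<Inter>c. \<Inter>x. {T :: 'a operator. T (c *\<^sub>C x) - c *\<^sub>C T x = 0})"
    by (auto simp: bounded_ops_def)
  have "closed {T :: 'a operator. T (c *\<^sub>C x) - c *\<^sub>C T x = 0}" for c x
    by (intro closed_Collect_eq continuous_intros
        bounded_linear.continuous_on [OF bounded_linear_scaleC])
  then show ?thesis unfolding eq by (intro closed_INT ballI)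
qed

text \<open>The minimiser of \<open>\<langle>Bx, x\<rangle> - 2 f x\<close> solves \<open>Bx = f\<close>; with \<open>B = 1\<close> this is the Riesz
  representation theorem.\<close>

lemma coercive_solve:
  fixes B :: "'h::{real_inner, complete_space} \<Rightarrow>\<^sub>L 'h"
  assumes sym: "\<And>x y. inner (B x) y = inner x (B y)" and c: "c > 0"
    and coercive: "\<And>x. inner (B x) x \<ge> c * (norm x)\<^sup>2" and f: "bounded_linear f"
  shows "\<exists>x. \<forall>y. inner (B x) y = f y"
proof -
  obtain K where K: "\<And>x. norm (f x) \<le> norm x * K"
    using bounded_linear.bounded [OF f] by blast
  define J where "J x = inner (B x) x - 2 * f x" for x
  have lin: "f (x + y) = f x + f y" "f (r *\<^sub>R x) = r * f x" for x y r
    using f by (simp_all add: linear_simps)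
  have lower: "- (K\<^sup>2 / c) \<le> J x" for x
  proof -
    have "0 \<le> (c * norm x - K)\<^sup>2 / c" using c by simp
    also have "\<dots> = c * (norm x)\<^sup>2 - 2 * (norm x * K) + K\<^sup>2 / c"
      using c by (simp add: power2_eq_square field_simps)
    finally show ?thesis using coercive [of x] K [of x] unfolding J_def by (auto simp: abs_le_iff)
  qed
  define m where "m = Inf (range J)"
  have bdd: "bdd_below (range J)" by (rule bdd_belowI2 [OF lower])
  have m: "m \<le> J x" for x unfolding m_def by (intro cInf_lower bdd) simp
  have "\<exists>x. J x < m + 1 / real (Suc n)" for n
    using cInf_less_iff [OF _ bdd, of "m + 1 / real (Suc n)"] by (auto simp: m_def)
  then obtain X where X: "\<And>n. J (X n) < m + 1 / real (Suc n)" by metis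
  \<comment> \<open>Parallelogram identity for the form of \<open>B\<close>, with \<open>J\<close>
    at the midpoint bounded below by \<open>m\<close>; it makes the minimising sequence
    Cauchy.\<close>
  have para: "c / 2 * (norm (x - y))\<^sup>2 \<le> J x + J y - 2 * m" for x y
  proof -
    have "J x + J y - 2 * J ((1 / 2) *\<^sub>R (x + y)) = inner (B (x - y)) (x - y) / 2"
      by (simp add: J_def lin blinfun.bilinear_simps inner_add_left inner_add_right inner_diff_left
          inner_diff_right sym inner_commute field_simps)
    then show ?thesis using m [of "(1 / 2) *\<^sub>R (x + y)"] coercive [of "x - y"] by simp
  qed
  have "Cauchy X"
  proof (rule metric_CauchyI)
    fix e :: real assume "e > 0"
    obtain N where N: "2 / (c / 2 * e\<^sup>2) < real N" using reals_Archimedean2 by blast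
    have "dist (X i) (X j) < e" if "i \<ge> N" "j \<ge> N" for i j
    proof -
      have N0: "0 < real N" using N c \<open>e > 0\<close> by (smt (verit) divide_pos_pos mult_pos_pos zero_less_power)
      have inv: "1 / real (Suc k) \<le> 1 / real N" if "k \<ge> N" for k
        using that N0 by (intro divide_left_mono mult_pos_pos) auto
      have "c / 2 * (norm (X i - X j))\<^sup>2 < 2 / real N"
        using para [of "X i" "X j"] X [of i] X [of j] inv [OF that(1)] inv [OF that(2)] by simp
      also have "\<dots> < c / 2 * e\<^sup>2" using N N0 c \<open>e > 0\<close> by (simp add: field_simps)
      finally have "(norm (X i - X j))\<^sup>2 < e\<^sup>2" using c by simp
      then show ?thesis using \<open>e > 0\<close> by (simp add: dist_norm power_less_imp_less_base)
    qed
    then show "\<exists>M. \<forall>i\<ge>M. \<forall>j\<ge>M. dist (X i) (X j) < e" by blast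
  qed
  then obtain z where z: "X \<longlonglongrightarrow> z" using Cauchy_convergent convergent_def by blast
  have "(\<lambda>n. J (X n)) \<longlonglongrightarrow> J z"
    unfolding J_def by (intro tendsto_intros z bounded_linear.tendsto [OF f])
  moreover have "(\<lambda>n. m + 1 / real (Suc n)) \<longlonglongrightarrow> m + 0"
    by (intro tendsto_intros LIMSEQ_Suc [OF lim_1_over_n])
  ultimately have "J z \<le> m + 0"
    by (rule LIMSEQ_le) (use X in \<open>blast intro: less_imp_le\<close>)
  then have min: "J z \<le> J x" for x using m [of x] by simp
  have "inner (B z) y = f y" for y
  proof -
    define d where "d = inner (B z) y - f y"
    define q where "q = inner (B y) y"
    have q: "q \<ge> 0" unfolding q_def
      using c by (intro order_trans [OF _ coercive]) simp
    have "inner (B y) z = inner (B z) y" by (metis sym inner_commute)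
    then have "J (z + t *\<^sub>R y) = J z + 2 * t * d + t\<^sup>2 * q" for t
      by (simp add: J_def d_def q_def lin blinfun.bilinear_simps inner_add_left inner_add_right
          power2_eq_square algebra_simps)
    then have "0 \<le> 2 * t * d + t\<^sup>2 * q" for t using min [of "z + t *\<^sub>R y"] by simp
    note ineq = this
    \<comment> \<open>At t = -u the linear term outweighs the quadratic one unless d = 0. Dividing
      by \<open>q + 1\<close> instead of \<open>q\<close> covers q = 0.\<close>
    define u where "u = d / (q + 1)"
    have d: "d = u * (q + 1)" using q by (simp add: u_def)
    have "2 * (- u) * d + (- u)\<^sup>2 * q = - (u\<^sup>2 * (q + 2))"
      by (simp add: d power2_eq_square algebra_simps)
    then have "u\<^sup>2 * (q + 2) \<le> 0" using ineq [of "- u"] by simp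
    then have "u = 0" using q by (simp add: mult_le_0_iff)
    then show ?thesis using d by (simp add: d_def)
  qed
  then show ?thesis by blast
qed

section \<open>Existence and algebra of adjoints\<close>

lemma adj_unique:
  fixes S T :: "'h::complex_inner operator"
  assumes "\<And>x y. cinner (T x) y = cinner x (S y)"
  shows "adj T = S"
  unfolding adj_def
proof (rule the_equality)
  fix S' :: "'h operator" assume "\<forall>x y. cinner (T x) y = cinner x (S' y)"
  then have "cinner x (S' y) = cinner x (S y)" for x y using assms by metis
  then show "S' = S" by (intro blinfun_eqI cinner_eqI) (simp add: inner_eq_Re_cinner)
qed (use assms in simp)

lemma adjoint_exists:
  fixes T :: "'h::chilbert_space operator"
  assumes "T \<in> bounded_ops"
  shows "\<exists>S :: 'h operator. \<forall>x y. cinner (T x) y = cinner x (S y)"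
proof -
  have "\<exists>s. \<forall>x. inner (id_blinfun s) x = inner (T x) y" for y
    by (rule coercive_solve [where c = 1])
      (auto simp: power2_norm_eq_inner intro!: bounded_linear_intros)
  then obtain s where s: "\<And>x y. inner (s y) x = inner (T x) y" by (metis blinfun_apply_id_blinfun id_apply)
  have s': "inner (T x) y = inner x (s y)" for x y by (metis s inner_commute)
  have "bounded_linear s"
  proof (rule bounded_linear_intro [where K = "norm T"])
    show "s (x + y) = s x + s y" for x y
      by (rule cinner_eqI) (simp add: s' [symmetric] inner_add_right)
    show "s (r *\<^sub>R x) = r *\<^sub>R s x" for r x
      by (rule cinner_eqI) (simp add: s' [symmetric])
    show "norm (s x) \<le> norm x * norm T" for x
    proof (cases "s x = 0")
      case False
      have "norm (s x) * norm (s x) = inner (T (s x)) x"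
        by (simp add: s' power2_norm_eq_inner [symmetric] power2_eq_square)
      also have "\<dots> \<le> norm (T (s x)) * norm x" by (rule norm_cauchy_schwarz)
      also have "\<dots> \<le> (norm T * norm (s x)) * norm x" by (intro mult_right_mono norm_blinfun) simp
      finally have "norm (s x) * norm (s x) \<le> norm (s x) * (norm x * norm T)" by (simp add: mult_ac)
      then show ?thesis using False by simp
    qed (simp add: mult_nonneg_nonneg)
  qed
  then have "Blinfun s x = s x" for x by (simp add: bounded_linear_Blinfun_apply)
  moreover have "cinner (T x) y = cinner x (s y)" for x y
    by (rule cinner_eq_of_inner_eq [OF bounded_opsD [OF assms] s'])
  ultimately show ?thesis by (intro exI [of _ "Blinfun s"]) simp
qed

lemma cinner_adj:
  fixes T :: "'h::chilbert_space operator"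
  assumes "T \<in> bounded_ops"
  shows "cinner (T x) y = cinner x (adj T y)"
  using adjoint_exists [OF assms] adj_unique [of T] by metis

lemma inner_adj:
  fixes T :: "'h::chilbert_space operator"
  assumes "T \<in> bounded_ops"
  shows "inner (T x) y = inner x (adj T y)"
  by (simp add: inner_eq_Re_cinner cinner_adj [OF assms])

lemma inner_adj_left:
  fixes T :: "'h::chilbert_space operator"
  assumes "T \<in> bounded_ops"
  shows "inner (adj T x) y = inner x (T y)"
  using inner_adj [OF assms, of y x] by (simp add: inner_commute)

lemma adj_bounded_ops:
  fixes T :: "'h::chilbert_space operator"
  assumes "T \<in> bounded_ops"
  shows "adj T \<in> bounded_ops"
  unfolding bounded_ops_def
proof (intro CollectI allI)
  fix c x
  have "cinner y (adj T (c *\<^sub>C x)) = cinner y (c *\<^sub>C adj T x)" for y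
    by (simp add: cinner_adj [OF assms, symmetric] cinner_scaleC_right)
  then show "adj T (c *\<^sub>C x) = c *\<^sub>C adj T x"
    by (intro cinner_eqI) (simp add: inner_eq_Re_cinner)
qed

lemma norm_adj_le:
  fixes T :: "'h::chilbert_space operator"
  assumes "T \<in> bounded_ops"
  shows "norm (adj T) \<le> norm T"
proof (rule norm_blinfun_bound)
  fix x
  show "norm (adj T x) \<le> norm T * norm x"
  proof (cases "adj T x = 0")
    case False
    have "norm (adj T x) * norm (adj T x) = inner (T (adj T x)) x"
      by (simp add: inner_adj [OF assms] power2_norm_eq_inner [symmetric] power2_eq_square)
    also have "\<dots> \<le> norm (T (adj T x)) * norm x" by (rule norm_cauchy_schwarz)
    also have "\<dots> \<le> (norm T * norm (adj T x)) * norm x" by (intro mult_right_mono norm_blinfun) simp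
    finally have "norm (adj T x) * norm (adj T x) \<le> norm (adj T x) * (norm T * norm x)"
      by (simp add: mult_ac)
    then show ?thesis using False by simp
  qed (simp add: mult_nonneg_nonneg)
qed simp

lemma adj_compose:
  fixes S T :: "'h::chilbert_space operator"
  assumes "S \<in> bounded_ops" "T \<in> bounded_ops"
  shows "adj (S o\<^sub>L T) = adj T o\<^sub>L adj S"
  by (rule adj_unique) (simp add: cinner_adj assms)

lemma adj_diff:
  fixes S T :: "'h::chilbert_space operator"
  assumes "S \<in> bounded_ops" "T \<in> bounded_ops"
  shows "adj (S - T) = adj S - adj T"
proof -
  have "cinner (x - y) z = cinner x z - cinner y z" for x y z :: 'h
    using cinner_add_left [of "x - y" y z] by (simp add: algebra_simps)
  moreover have "cinner z (x - y) = cinner z x - cinner z y" for x y z :: 'h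
    using cinner_add_right [of z "x - y" y] by (simp add: algebra_simps)
  ultimately show ?thesis
    by (intro adj_unique) (simp add: blinfun.diff_left cinner_adj assms)
qed

lemma adj_adj:
  fixes T :: "'h::chilbert_space operator"
  assumes "T \<in> bounded_ops"
  shows "adj (adj T) = T"
proof (rule adj_unique)
  show "cinner (adj T x) y = cinner x (T y)" for x y
    using cinner_adj [OF assms, of y x] by (metis cinner_commute)
qed

lemma inner_adj_self:
  fixes T :: "'h::chilbert_space operator"
  assumes "T \<in> bounded_ops"
  shows "inner ((adj T o\<^sub>L T) x) x = (norm (T x))\<^sup>2" "inner ((T o\<^sub>L adj T) x) x = (norm (adj T x))\<^sup>2"
  by (simp_all add: inner_adj_left [OF assms] inner_adj [OF assms] power2_norm_eq_inner)

lemma pos_cone_facts: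
  fixes A :: "'h::chilbert_space operator set"
  assumes "a \<in> pos_cone A" "A \<subseteq> bounded_ops"
  shows "a \<in> bounded_ops" "inner (a x) y = inner x (a y)" "inner (a x) x \<ge> 0"
proof -
  obtain x where x: "x \<in> bounded_ops" "a = adj x o\<^sub>L x" using assms by (auto simp: pos_cone_def)
  show "a \<in> bounded_ops" by (simp add: x compose_bounded_ops adj_bounded_ops)
  show "inner (a y) z = inner y (a z)" for y z
    by (simp add: x inner_adj inner_adj_left)
  show "inner (a y) y \<ge> 0" for y
    unfolding x(2) by (simp only: inner_adj_self [OF x(1)] zero_le_power2)
qed

section \<open>Functional calculus of positive operators\<close>

lemma op_poly_eq_sum:
  assumes "degree p \<le> n"
  shows "op_poly p T = (\<Sum>i\<le>n. coeff p i *\<^sub>R (((o\<^sub>L) T ^^ i) id_blinfun))"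
  unfolding op_poly_def
  by (rule sum.mono_neutral_left) (use assms in \<open>auto simp: coeff_eq_0\<close>)

lemma op_poly_0 [simp]: "op_poly 0 T = 0"
  by (simp add: op_poly_def)

lemma op_poly_pCons: "op_poly (pCons a p) T = a *\<^sub>R id_blinfun + (T o\<^sub>L op_poly p T)"
proof -
  have "degree (pCons a p) \<le> Suc (degree p)" by (rule degree_pCons_le)
  then have "op_poly (pCons a p) T
      = (\<Sum>i\<le>Suc (degree p). coeff (pCons a p) i *\<^sub>R (((o\<^sub>L) T ^^ i) id_blinfun))"
    by (rule op_poly_eq_sum)
  also have "\<dots> = a *\<^sub>R id_blinfun
      + (\<Sum>i\<le>degree p. coeff p i *\<^sub>R (T o\<^sub>L ((o\<^sub>L) T ^^ i) id_blinfun))"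
    by (subst sum.atMost_Suc_shift) simp
  also have "(\<Sum>i\<le>degree p. coeff p i *\<^sub>R (T o\<^sub>L ((o\<^sub>L) T ^^ i) id_blinfun)) = T o\<^sub>L op_poly p T"
    by (rule blinfun_eqI) (simp add: op_poly_def blinfun.sum_left blinfun.sum_right blinfun.bilinear_simps)
  finally show ?thesis .
qed

lemma op_poly_add: "op_poly (p + q) T = op_poly p T + op_poly q T"
proof (induction p arbitrary: q)
  case (pCons a p)
  show ?case
  proof (cases q)
    case (pCons b q')
    then show ?thesis
      by (simp add: op_poly_pCons pCons.IH blinfun_eqI blinfun.bilinear_simps scaleR_add_left)
  qed
qed simp

lemma op_poly_smult: "op_poly (smult c p) T = c *\<^sub>R op_poly p T"
  by (induction p) (auto intro!: blinfun_eqI simp: op_poly_pCons blinfun.bilinear_simps algebra_simps)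

lemma op_poly_diff: "op_poly (p - q) T = op_poly p T - op_poly q T"
  using op_poly_add [of p "smult (-1) q" T] op_poly_smult [of "-1" q T] by simp

lemma op_poly_minus: "op_poly (- p) T = - op_poly p T"
  using op_poly_smult [of "-1" p T] by simp

lemma op_poly_mult: "op_poly (p * q) T = op_poly p T o\<^sub>L op_poly q T"
proof (induction p)
  case (pCons a p)
  show ?case
    by (simp add: op_poly_pCons op_poly_add op_poly_smult pCons.IH mult_pCons_left)
      (rule blinfun_eqI, simp add: blinfun.bilinear_simps pCons.IH)
qed simp

lemma op_poly_linear_apply: "op_poly [:a, b:] T x = a *\<^sub>R x + b *\<^sub>R T x"
  by (simp add: op_poly_pCons blinfun.bilinear_simps)

lemma op_poly_quadratic_apply: "op_poly [:a, b, c:] T x = a *\<^sub>R x + b *\<^sub>R T x + c *\<^sub>R T (T x)"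
  by (simp add: op_poly_pCons blinfun.bilinear_simps)

lemma op_poly_symmetric:
  fixes T :: "'h::complex_inner operator"
  assumes "\<And>x y. inner (T x) y = inner x (T y)"
  shows "inner (op_poly p T x) y = inner x (op_poly p T y)"
proof (induction p arbitrary: x y)
  case (pCons a p)
  have "op_poly p T (T y) = T (op_poly p T y)" for y
  proof -
    have "op_poly (p * [:0, 1:]) T y = op_poly ([:0, 1:] * p) T y" by (simp add: mult.commute)
    then show ?thesis by (simp only: op_poly_mult blinfun_apply_blinfun_compose op_poly_linear_apply) simp
  qed
  then show ?case
    by (simp add: op_poly_pCons blinfun.bilinear_simps inner_add_left inner_add_right assms pCons.IH)
qed simp

section \<open>Spectrum and numerical range of symmetric operators\<close>

lemma not_bounded_below_factor:
  assumes "\<forall>c>0. \<exists>x. norm (op_poly (q * r) T x) < c * norm x" "d > 0"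
    and "\<And>x. norm (op_poly q T x) \<ge> d * norm x"
  shows "\<forall>c>0. \<exists>x. norm (op_poly r T x) < c * norm x"
proof (intro allI impI)
  fix c :: real assume "c > 0"
  with assms(1,2) obtain x where x: "norm (op_poly (q * r) T x) < d * c * norm x"
    by (metis mult_pos_pos)
  have "d * norm (op_poly r T x) \<le> norm (op_poly (q * r) T x)"
    using assms(3) [of "op_poly r T x"] by (simp add: op_poly_mult)
  with x have "d * norm (op_poly r T x) < d * (c * norm x)" by (simp add: mult.assoc)
  then show "\<exists>x. norm (op_poly r T x) < c * norm x" using \<open>d > 0\<close> by auto
qed

lemma map_poly_of_real_add:
  "map_poly complex_of_real (p + q) = map_poly complex_of_real p + map_poly complex_of_real q"
  by (simp add: poly_eq_iff coeff_map_poly)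

lemma map_poly_of_real_mult:
  "map_poly complex_of_real (p * q) = map_poly complex_of_real p * map_poly complex_of_real q"
  by (simp add: poly_eq_iff coeff_map_poly coeff_mult)

lemma poly_map_poly_of_real: "poly (map_poly complex_of_real p) (complex_of_real x) = complex_of_real (poly p x)"
  by (induction p) (simp_all add: map_poly_pCons)

text \<open>One half of the spectral mapping theorem, by splitting off factors that are bounded
  below. At a real root outside the spectrum the linear factor is invertible. If there is no real
  root, a complex root yields a real quadratic factor, which is bounded below because
  \<open>T\<close> is symmetric. In the end a constant would have to fail to be bounded
  below.\<close>

lemma not_bounded_below_imp_root:
  fixes T :: "'h::complex_inner operator"
  assumes sym: "\<And>x y. inner (T x) y = inner x (T y)"
  shows "r \<noteq> 0 \<Longrightarrow> \<forall>c>0. \<exists>x. norm (op_poly r T x) < c * norm x \<Longrightarrow>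
    \<exists>t. poly r t = 0 \<and> complex_of_real t \<in> spectrum T"
proof (induction "degree r" arbitrary: r rule: less_induct)
  case less
  note nbb = less.prems(2)
  show ?case
  proof (cases "degree r = 0")
    case True
    then obtain a where a: "r = [:a:]" by (metis degree_eq_zeroE)
    then have "\<bar>a\<bar> > 0" using less.prems(1) by simp
    with nbb obtain x where "norm (op_poly r T x) < \<bar>a\<bar> * norm x" by blast
    then show ?thesis by (simp add: a op_poly_pCons blinfun.bilinear_simps)
  next
    case False
    show ?thesis
    proof (cases "\<exists>t. poly r t = 0")
      case True
      then obtain t where t: "poly r t = 0" by blast
      show ?thesis
      proof (cases "complex_of_real t \<in> spectrum T")
        case False
        then obtain S :: "'h operator" where
          S: "\<And>x. S (T x - complex_of_real t *\<^sub>C x) = x" by (auto simp: spectrum_def)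
        obtain s where s: "r = [:-t, 1:] * s" using t by (auto simp: poly_eq_0_iff_dvd dvd_def)
        then have s0: "s \<noteq> 0" using less.prems(1) by auto
        have "degree r = degree [:-t, 1:] + degree s"
          unfolding s by (rule degree_mult_eq) (use s0 in auto)
        then have deg: "degree s < degree r" by simp
        define d where "d = 1 / (norm S + 1)"
        have d: "d > 0" by (simp add: d_def add_nonneg_pos)
        have "norm (op_poly [:-t, 1:] T x) \<ge> d * norm x" for x
        proof -
          have "norm x = norm (S (op_poly [:-t, 1:] T x))"
            using S [of x] by (simp add: op_poly_linear_apply scaleR_scaleC [symmetric])
          also have "\<dots> \<le> norm S * norm (op_poly [:-t, 1:] T x)" by (rule norm_blinfun)
          also have "\<dots> \<le> (norm S + 1) * norm (op_poly [:-t, 1:] T x)"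
            by (intro mult_right_mono) auto
          finally show ?thesis
            using norm_ge_zero [of S] by (simp add: d_def pos_divide_le_eq add_nonneg_pos mult.commute)
        qed
        from not_bounded_below_factor [OF nbb [unfolded s] d this]
        obtain u where "poly s u = 0 \<and> complex_of_real u \<in> spectrum T"
          using less.hyps [OF deg s0] by blast
        then show ?thesis by (auto simp: s)
      qed (use t in blast)
    next
      case noroot: False
      let ?R = "map_poly complex_of_real r"
      have "degree ?R > 0" using False by (subst degree_map_poly) auto
      then have "\<not> constant (poly ?R)" by (metis constant_degree less_numeral_extra(3))
      then obtain z where z: "poly ?R z = 0" using fundamental_theorem_of_algebra by blast
      have Im: "Im z \<noteq> 0"
      proof
        assume "Im z = 0"
        then have "z = complex_of_real (Re z)" by (simp add: complex_eq_iff)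
        then have "complex_of_real (poly r (Re z)) = 0" using z by (metis poly_map_poly_of_real)
        then show False using noroot by simp
      qed
      define a b where "a = Re z" and "b = Im z"
      \<comment> \<open>The real polynomial with roots \<open>z\<close> and its conjugate, that is,
        the square of X - a plus the square of b.\<close>
      define q where "q = [:a\<^sup>2 + b\<^sup>2, -2 * a, 1:]"
      have degq: "degree q = 2" and q0: "q \<noteq> 0" by (simp_all add: q_def)
      define s m where "s = r div q" and "m = r mod q"
      have rsm: "r = q * s + m" by (simp add: s_def m_def)
      have "degree m < 2" unfolding m_def using degree_mod_less [OF q0, of r] degq by auto
      then have m: "m = [:coeff m 0, coeff m 1:]"
        by (intro poly_eqI) (auto simp: coeff_pCons coeff_eq_0 split: nat.split)
      define u v where "u = coeff m 0" and "v = coeff m 1"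
      have m: "m = [:u, v:]" unfolding u_def v_def by (rule m)
      \<comment> \<open>The remainder \<open>m\<close> is real, of degree below 2, and vanishes at
        the non-real point \<open>z\<close>; hence it is zero and \<open>q\<close> divides
        \<open>r\<close>.\<close>
      have "poly (map_poly complex_of_real q) z = 0"
        by (simp add: q_def map_poly_pCons complex_eq_iff a_def b_def power2_eq_square algebra_simps)
      then have "poly (map_poly complex_of_real m) z = 0"
        using z unfolding rsm by (simp add: map_poly_of_real_add map_poly_of_real_mult)
      then have "complex_of_real u + z * complex_of_real v = 0" by (simp add: m map_poly_pCons)
      then have "u + Re z * v = 0" "v = 0" using Im by (auto simp: complex_eq_iff)
      then have "m = 0" by (simp add: m)
      then have r: "r = q * s" using rsm by simp
      then have s0: "s \<noteq> 0" and deg: "degree s < degree r"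
        using less.prems(1) q0 degq by (auto simp: degree_mult_eq)
      have d: "b\<^sup>2 > 0" using Im by (simp add: b_def)
      have "norm (op_poly q T x) \<ge> b\<^sup>2 * norm x" for x
      proof (cases "x = 0")
        case False
        have "inner (op_poly q T x) x = (norm (T x - a *\<^sub>R x))\<^sup>2 + b\<^sup>2 * (norm x)\<^sup>2"
          using sym [of "T x" x]
          by (simp add: q_def op_poly_quadratic_apply power2_norm_eq_inner inner_add_left
              inner_diff_left inner_diff_right inner_commute power2_eq_square [of a]
              power2_eq_square [of b] algebra_simps)
        then have "b\<^sup>2 * norm x * norm x \<le> inner (op_poly q T x) x"
          by (simp add: power2_eq_square)
        also have "\<dots> \<le> norm (op_poly q T x) * norm x" by (rule norm_cauchy_schwarz)
        finally show ?thesis using False by simp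
      qed simp
      from not_bounded_below_factor [OF nbb [unfolded r] d this]
      obtain u where "poly s u = 0 \<and> complex_of_real u \<in> spectrum T"
        using less.hyps [OF deg s0] by blast
      then show ?thesis by (auto simp: r)
    qed
  qed
qed

text \<open>Positivity of the form at \<open>x - s *\<^sub>R M x\<close> with s = 1 / norm M takes
  the place of a square root of \<open>M\<close>. The use: a unit vector at which the form is small
  is almost annihilated by \<open>M\<close>.\<close>

lemma positive_norm_sq_le:
  fixes M :: "'h::real_inner \<Rightarrow>\<^sub>L 'h"
  assumes sym: "\<And>x y. inner (M x) y = inner x (M y)" and pos: "\<And>x. inner (M x) x \<ge> 0"
  shows "(norm (M x))\<^sup>2 \<le> norm M * inner (M x) x"
proof (cases "M = 0")
  case False
  then have n: "norm M > 0" by simp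
  define s where "s = 1 / norm M"
  have "0 \<le> inner (M (x - s *\<^sub>R M x)) (x - s *\<^sub>R M x)" by (rule pos)
  also have "\<dots> = inner (M x) x - 2 * s * (norm (M x))\<^sup>2 + s\<^sup>2 * inner (M (M x)) (M x)"
    using sym [of "M x" x]
    by (simp add: blinfun.bilinear_simps inner_diff_left inner_diff_right power2_norm_eq_inner
        power2_eq_square [of s] algebra_simps)
  also have "inner (M (M x)) (M x) \<le> norm M * (norm (M x))\<^sup>2"
    using order_trans [OF norm_cauchy_schwarz mult_right_mono [OF norm_blinfun [of M "M x"] norm_ge_zero]]
    by (simp add: power2_eq_square mult.assoc)
  finally have "0 \<le> inner (M x) x - 2 * s * (norm (M x))\<^sup>2 + s\<^sup>2 * (norm M * (norm (M x))\<^sup>2)"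
    by (simp add: mult_left_mono)
  also have "\<dots> = inner (M x) x - s * (norm (M x))\<^sup>2"
    using n by (simp add: s_def power2_eq_square field_simps)
  finally show ?thesis using n by (simp add: s_def field_simps)
qed simp

text \<open>The infimum \<open>l\<close> of the numerical range of p(T) is an approximate
  eigenvalue, since near-minimisers are almost annihilated by p(T) - l. Hence p - l has a root in
  the spectrum, where \<open>p\<close> takes the value \<open>l\<close>. Non-constancy ensures that
  p - l is not the zero polynomial.\<close>

lemma spectrum_numerical_range_nonconstant:
  fixes T :: "'h::complex_inner operator"
  assumes sym: "\<And>x y. inner (T x) y = inner x (T y)" and "degree p > 0" "(x::'h) \<noteq> 0"
  shows "\<exists>t. complex_of_real t \<in> spectrum T \<and> poly p t * (norm x)\<^sup>2 \<le> inner (op_poly p T x) x"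
proof -
  define W where "W = (\<lambda>x. inner (op_poly p T x) x) ` {x. norm x = 1}"
  define l where "l = Inf W"
  have unit: "norm (inverse (norm y) *\<^sub>R y) = 1" if "y \<noteq> 0" for y :: 'h using that by simp
  have ne: "W \<noteq> {}" unfolding W_def using unit [OF assms(3)] by blast
  have bdd: "bdd_below W"
  proof (rule bdd_belowI [of _ "- norm (op_poly p T)"])
    fix w assume "w \<in> W"
    then obtain y where y: "norm y = 1" "w = inner (op_poly p T y) y" by (auto simp: W_def)
    have "\<bar>w\<bar> \<le> norm (op_poly p T y) * norm y" unfolding y(2) by (rule Cauchy_Schwarz_ineq2)
    also have "\<dots> \<le> norm (op_poly p T)" using norm_blinfun [of "op_poly p T" y] y(1) by simp
    finally show "- norm (op_poly p T) \<le> w" by linarith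
  qed
  have low: "l * (norm y)\<^sup>2 \<le> inner (op_poly p T y) y" for y
  proof (cases "y = 0")
    case False
    have "l \<le> inner (op_poly p T (inverse (norm y) *\<^sub>R y)) (inverse (norm y) *\<^sub>R y)"
      unfolding l_def W_def using unit [OF False]
      by (intro cInf_lower bdd [unfolded W_def]) (rule imageI, simp)
    then show ?thesis using False
      by (simp add: blinfun.bilinear_simps power2_eq_square field_simps)
  qed simp
  define r where "r = p - [:l:]"
  have r0: "r \<noteq> 0"
  proof
    assume "r = 0"
    then have "p = [:l:]" by (simp add: r_def)
    then show False using assms(2) by simp
  qed
  let ?M = "op_poly r T"
  have M: "?M y = op_poly p T y - l *\<^sub>R y" for y
    by (simp add: r_def op_poly_diff op_poly_pCons blinfun.bilinear_simps)
  have Msym: "inner (?M x) y = inner x (?M y)" for x y by (rule op_poly_symmetric [OF sym])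
  have Mq: "inner (?M y) y = inner (op_poly p T y) y - l * (norm y)\<^sup>2" for y
    by (simp add: M inner_diff_left power2_norm_eq_inner)
  have Mpos: "inner (?M y) y \<ge> 0" for y using low [of y] by (simp add: Mq)
  have "\<exists>y. norm (?M y) < c * norm y" if c: "c > 0" for c
  proof -
    have "c\<^sup>2 / (norm ?M + 1) > 0" using c by (simp add: add_nonneg_pos)
    then have "l < l + c\<^sup>2 / (norm ?M + 1)" by simp
    then obtain w where "w \<in> W" "w < l + c\<^sup>2 / (norm ?M + 1)"
      unfolding l_def using cInf_less_iff [OF ne bdd] by blast
    then obtain y where y: "norm y = 1" "inner (?M y) y < c\<^sup>2 / (norm ?M + 1)"
      by (auto simp: W_def Mq)
    have "(norm (?M y))\<^sup>2 \<le> norm ?M * inner (?M y) y" by (rule positive_norm_sq_le [OF Msym Mpos])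
    also have "\<dots> \<le> (norm ?M + 1) * inner (?M y) y" by (intro mult_right_mono Mpos) simp
    also have "\<dots> < c\<^sup>2"
      using y(2) norm_ge_zero [of ?M] by (simp add: pos_less_divide_eq add_nonneg_pos mult.commute)
    finally have "norm (?M y) < c" using c by (simp add: power_less_imp_less_base)
    then show ?thesis using y(1) by (intro exI [of _ y]) simp
  qed
  then obtain t where "poly r t = 0" "complex_of_real t \<in> spectrum T"
    using not_bounded_below_imp_root [OF sym r0] by blast
  then show ?thesis using low [of x] by (intro exI [of _ t]) (simp add: r_def)
qed

lemma spectrum_numerical_range:
  fixes T :: "'h::complex_inner operator"
  assumes sym: "\<And>x y. inner (T x) y = inner x (T y)" and "(x::'h) \<noteq> 0"
  shows "\<exists>t. complex_of_real t \<in> spectrum T \<and> poly p t * (norm x)\<^sup>2 \<le> inner (op_poly p T x) x"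
proof (cases "degree p = 0")
  case True
  then obtain a where a: "p = [:a:]" by (metis degree_eq_zeroE)
  \<comment> \<open>For a constant polynomial any real point of the spectrum will do; the polynomial
    X supplies one.\<close>
  obtain t where "complex_of_real t \<in> spectrum T"
    using spectrum_numerical_range_nonconstant [OF sym _ assms(2), where p = "[:0, 1:]"] by auto
  then show ?thesis
    by (auto simp: a op_poly_pCons blinfun.bilinear_simps power2_norm_eq_inner)
qed (use spectrum_numerical_range_nonconstant [OF sym _ assms(2)] in blast)

lemma op_poly_lower_bound:
  fixes T :: "'h::complex_inner operator"
  assumes sym: "\<And>x y. inner (T x) y = inner x (T y)"
    and "\<And>t. complex_of_real t \<in> spectrum T \<Longrightarrow> c \<le> poly p t"
  shows "c * (norm x)\<^sup>2 \<le> inner (op_poly p T x) x"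
proof (cases "x = 0")
  case False
  then obtain t where t: "complex_of_real t \<in> spectrum T" "poly p t * (norm x)\<^sup>2 \<le> inner (op_poly p T x) x"
    using spectrum_numerical_range [OF sym] by blast
  then show ?thesis using mult_right_mono [OF assms(2) [OF t(1)], of "(norm x)\<^sup>2"] by simp
qed simp

text \<open>The lower bound applied to \<open>- (p * p)\<close> controls the square of the norm of
  p(T) x directly, without a spectral radius formula.\<close>

lemma op_poly_norm_le:
  fixes T :: "'h::complex_inner operator"
  assumes sym: "\<And>x y. inner (T x) y = inner x (T y)" and "c \<ge> 0"
    and bd: "\<And>t. complex_of_real t \<in> spectrum T \<Longrightarrow> \<bar>poly p t\<bar> \<le> c"
  shows "norm (op_poly p T) \<le> c"
proof (rule norm_blinfun_bound [OF \<open>c \<ge> 0\<close>])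
  fix x
  have "- c\<^sup>2 * (norm x)\<^sup>2 \<le> inner (op_poly (- (p * p)) T x) x"
  proof (rule op_poly_lower_bound [OF sym])
    fix t assume "complex_of_real t \<in> spectrum T"
    then have "\<bar>poly p t\<bar>\<^sup>2 \<le> c\<^sup>2" by (intro power_mono bd) auto
    then show "- c\<^sup>2 \<le> poly (- (p * p)) t" by (simp add: power2_eq_square)
  qed
  then have "(norm (op_poly p T x))\<^sup>2 \<le> (c * norm x)\<^sup>2"
    by (simp add: op_poly_minus op_poly_mult blinfun.bilinear_simps op_poly_symmetric [OF sym]
        power2_norm_eq_inner power_mult_distrib)
  then show "norm (op_poly p T x) \<le> c * norm x"
    by (rule power2_le_imp_le) (use \<open>c \<ge> 0\<close> in simp)
qed

text \<open>The symmetric case of Lax-Milgram: \<open>coercive_solve\<close> gives surjectivity, and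
  coercivity bounds \<open>B\<close> below by \<open>c\<close>, which gives injectivity and the
  bound 1 / c for the inverse.\<close>

lemma coercive_inverse:
  fixes B :: "'h::chilbert_space operator"
  assumes sym: "\<And>x y. inner (B x) y = inner x (B y)" and c: "c > 0"
    and coercive: "\<And>x. inner (B x) x \<ge> c * (norm x)\<^sup>2" and B: "B \<in> bounded_ops"
  shows "\<exists>S\<in>bounded_ops. \<forall>x. S (B x) = x \<and> B (S x) = x"
proof -
  have "\<exists>x. \<forall>z. inner (B x) z = inner y z" for y
    by (rule coercive_solve [OF sym c coercive]) (rule bounded_linear_inner_right)
  then have "\<exists>x. B x = y" for y by (metis cinner_eqI inner_commute)
  then obtain s where s: "\<And>y. B (s y) = y" by metis
  have low: "c * norm x \<le> norm (B x)" for x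
  proof (cases "x = 0")
    case False
    have "c * norm x * norm x \<le> norm (B x) * norm x"
      using order_trans [OF coercive norm_cauchy_schwarz, of x] by (simp add: power2_eq_square mult.assoc)
    then show ?thesis using False by simp
  qed simp
  have inj: "x = y" if "B x = B y" for x y
    using low [of "x - y"] c that by (simp add: blinfun.bilinear_simps mult_le_0_iff)
  have sB: "s (B x) = x" for x by (rule inj) (simp add: s)
  have "bounded_linear s"
  proof (rule bounded_linear_intro [where K = "1 / c"])
    show "s (x + y) = s x + s y" for x y by (rule inj) (simp add: s blinfun.bilinear_simps)
    show "s (r *\<^sub>R x) = r *\<^sub>R s x" for r x by (rule inj) (simp add: s blinfun.bilinear_simps)
    show "norm (s x) \<le> norm x * (1 / c)" for x using low [of "s x"] c by (simp add: s field_simps)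
  qed
  then have S: "Blinfun s x = s x" for x by (simp add: bounded_linear_Blinfun_apply)
  have "s (k *\<^sub>C x) = k *\<^sub>C s x" for k x
    by (rule inj) (simp add: s bounded_opsD [OF B])
  then show ?thesis by (intro bexI [of _ "Blinfun s"]) (auto simp: S s sB bounded_ops_def)
qed

text \<open>The factor \<open>s\<close> is used as a sign: 1 for points below the numerical range
  and -1 for points above it, so that both bounds in \<open>spectrum_positive\<close> come from one
  argument.\<close>

lemma coercive_imp_not_spectrum:
  fixes T :: "'h::chilbert_space operator"
  assumes sym: "\<And>x y. inner (T x) y = inner x (T y)" and T: "T \<in> bounded_ops" and c: "c > 0"
    and coercive: "\<And>x. c * (norm x)\<^sup>2 \<le> s * inner (T x - t *\<^sub>R x) x"
  shows "complex_of_real t \<notin> spectrum T"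
proof -
  define B where "B = s *\<^sub>R (T - t *\<^sub>R id_blinfun)"
  have B: "B x = s *\<^sub>R (T x - t *\<^sub>R x)" for x by (simp add: B_def blinfun.bilinear_simps)
  have "\<exists>S\<in>bounded_ops. \<forall>x. S (B x) = x \<and> B (S x) = x"
  proof (rule coercive_inverse [OF _ c])
    show "inner (B x) y = inner x (B y)" for x y
      by (simp add: B inner_diff_left inner_diff_right sym)
    show "c * (norm x)\<^sup>2 \<le> inner (B x) x" for x using coercive [of x] by (simp add: B)
    show "B \<in> bounded_ops" unfolding B_def
      by (intro diff_bounded_ops scaleR_bounded_ops T id_bounded_ops)
  qed
  then obtain S where S: "S \<in> bounded_ops" "\<And>x. S (B x) = x" "\<And>x. B (S x) = x" by blast
  have "(s *\<^sub>R S) (T x - complex_of_real t *\<^sub>C x) = x"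
    "T ((s *\<^sub>R S) x) - complex_of_real t *\<^sub>C (s *\<^sub>R S) x = x" for x
    using S(2,3) [of x] by (simp_all add: B blinfun.bilinear_simps scaleR_scaleC [symmetric] algebra_simps)
  then show ?thesis using scaleR_bounded_ops [OF S(1), of s] unfolding spectrum_def by blast
qed

lemma spectrum_positive:
  fixes T :: "'h::chilbert_space operator"
  assumes sym: "\<And>x y. inner (T x) y = inner x (T y)" and pos: "\<And>x. inner (T x) x \<ge> 0"
    and T: "T \<in> bounded_ops" and t: "complex_of_real t \<in> spectrum T"
  shows "0 \<le> t" "t \<le> norm T"
proof -
  have "- t * (norm x)\<^sup>2 \<le> 1 * inner (T x - t *\<^sub>R x) x" for x
    using pos [of x] by (simp add: inner_diff_left power2_norm_eq_inner)
  then show "0 \<le> t" using coercive_imp_not_spectrum [OF sym T, of "- t"] t by fastforce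
  have "(t - norm T) * (norm x)\<^sup>2 \<le> - 1 * inner (T x - t *\<^sub>R x) x" for x
    using order_trans [OF norm_cauchy_schwarz mult_right_mono [OF norm_blinfun [of T x] norm_ge_zero [of x]]]
    by (simp add: inner_diff_left power2_norm_eq_inner [symmetric] left_diff_distrib power2_eq_square mult.assoc)
  then show "t \<le> norm T" using coercive_imp_not_spectrum [OF sym T, of "t - norm T"] t by fastforce
qed

section \<open>Continuous functions of a positive operator and the cut-down\<close>

lemma polynomial_uniform_limit:
  fixes f :: "real \<Rightarrow> real"
  assumes "continuous_on {a..b} f"
  shows "\<exists>p. \<forall>n t. t \<in> {a..b} \<longrightarrow> \<bar>poly (p n) t - f t\<bar> < 1 / real (Suc n)"
proof -
  have "\<exists>p. \<forall>t\<in>{a..b}. \<bar>poly p t - f t\<bar> < 1 / real (Suc n)" for n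
  proof -
    obtain g where g: "real_polynomial_function g" "\<And>x. x \<in> {a..b} \<Longrightarrow> \<bar>f x - g x\<bar> < 1 / real (Suc n)"
      using Stone_Weierstrass_real_polynomial_function [OF compact_Icc assms, of "1 / real (Suc n)"] by auto
    obtain c m where "g = (\<lambda>x. \<Sum>i\<le>m. c i * x ^ i)" using g(1) by (auto simp: real_polynomial_function_iff_sum)
    then have "poly (\<Sum>i\<le>m. monom (c i) i) x = g x" for x by (simp add: poly_sum poly_monom)
    then show ?thesis using g(2) by (intro exI [of _ "\<Sum>i\<le>m. monom (c i) i"]) (simp add: abs_minus_commute)
  qed
  then show ?thesis by metis
qed

text \<open>Two polynomials close to \<open>f\<close> on the spectrum have close values at
  \<open>T\<close>, by \<open>op_poly_norm_le\<close>. This yields at once convergence along one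
  sequence and independence of the sequence, which is what the definite description in
  \<open>fun_calc\<close> requires. The explicit rate lets inequalities on the spectrum pass to the
  limit.\<close>

lemma fun_calc_limit:
  fixes T :: "'h::chilbert_space operator"
  assumes sym: "\<And>x y. inner (T x) y = inner x (T y)" and pos: "\<And>x. inner (T x) x \<ge> 0"
    and T: "T \<in> bounded_ops" and f: "continuous_on {0..norm T} f"
  shows "\<exists>p. (\<forall>n t. complex_of_real t \<in> spectrum T \<longrightarrow> \<bar>poly (p n) t - f t\<bar> < 1 / real (Suc n)) \<and>
    (\<lambda>n. op_poly (p n) T) \<longlonglongrightarrow> fun_calc f T"
proof -
  let ?K = "{t. complex_of_real t \<in> spectrum T}"
  have K: "?K \<subseteq> {0..norm T}" using spectrum_positive [OF sym pos T] by auto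
  obtain p where p: "\<And>n t. t \<in> ?K \<Longrightarrow> \<bar>poly (p n) t - f t\<bar> < 1 / real (Suc n)"
    using polynomial_uniform_limit [OF f] K by (metis subsetD)
  have dist: "dist (op_poly r T) (op_poly s T) \<le> d + e"
    if "\<And>t. t \<in> ?K \<Longrightarrow> \<bar>poly r t - f t\<bar> \<le> d" "\<And>t. t \<in> ?K \<Longrightarrow> \<bar>poly s t - f t\<bar> \<le> e" "d \<ge> 0" "e \<ge> 0"
    for r s d e
    unfolding dist_norm op_poly_diff [symmetric]
  proof (rule op_poly_norm_le [OF sym])
    fix t assume "complex_of_real t \<in> spectrum T"
    then show "\<bar>poly (r - s) t\<bar> \<le> d + e" using that(1) [of t] that(2) [of t] by simp
  qed (use that in simp)
  have inv: "\<exists>N. \<forall>n\<ge>N. 1 / real (Suc n) < e" if "e > 0" for e :: real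
    using LIMSEQ_D [OF LIMSEQ_Suc [OF lim_1_over_n [where 'a = real]] that] by auto
  have "Cauchy (\<lambda>n. op_poly (p n) T)"
  proof (rule metric_CauchyI)
    fix e :: real assume "e > 0"
    then obtain N where N: "\<And>n. n \<ge> N \<Longrightarrow> 1 / real (Suc n) < e / 2" using inv [of "e / 2"] by auto
    have "dist (op_poly (p i) T) (op_poly (p j) T) < e" if "i \<ge> N" "j \<ge> N" for i j
      using dist [of "p i" "1 / real (Suc i)" "p j" "1 / real (Suc j)"] p N [OF that(1)] N [OF that(2)]
      by (force intro: less_imp_le)
    then show "\<exists>M. \<forall>i\<ge>M. \<forall>j\<ge>M. dist (op_poly (p i) T) (op_poly (p j) T) < e" by blast
  qed
  then obtain S where S: "(\<lambda>n. op_poly (p n) T) \<longlonglongrightarrow> S" using Cauchy_convergent convergent_def by blast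
  have all: "(\<lambda>n. op_poly (q n) T) \<longlonglongrightarrow> S" if q: "uniform_limit ?K (\<lambda>n. poly (q n)) f sequentially" for q
  proof (rule metric_LIMSEQ_I)
    fix e :: real assume e: "e > 0"
    obtain N1 where N1: "\<And>n. n \<ge> N1 \<Longrightarrow> 1 / real (Suc n) < e / 3" using inv [of "e / 3"] e by auto
    obtain N2 where N2: "\<And>n t. n \<ge> N2 \<Longrightarrow> t \<in> ?K \<Longrightarrow> dist (poly (q n) t) (f t) < e / 3"
      using uniform_limitD [OF q, of "e / 3"] e unfolding eventually_sequentially by auto
    obtain N3 where N3: "\<And>n. n \<ge> N3 \<Longrightarrow> dist (op_poly (p n) T) S < e / 3"
      using metric_LIMSEQ_D [OF S, of "e / 3"] e by auto
    have "dist (op_poly (q n) T) S < e" if n: "n \<ge> max N1 (max N2 N3)" for n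
    proof -
      have "dist (op_poly (q n) T) (op_poly (p n) T) \<le> e / 3 + 1 / real (Suc n)"
      proof (rule dist)
        show "\<bar>poly (q n) t - f t\<bar> \<le> e / 3" if "t \<in> ?K" for t
          using N2 [OF _ that, of n] n by (simp add: dist_real_def)
        show "\<bar>poly (p n) t - f t\<bar> \<le> 1 / real (Suc n)" if "t \<in> ?K" for t
          using p [OF that, of n] by simp
      qed (use e in auto)
      then show ?thesis
        using N1 [of n] N3 [of n] n dist_triangle [of "op_poly (q n) T" S "op_poly (p n) T"] by simp
    qed
    then show "\<exists>N. \<forall>n\<ge>N. dist (op_poly (q n) T) S < e" by blast
  qed
  have unif: "uniform_limit ?K (\<lambda>n. poly (p n)) f sequentially"
  proof (rule uniform_limitI)
    fix e :: real assume "e > 0"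
    then obtain N where "\<And>n. n \<ge> N \<Longrightarrow> 1 / real (Suc n) < e" using inv by blast
    then show "\<forall>\<^sub>F n in sequentially. \<forall>t\<in>?K. dist (poly (p n) t) (f t) < e"
      unfolding eventually_sequentially using p
      by (intro exI [of _ N]) (force simp: dist_real_def intro: less_trans)
  qed
  have "fun_calc f T = S"
    unfolding fun_calc_def
  proof (rule the_equality)
    show "\<forall>q. uniform_limit ?K (\<lambda>n. poly (q n)) f sequentially \<longrightarrow> (\<lambda>n. op_poly (q n) T) \<longlonglongrightarrow> S"
      using all by blast
    show "S' = S" if "\<forall>q. uniform_limit ?K (\<lambda>n. poly (q n)) f sequentially \<longrightarrow> (\<lambda>n. op_poly (q n) T) \<longlonglongrightarrow> S'" for S'
      using that unif S LIMSEQ_unique by blast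
  qed
  then show ?thesis using p S by blast
qed

text \<open>These are the limits of polynomial forms of t - \<epsilon> \<le> max (t - \<epsilon>) 0
  \<le> t on the spectrum. The upper estimate uses that the spectrum of a positive operator has no
  negative real points.\<close>

lemma cut_down_bounds:
  fixes T :: "'h::chilbert_space operator"
  assumes sym: "\<And>x y. inner (T x) y = inner x (T y)" and pos: "\<And>x. inner (T x) x \<ge> 0"
    and T: "T \<in> bounded_ops" and "\<epsilon> > 0"
  shows "inner (cut_down T \<epsilon> x) x \<le> inner (T x) x"
    and "inner (T x) x - \<epsilon> * (norm x)\<^sup>2 \<le> inner (cut_down T \<epsilon> x) x"
proof -
  let ?f = "\<lambda>t::real. max (t - \<epsilon>) 0"
  have "continuous_on {0..norm T} ?f" by (intro continuous_intros)
  then obtain p where p: "\<And>n t. complex_of_real t \<in> spectrum T \<Longrightarrow> \<bar>poly (p n) t - ?f t\<bar> < 1 / real (Suc n)"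
    and lim: "(\<lambda>n. op_poly (p n) T) \<longlonglongrightarrow> cut_down T \<epsilon>"
    unfolding cut_down_def using fun_calc_limit [OF sym pos T] by metis
  have lim': "(\<lambda>n. inner (op_poly (p n) T x) x) \<longlonglongrightarrow> inner (cut_down T \<epsilon> x) x"
    by (intro tendsto_intros lim)
  have inv: "(\<lambda>n. 1 / real (Suc n) * (norm x)\<^sup>2) \<longlonglongrightarrow> 0 * (norm x)\<^sup>2"
    by (intro tendsto_intros LIMSEQ_Suc [OF lim_1_over_n])
  have up: "inner (op_poly (p n) T x) x \<le> inner (T x) x + 1 / real (Suc n) * (norm x)\<^sup>2" for n
  proof -
    have "- (1 / real (Suc n)) * (norm x)\<^sup>2 \<le> inner (op_poly ([:0, 1:] - p n) T x) x"
    proof (rule op_poly_lower_bound [OF sym])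
      fix t assume t: "complex_of_real t \<in> spectrum T"
      show "- (1 / real (Suc n)) \<le> poly ([:0, 1:] - p n) t"
        using p [OF t, of n] spectrum_positive(1) [OF sym pos T t] \<open>\<epsilon> > 0\<close> by auto
    qed
    then show ?thesis
      by (simp add: op_poly_diff op_poly_linear_apply blinfun.bilinear_simps inner_diff_left)
  qed
  have low: "inner (T x) x - \<epsilon> * (norm x)\<^sup>2 - 1 / real (Suc n) * (norm x)\<^sup>2 \<le> inner (op_poly (p n) T x) x" for n
  proof -
    have "- (1 / real (Suc n)) * (norm x)\<^sup>2 \<le> inner (op_poly (p n - [:-\<epsilon>, 1:]) T x) x"
    proof (rule op_poly_lower_bound [OF sym])
      fix t assume t: "complex_of_real t \<in> spectrum T"
      show "- (1 / real (Suc n)) \<le> poly (p n - [:-\<epsilon>, 1:]) t"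
        using p [OF t, of n] by auto
    qed
    then show ?thesis
      by (simp add: op_poly_diff op_poly_linear_apply blinfun.bilinear_simps inner_diff_left power2_norm_eq_inner)
  qed
  have "inner (cut_down T \<epsilon> x) x \<le> inner (T x) x + 0 * (norm x)\<^sup>2"
    by (rule LIMSEQ_le [OF lim' tendsto_add [OF tendsto_const inv]]) (use up in blast)
  then show "inner (cut_down T \<epsilon> x) x \<le> inner (T x) x" by simp
  have "inner (T x) x - \<epsilon> * (norm x)\<^sup>2 - 0 * (norm x)\<^sup>2 \<le> inner (cut_down T \<epsilon> x) x"
    by (rule LIMSEQ_le [OF tendsto_diff [OF tendsto_const inv] lim']) (use low in blast)
  then show "inner (T x) x - \<epsilon> * (norm x)\<^sup>2 \<le> inner (cut_down T \<epsilon> x) x" by simp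
qed

section \<open>Diagonal and shift operators\<close>

definition l2_single :: "'i \<Rightarrow> 'h::complex_inner \<Rightarrow> ('i, 'h) l2"
  where "l2_single i h = Abs_l2 (\<lambda>j. if j = i then h else 0)"

lemma l2_single_apply [simp]: "l2_apply (l2_single i h) j = (if j = i then h else 0)"
proof -
  have "(\<lambda>j. (norm (if j = i then h else 0))\<^sup>2) summable_on UNIV
      \<longleftrightarrow> (\<lambda>j. (norm (if j = i then h else 0))\<^sup>2) summable_on {i}"
    by (rule summable_on_cong_neutral) auto
  then show ?thesis unfolding l2_single_def by (subst Abs_l2_inverse) auto
qed

lemma l2_apply_zero [simp]: "l2_apply 0 i = 0"
  by (simp add: zero_l2.rep_eq)

lemma l2_apply_sum [simp]: "l2_apply (\<Sum>k\<in>K. f k) i = (\<Sum>k\<in>K. l2_apply (f k) i)"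
  by (induction K rule: infinite_finite_induct) auto

lemma cinner_l2_single: "cinner \<xi> (l2_single i h) = cinner (l2_apply \<xi> i) h"
proof -
  have z: "cinner x (0::'b) = 0" for x :: 'b
    using cinner_add_right [of x 0 0] by simp
  have "cinner \<xi> (l2_single i h) = (\<Sum>\<^sub>\<infinity>j\<in>{i}. cinner (l2_apply \<xi> j) h)"
    unfolding cinner_l2_def by (rule infsum_cong_neutral) (auto simp: z)
  then show ?thesis by simp
qed

lemma inner_l2_single: "inner \<xi> (l2_single i h) = inner (l2_apply \<xi> i) h"
  by (simp add: inner_eq_Re_cinner cinner_l2_single)

lemma norm_l2_single [simp]: "norm (l2_single i h) = norm h"
  by (simp add: norm_eq_sqrt_inner inner_l2_single)

lemma bounded_linear_l2_single: "bounded_linear (l2_single i)"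
  by (rule bounded_linear_intro [where K = 1]) (auto intro!: l2_eqI)

lemma bounded_linear_l2_apply: "bounded_linear (\<lambda>\<xi>. l2_apply \<xi> i)"
  by (rule bounded_linear_intro [where K = 1]) (auto simp: norm_l2_apply_le)

lemma norm_diag_op_le:
  assumes "\<And>i. norm (a i) \<le> K"
  shows "norm (diag_op a) \<le> K"
proof (rule norm_blinfun_bound)
  show K0: "0 \<le> K" by (rule order_trans [OF norm_ge_zero assms [of undefined]])
  have bd: "bounded (range a)" using assms by (auto simp: bounded_iff)
  fix x
  have "(norm (diag_op a x))\<^sup>2 \<le> (\<Sum>\<^sub>\<infinity>i. K\<^sup>2 * (norm (l2_apply x i))\<^sup>2)"
    unfolding norm_l2_sq [of "diag_op a x"]
  proof (rule infsum_mono [OF l2_summable summable_on_cmult_right [OF l2_summable]])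
    show "(norm (l2_apply (diag_op a x) i))\<^sup>2 \<le> K\<^sup>2 * (norm (l2_apply x i))\<^sup>2" for i
      using power_mono [OF blinfun_norm_le [OF assms [of i], of "l2_apply x i"], of 2]
      by (simp add: diag_op_apply [OF bd] power_mult_distrib)
  qed
  also have "\<dots> = (K * norm x)\<^sup>2"
    by (simp add: infsum_cmult_right' norm_l2_sq power_mult_distrib)
  finally show "norm (diag_op a x) \<le> K * norm x"
    by (rule power2_le_imp_le) (simp add: K0)
qed

lemma diag_op_bounded_ops:
  assumes "bounded (range a)" "\<And>i. a i \<in> bounded_ops"
  shows "diag_op a \<in> bounded_ops"
  unfolding bounded_ops_def
  by (auto intro!: l2_eqI simp: diag_op_apply [OF assms(1)] bounded_opsD [OF assms(2)])

lemma adj_diag_op: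
  fixes a :: "'i \<Rightarrow> 'h::chilbert_space operator"
  assumes "bounded (range a)" "\<And>i. a i \<in> bounded_ops"
  shows "bounded (range (\<lambda>i. adj (a i)))" "adj (diag_op a) = diag_op (\<lambda>i. adj (a i))"
proof -
  obtain K where "\<And>i. norm (a i) \<le> K" using assms(1) by (auto simp: bounded_iff)
  then have "norm (adj (a i)) \<le> K" for i using norm_adj_le [OF assms(2)] order_trans by blast
  then show bd: "bounded (range (\<lambda>i. adj (a i)))" by (auto simp: bounded_iff)
  show "adj (diag_op a) = diag_op (\<lambda>i. adj (a i))"
    by (rule adj_unique)
      (simp add: cinner_l2_def diag_op_apply [OF assms(1)] diag_op_apply [OF bd] cinner_adj [OF assms(2)])
qed

lemma shift_op_bounded_ops: "shift_op s \<in> bounded_ops"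
  unfolding bounded_ops_def by (auto intro!: l2_eqI simp: shift_op_apply)

lemma shift_op_compose: "shift_op s o\<^sub>L shift_op t = shift_op (s + t)"
  by (rule blinfun_l2_eqI) (simp add: shift_op_apply minus_add add.assoc del: add_uminus_conv_diff)

lemma shift_op_0: "shift_op 0 = id_blinfun"
  by (rule blinfun_l2_eqI) (simp add: shift_op_apply)

lemma shift_op_shift_op: "shift_op s (shift_op t \<xi>) = shift_op (s + t) \<xi>"
  by (simp add: shift_op_compose [symmetric])

lemma bij_left_add: "bij (\<lambda>t. s + (t::'g::group_add))"
  by (rule bij_betw_byWitness [where f' = "\<lambda>t. - s + t"]) (auto simp: add.assoc [symmetric])

lemma adj_shift_op:
  fixes s :: "'g::group_add"
  shows "adj (shift_op s :: ('g, 'h::complex_inner) l2 operator) = shift_op (- s)"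
proof (rule adj_unique)
  fix \<xi> \<eta> :: "('g, 'h) l2"
  have "(\<Sum>\<^sub>\<infinity>i. cinner (l2_apply \<xi> (- s + i)) (l2_apply \<eta> i))
      = (\<Sum>\<^sub>\<infinity>i. cinner (l2_apply \<xi> (- s + (s + i))) (l2_apply \<eta> (s + i)))"
    by (rule infsum_reindex_bij_betw [OF bij_left_add [of s], symmetric])
  then show "cinner (shift_op s \<xi>) \<eta> = cinner \<xi> (shift_op (- s) \<eta>)"
    by (simp add: cinner_l2_def shift_op_apply add.assoc [symmetric])
qed

lemma norm_shift_op_le: "norm (shift_op s :: ('g::group_add, 'h::complex_inner) l2 operator) \<le> 1"
proof (rule norm_blinfun_bound)
  fix \<xi> :: "('g, 'h) l2"
  have "(norm (shift_op s \<xi>))\<^sup>2 = (norm \<xi>)\<^sup>2"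
    unfolding norm_l2_sq shift_op_apply
    using infsum_reindex_bij_betw [OF bij_left_add [of "- s"], of "\<lambda>i. (norm (l2_apply \<xi> i))\<^sup>2"] by simp
  then show "norm (shift_op s \<xi>) \<le> 1 * norm \<xi>" by (simp add: power2_eq_iff_nonneg)
qed simp

section \<open>The regular representation\<close>

abbreviation left_rep :: "('g::group_add, 'h::complex_inner) l2 operator \<Rightarrow> ('g, ('g, 'h) l2) l2 operator"
  where "left_rep \<equiv> regular_rep left_translation"

lemma norm_left_translation_le: "norm (left_translation s T) \<le> norm T"
proof -
  have "norm (shift_op s o\<^sub>L T) \<le> 1 * norm T"
    by (rule order_trans [OF norm_blinfun_compose]) (intro mult_right_mono norm_shift_op_le, simp)
  then have "norm (left_translation s T) \<le> (1 * norm T) * 1"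
    unfolding left_translation_def
    by (intro order_trans [OF norm_blinfun_compose] mult_mono norm_shift_op_le) auto
  then show ?thesis by simp
qed

lemma left_translation_bounded_ops: "T \<in> bounded_ops \<Longrightarrow> left_translation s T \<in> bounded_ops"
  unfolding left_translation_def by (intro compose_bounded_ops shift_op_bounded_ops)

lemma bounded_left_translations: "bounded (range (\<lambda>t. left_translation (f t) T))"
  unfolding bounded_iff using norm_left_translation_le [of _ T] by blast

lemma regular_rep_apply:
  "l2_apply (left_rep T \<xi>) t = left_translation (- t) T (l2_apply \<xi> t)"
  unfolding regular_rep_def by (rule diag_op_apply [OF bounded_left_translations])

lemma regular_rep_bounded_ops: "T \<in> bounded_ops \<Longrightarrow> left_rep T \<in> bounded_ops"
  unfolding regular_rep_def
  by (intro diag_op_bounded_ops bounded_left_translations left_translation_bounded_ops)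

lemma regular_rep_add:
  "left_rep (S + T) = left_rep S + left_rep T"
  by (rule blinfun_l2_eqI) (simp add: regular_rep_apply left_translation_def blinfun.bilinear_simps)

lemma regular_rep_scaleR:
  "left_rep (r *\<^sub>R T) = r *\<^sub>R left_rep T"
  by (rule blinfun_l2_eqI) (simp add: regular_rep_apply left_translation_def blinfun.bilinear_simps)

lemma regular_rep_compose:
  "left_rep (S o\<^sub>L T) = left_rep S o\<^sub>L left_rep T"
  by (rule blinfun_l2_eqI)
    (simp add: regular_rep_apply left_translation_def shift_op_shift_op shift_op_0)

lemma adj_regular_rep:
  fixes T :: "('g::group_add, 'h::chilbert_space) l2 operator"
  assumes "T \<in> bounded_ops"
  shows "adj (left_rep T) = left_rep (adj T)"
proof -
  have "adj (left_translation s T) = left_translation s (adj T)" for s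
    unfolding left_translation_def
    by (rule blinfun_eqI)
      (simp add: adj_compose assms compose_bounded_ops shift_op_bounded_ops adj_shift_op)
  then show ?thesis
    unfolding regular_rep_def
    by (subst adj_diag_op(2)) (auto intro: bounded_left_translations left_translation_bounded_ops assms)
qed

lemma regular_rep_covariant:
  "left_rep (left_translation s T)
    = shift_op s o\<^sub>L left_rep T o\<^sub>L shift_op (- s)"
  by (rule blinfun_l2_eqI)
    (simp add: regular_rep_apply left_translation_def shift_op_apply shift_op_shift_op minus_add
      add.assoc [symmetric])

section \<open>Supports\<close>

definition supp_space :: "('g \<times> 'k) set \<Rightarrow> ('g, ('k, 'h::complex_inner) l2) l2 set"
  where "supp_space D = {\<xi>. \<forall>t v. (t, v) \<notin> D \<longrightarrow> l2_apply (l2_apply \<xi> t) v = 0}"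

text \<open>Only the first coordinate is translated: \<open>shift_op\<close> permutes the outer
  index, while the coefficients act diagonally in both indices.\<close>

definition left_invariant :: "'g::group_add set \<Rightarrow> ('g \<times> 'k) set \<Rightarrow> bool"
  where "left_invariant F D \<longleftrightarrow> (\<forall>s\<in>F. \<forall>t v. (t, v) \<in> D \<longrightarrow> (s + t, v) \<in> D)"

text \<open>Propagation within \<open>F\<close>, uniformly in \<open>D\<close>: the set
  \<open>F\<close> belongs to the operator, and the block is chosen afterwards.\<close>

definition local_op :: "'g::group_add set \<Rightarrow> ('g, ('k, 'h::complex_inner) l2) l2 operator \<Rightarrow> bool"
  where "local_op F T \<longleftrightarrow> (\<forall>D. left_invariant F D \<longrightarrow> (\<forall>\<xi>\<in>supp_space D. T \<xi> \<in> supp_space D))"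

lemma local_opD: "local_op F T \<Longrightarrow> left_invariant F D \<Longrightarrow> \<xi> \<in> supp_space D \<Longrightarrow> T \<xi> \<in> supp_space D"
  by (simp add: local_op_def)

lemma subspace_supp_space: "subspace (supp_space D)"
  by (auto simp: supp_space_def subspace_def)

lemma scaleC_supp_space: "\<xi> \<in> supp_space D \<Longrightarrow> c *\<^sub>C \<xi> \<in> supp_space D"
  by (auto simp: supp_space_def)

lemma closed_supp_space:
  "closed (supp_space D :: ('g, ('k, 'h::complex_inner) l2) l2 set)"
proof -
  have eq: "(supp_space D :: ('g, ('k, 'h) l2) l2 set)
      = (\<Inter>x\<in>- D. {\<xi>. l2_apply (l2_apply \<xi> (fst x)) (snd x) = 0})"
    by (force simp: supp_space_def)
  show ?thesis unfolding eq
    by (intro closed_INT ballI closed_Collect_eq continuous_intros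
        bounded_linear.continuous_on [OF bounded_linear_l2_apply])
qed

lemma local_op_mono: "local_op F T \<Longrightarrow> F \<subseteq> F' \<Longrightarrow> local_op F' T"
  unfolding local_op_def left_invariant_def by (meson subsetD)

text \<open>If \<open>F\<close> is closed under inverses, the complement of an invariant set is
  invariant. So \<open>T\<close> preserves the vectors supported off \<open>D\<close>, and its
  adjoint preserves their orthogonal complement.\<close>

lemma local_op_adj:
  fixes T :: "('g::group_add, ('k, 'h::chilbert_space) l2) l2 operator"
  assumes T: "local_op F T" "T \<in> bounded_ops" and F: "\<And>s. s \<in> F \<Longrightarrow> - s \<in> F"
  shows "local_op F (adj T)"
  unfolding local_op_def
proof (intro allI impI ballI)
  fix D and \<xi> :: "('g, ('k, 'h) l2) l2"
  assume D: "left_invariant F D" and \<xi>: "\<xi> \<in> supp_space D"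
  have "left_invariant F (- D)"
    unfolding left_invariant_def
  proof (intro ballI allI impI)
    fix s t v assume s: "s \<in> F" and tv: "(t, v) \<in> - D"
    have "(- s + (s + t), v) \<in> D" if "(s + t, v) \<in> D"
      using D F [OF s] that unfolding left_invariant_def by blast
    then show "(s + t, v) \<in> - D" using tv by (auto simp: add.assoc [symmetric])
  qed
  then have T': "T \<eta> \<in> supp_space (- D)" if "\<eta> \<in> supp_space (- D)" for \<eta>
    using local_opD [OF T(1)] that by blast
  show "adj T \<xi> \<in> supp_space D"
    unfolding supp_space_def
  proof (intro CollectI allI impI)
    fix t v assume tv: "(t, v) \<notin> D"
    show "l2_apply (l2_apply (adj T \<xi>) t) v = 0"
    proof -
      let ?h = "l2_apply (l2_apply (adj T \<xi>) t) v"
      \<comment> \<open>Pairing with the coordinate vector built from the value \<open>?h\<close>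
        itself returns the square of its norm.\<close>
      define \<eta> where "\<eta> = l2_single t (l2_single v ?h)"
      have "\<eta> \<in> supp_space (- D)" using tv by (auto simp: supp_space_def \<eta>_def)
      then have "T \<eta> \<in> supp_space (- D)" by (rule T')
      then have z: "l2_apply (l2_apply \<xi> i) j = 0 \<or> l2_apply (l2_apply (T \<eta>) i) j = 0" for i j
        using \<xi> by (auto simp: supp_space_def)
      have z0: "cinner (0::'h) x = 0" "cinner x (0::'h) = 0" for x
        using cinner_add_right [of x 0 0] cinner_add_left [of 0 0 x] by auto
      have "cinner (l2_apply (l2_apply \<xi> i) j) (l2_apply (l2_apply (T \<eta>) i) j) = 0" for i j
        using z [of i j] by (auto simp: z0)
      then have "cinner \<xi> (T \<eta>) = 0"
        by (simp add: cinner_l2_def)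
      then have "inner \<xi> (T \<eta>) = 0" by (simp add: inner_eq_Re_cinner)
      then have "inner (adj T \<xi>) \<eta> = 0" by (simp only: inner_adj_left [OF T(2)])
      then show ?thesis by (simp add: \<eta>_def inner_l2_single)
    qed
  qed
qed

lemma fin_approx_compact_op:
  fixes T :: "'h::complex_inner operator"
  assumes "T \<in> compact_ops"
  shows "fin_approx L T"
proof (rule fin_approxI)
  fix \<eta> :: real assume "\<eta> > 0"
  have "compact (closure (T ` cball 0 1))" using assms by (simp add: compact_ops_def)
  then obtain C where C: "finite C" "closure (T ` cball 0 1) \<subseteq> (\<Union>x\<in>C. ball x \<eta>)"
    using seq_compact_imp_totally_bounded \<open>\<eta> > 0\<close> unfolding compact_eq_seq_compact_metric by metis
  have "\<exists>y\<in>span C. norm (T x - y) \<le> \<eta> * norm x" for x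
  proof (cases "x = 0")
    case False
    let ?x = "inverse (norm x) *\<^sub>R x"
    have "T ?x \<in> closure (T ` cball 0 1)"
      using False closure_subset by (intro subsetD [OF closure_subset]) simp
    then obtain c where c: "c \<in> C" "dist c (T ?x) < \<eta>" using C(2) by auto
    have "T x - norm x *\<^sub>R c = norm x *\<^sub>R (T ?x - c)"
      using False by (simp add: blinfun.bilinear_simps scaleR_diff_right)
    then have "norm (T x - norm x *\<^sub>R c) = norm x * norm (T ?x - c)" by simp
    also have "\<dots> \<le> norm x * \<eta>"
      using c(2) by (intro mult_left_mono) (simp_all add: dist_norm norm_minus_commute less_imp_le)
    finally show ?thesis using c(1) by (intro bexI [of _ "norm x *\<^sub>R c"]) (simp_all add: mult.commute span_scale span_base)
  qed (auto simp: blinfun.zero_right intro!: bexI [of _ 0] span_zero)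
  then show "\<exists>C. finite C \<and> (\<forall>x\<in>L. \<exists>y\<in>span C. norm (T x - y) \<le> \<eta> * norm x)"
    using C(1) by blast
qed

section \<open>The Roe algebra\<close>

definition roe_finite_sums :: "('g::group_add, ('g, 'h::complex_inner) l2) l2 operator set"
  where "roe_finite_sums = {\<Sum>s\<in>F. left_rep (a s) o\<^sub>L shift_op s | F a.
    finite F \<and> (\<forall>s\<in>F. a s \<in> linf_compact)}"

lemma roe_algebra_eq: "roe_algebra = closure roe_finite_sums"
  by (simp add: roe_algebra_def reduced_crossed_product_def roe_finite_sums_def)

lemma linf_compact_bounded_ops: "linf_compact \<subseteq> bounded_ops"
  by (auto simp: linf_compact_def compact_ops_def intro!: diag_op_bounded_ops)

lemma roe_finite_sums_bounded_ops: "roe_finite_sums \<subseteq> bounded_ops"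
  unfolding roe_finite_sums_def using linf_compact_bounded_ops
  by (fastforce intro!: sum_bounded_ops compose_bounded_ops shift_op_bounded_ops regular_rep_bounded_ops)

lemma roe_algebra_bounded_ops: "roe_algebra \<subseteq> bounded_ops"
  unfolding roe_algebra_eq by (rule closure_minimal [OF roe_finite_sums_bounded_ops closed_bounded_ops])

lemma regular_rep_shift_in_roe_algebra:
  assumes "a \<in> linf_compact"
  shows "left_rep a o\<^sub>L shift_op s \<in> roe_algebra"
proof -
  have "left_rep a o\<^sub>L shift_op s \<in> roe_finite_sums"
    unfolding roe_finite_sums_def using assms by (intro CollectI exI [of _ "{s}"] exI [of _ "\<lambda>_. a"]) simp
  then show ?thesis unfolding roe_algebra_eq using closure_subset by blast
qed

lemma regular_rep_in_roe_algebra: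
  assumes "a \<in> linf_compact"
  shows "left_rep a \<in> roe_algebra"
proof -
  have "left_rep a o\<^sub>L shift_op 0 = left_rep a"
    by (rule blinfun_eqI) (simp add: shift_op_0)
  then show ?thesis using regular_rep_shift_in_roe_algebra [OF assms, of 0] by simp
qed

text \<open>The translation by \<open>- t\<close> in the regular representation brings the site t +
  v to v. Every pair (t, v) is thus acted on in place, and on pairs with second coordinate v the
  entries of \<open>c\<close> at t + v become visible.\<close>

lemma regular_rep_diag_op_apply:
  assumes "bounded (range c)"
  shows "l2_apply (l2_apply (left_rep (diag_op c) \<xi>) t) v
    = c (t + v) (l2_apply (l2_apply \<xi> t) v)"
  by (simp add: regular_rep_apply left_translation_def shift_op_apply diag_op_apply [OF assms]
      add.assoc [symmetric])

text \<open>The coefficients act in place and \<open>shift_op s\<close> moves (t, v) to (s + t, v),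
  so the group elements in the sum already describe the propagation.\<close>

lemma roe_finite_sums_local:
  assumes "w \<in> roe_finite_sums"
  shows "\<exists>F. finite F \<and> local_op F w"
proof -
  obtain F a where F: "finite F" "\<And>s. s \<in> F \<Longrightarrow> a s \<in> linf_compact"
    and w: "w = (\<Sum>s\<in>F. left_rep (a s) o\<^sub>L shift_op s)"
    using assms by (auto simp: roe_finite_sums_def)
  have "local_op F w"
    unfolding local_op_def
  proof (intro allI impI ballI)
    fix D :: "('a \<times> 'a) set" and \<xi> :: "('a, ('a, 'b) l2) l2"
    assume D: "left_invariant F D" and \<xi>: "\<xi> \<in> supp_space D"
    have "left_rep (a s) (shift_op s \<xi>) \<in> supp_space D" if s: "s \<in> F" for s
      unfolding supp_space_def
    proof (intro CollectI allI impI)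
      fix t v assume tv: "(t, v) \<notin> D"
      obtain c where c: "a s = diag_op c" "bounded (range c)" using F(2) [OF s] by (auto simp: linf_compact_def)
      have "(- s + t, v) \<notin> D"
      proof
        assume "(- s + t, v) \<in> D"
        then have "(s + (- s + t), v) \<in> D" using D s unfolding left_invariant_def by blast
        then show False using tv by (simp add: add.assoc [symmetric])
      qed
      then have "l2_apply (l2_apply \<xi> (- s + t)) v = 0" using \<xi> by (simp add: supp_space_def)
      then show "l2_apply (l2_apply (left_rep (a s) (shift_op s \<xi>)) t) v = 0"
        by (simp add: c(1) regular_rep_diag_op_apply [OF c(2)] shift_op_apply blinfun.zero_right)
    qed
    then show "w \<xi> \<in> supp_space D"
      unfolding w blinfun.sum_left by (intro subspace_sum [OF subspace_supp_space]) simp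
  qed
  then show ?thesis using F(1) by blast
qed

text \<open>On a finite support the operator is a finite sum of compact entries; \<open>T x\<close>
  carries the site \<open>x\<close> to the site \<open>(s + fst x, snd x)\<close>.\<close>

lemma fin_approx_roe_term:
  assumes "a \<in> linf_compact" "finite D"
  shows "fin_approx (supp_space D) (\<lambda>\<xi>. (left_rep a o\<^sub>L shift_op s) \<xi>)"
proof -
  obtain c where c: "a = diag_op c" "bounded (range c)" "\<And>t. c t \<in> compact_ops"
    using assms(1) by (auto simp: linf_compact_def)
  define T where "T x \<xi> = l2_single (s + fst x) (l2_single (snd x)
      (c (s + fst x + snd x) (l2_apply (l2_apply \<xi> (fst x)) (snd x))))" for x :: "'a \<times> 'a" and \<xi>
  have "fin_approx (supp_space D) (T x)" for x
  proof -
    have "fin_approx (supp_space D) (\<lambda>\<xi>. c (s + fst x + snd x) (l2_apply (l2_apply \<xi> (fst x)) (snd x)))"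
      by (rule fin_approx_compose_right [where M = UNIV and K = 1, OF fin_approx_compact_op [OF c(3)]])
        (auto intro: order_trans [OF norm_l2_apply_le norm_l2_apply_le])
    from fin_approx_compose_left [OF fin_approx_compose_left [OF this
        bounded_linear_l2_single [of "snd x"]] bounded_linear_l2_single [of "s + fst x"]]
    show ?thesis by (simp only: T_def [abs_def])
  qed
  then have "fin_approx (supp_space D) (\<lambda>\<xi>. \<Sum>x\<in>D. T x \<xi>)" by (intro fin_approx_sum)
  moreover have "(left_rep a o\<^sub>L shift_op s) \<xi> = (\<Sum>x\<in>D. T x \<xi>)"
    if \<xi>: "\<xi> \<in> supp_space D" for \<xi>
  proof (intro l2_eqI)
    fix t v
    have eq: "l2_apply (l2_apply (T x \<xi>) t) v
        = (if x = (- s + t, v) then c (t + v) (l2_apply (l2_apply \<xi> (- s + t)) v) else 0)" for x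
      by (cases x) (auto simp: T_def add.assoc [symmetric])
    define h where "h = l2_apply (l2_apply \<xi> (- s + t)) v"
    have "l2_apply (l2_apply (\<Sum>x\<in>D. T x \<xi>) t) v
        = (\<Sum>x\<in>D. if x = (- s + t, v) then c (t + v) h else 0)"
      by (simp only: l2_apply_sum eq h_def)
    also have "\<dots> = (if (- s + t, v) \<in> D then c (t + v) h else 0)"
      using assms(2) by (rule sum.delta)
    also have "\<dots> = c (t + v) h"
      using \<xi> by (auto simp: h_def supp_space_def blinfun.zero_right)
    also have "\<dots> = l2_apply (l2_apply ((left_rep a o\<^sub>L shift_op s) \<xi>) t) v"
      by (simp only: c(1) blinfun_apply_blinfun_compose regular_rep_diag_op_apply [OF c(2)] shift_op_apply h_def)
    finally show "l2_apply (l2_apply ((left_rep a o\<^sub>L shift_op s) \<xi>) t) v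
        = l2_apply (l2_apply (\<Sum>x\<in>D. T x \<xi>) t) v" by (rule sym)
  qed
  ultimately show ?thesis by (simp add: fin_approx_def)
qed

lemma fin_approx_roe_algebra:
  fixes w :: "('g::group_add, ('g, 'h::complex_inner) l2) l2 operator"
  assumes "w \<in> roe_algebra" "finite D"
  shows "fin_approx (supp_space D) w"
proof (rule fin_approx_closure [OF assms(1) [unfolded roe_algebra_eq]])
  fix y :: "('g, ('g, 'h) l2) l2 operator" assume "y \<in> roe_finite_sums"
  then obtain F a where F: "\<And>s. s \<in> F \<Longrightarrow> a s \<in> linf_compact"
    and y: "y = (\<Sum>s\<in>F. left_rep (a s) o\<^sub>L shift_op s)"
    unfolding roe_finite_sums_def by blast
  have "blinfun_apply y = (\<lambda>\<xi>. \<Sum>s\<in>F. (left_rep (a s) o\<^sub>L shift_op s) \<xi>)"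
    unfolding y by (rule ext) (rule blinfun.sum_left)
  moreover have "fin_approx (supp_space D) \<dots>"
    by (intro fin_approx_sum fin_approx_roe_term F assms(2))
  ultimately show "fin_approx (supp_space D) y" by simp
qed

section \<open>Limits of truncated traces\<close>

lemma compact_UNIV_fun_ennreal: "compact (UNIV :: ('i \<Rightarrow> ennreal) set)"
proof -
  have "compactin (product_topology (\<lambda>i::'i. euclidean :: ennreal topology) UNIV) (PiE UNIV (\<lambda>_. UNIV))"
    unfolding compactin_PiE by (simp add: compact_UNIV)
  then show ?thesis by (simp add: euclidean_product_topology PiE_UNIV_domain)
qed

text \<open>Tychonoff for functions into [0, \<infinity>]. \<open>H\<close> is the meet of the
  neighbourhoods of \<Phi> with the image filter: the first gives pointwise convergence, the second
  passes on everything that holds eventually along \<open>F\<close>.\<close>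

lemma cluster_point_exists:
  fixes \<Psi> :: "'s \<Rightarrow> 'i \<Rightarrow> ennreal"
  assumes "F \<noteq> bot"
  shows "\<exists>\<Phi> H. H \<noteq> bot \<and> (\<forall>i. ((\<lambda>\<psi>. \<psi> i) \<longlongrightarrow> \<Phi> i) H) \<and>
    (\<forall>Q. (\<forall>\<^sub>F s in F. Q (\<Psi> s)) \<longrightarrow> (\<forall>\<^sub>F \<psi> in H. Q \<psi>))"
proof -
  have "filtermap \<Psi> F \<noteq> bot" using assms by (simp add: filtermap_bot_iff)
  then obtain \<Phi> where \<Phi>: "inf (nhds \<Phi>) (filtermap \<Psi> F) \<noteq> bot"
    using compact_UNIV_fun_ennreal unfolding compact_filter by auto
  have "((\<lambda>\<psi>. \<psi> i) \<longlongrightarrow> \<Phi> i) (inf (nhds \<Phi>) (filtermap \<Psi> F))" for i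
  proof -
    have "((\<lambda>\<psi>. \<psi> i) \<longlongrightarrow> \<Phi> i) (nhds \<Phi>)"
    proof (rule topological_tendstoI)
      fix U :: "ennreal set" assume U: "open U" "\<Phi> i \<in> U"
      have "open ((\<lambda>\<psi> :: 'i \<Rightarrow> ennreal. \<psi> i) -` U)"
        by (rule open_vimage [OF U(1) continuous_on_product_coordinates])
      then show "\<forall>\<^sub>F \<psi> in nhds \<Phi>. \<psi> i \<in> U"
        unfolding eventually_nhds using U(2) by (intro exI [of _ "(\<lambda>\<psi>. \<psi> i) -` U"]) auto
    qed
    then show ?thesis by (rule tendsto_mono [rotated]) simp
  qed
  moreover have "\<forall>\<^sub>F \<psi> in inf (nhds \<Phi>) (filtermap \<Psi> F). Q \<psi>" if "\<forall>\<^sub>F s in F. Q (\<Psi> s)" for Q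
    by (rule filter_leD [of _ "filtermap \<Psi> F"]) (use that in \<open>auto simp: eventually_filtermap\<close>)
  ultimately show ?thesis using \<Phi> by blast
qed

section \<open>Generated subgroups and norm limits of local operators\<close>

lemma generated_subgroup_props:
  "S \<subseteq> generated_subgroup S" "0 \<in> generated_subgroup S"
  "x \<in> generated_subgroup S \<Longrightarrow> y \<in> generated_subgroup S \<Longrightarrow> x + y \<in> generated_subgroup S"
  "x \<in> generated_subgroup S \<Longrightarrow> - x \<in> generated_subgroup S"
proof -
  let ?P = "\<lambda>H. 0 \<in> H \<and> (\<forall>x\<in>H. \<forall>y\<in>H. x + y \<in> H) \<and> (\<forall>x\<in>H. - x \<in> H)"
  have "?P (generated_subgroup S)"
    unfolding generated_subgroup_def by (rule hull_in) blast
  then show "0 \<in> generated_subgroup S"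
    "x \<in> generated_subgroup S \<Longrightarrow> y \<in> generated_subgroup S \<Longrightarrow> x + y \<in> generated_subgroup S"
    "x \<in> generated_subgroup S \<Longrightarrow> - x \<in> generated_subgroup S"
    by blast+
  show "S \<subseteq> generated_subgroup S" unfolding generated_subgroup_def by (rule hull_subset)
qed

text \<open>Closure of \<open>F\<close> under inverses is included so that the notion passes to
  adjoints through \<open>local_op_adj\<close>.\<close>

definition approx_local :: "('g::group_add, ('k, 'h::chilbert_space) l2) l2 operator \<Rightarrow> bool"
  where "approx_local x \<longleftrightarrow> x \<in> bounded_ops \<and>
    (\<forall>\<delta>>0. \<exists>F y. finite F \<and> (\<forall>s\<in>F. - s \<in> F) \<and> y \<in> bounded_ops \<and> local_op F y \<and> norm (x - y) < \<delta>)"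

lemma approx_local_adj:
  assumes "approx_local x"
  shows "approx_local (adj x)"
  unfolding approx_local_def
proof (intro conjI allI impI)
  have x: "x \<in> bounded_ops" using assms by (simp add: approx_local_def)
  then show "adj x \<in> bounded_ops" by (rule adj_bounded_ops)
  fix \<delta> :: real assume "\<delta> > 0"
  then obtain F y where F: "finite F" "\<forall>s\<in>F. - s \<in> F" "y \<in> bounded_ops" "local_op F y" "norm (x - y) < \<delta>"
    using assms unfolding approx_local_def by blast
  have "norm (adj x - adj y) \<le> norm (x - y)"
    using norm_adj_le [OF diff_bounded_ops [OF x F(3)]] by (simp add: adj_diff x F(3))
  then show "\<exists>F y. finite F \<and> (\<forall>s\<in>F. - s \<in> F) \<and> y \<in> bounded_ops \<and> local_op F y \<and> norm (adj x - y) < \<delta>"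
    using F local_op_adj [OF F(4,3)] adj_bounded_ops [OF F(3)]
    by (intro exI [of _ F] exI [of _ "adj y"]) auto
qed

lemma approx_local_roe_algebra:
  fixes x :: "('g::group_add, ('g, 'h::chilbert_space) l2) l2 operator"
  assumes "x \<in> roe_algebra"
  shows "approx_local x"
  unfolding approx_local_def
proof (intro conjI allI impI)
  show "x \<in> bounded_ops" using assms roe_algebra_bounded_ops by blast
  fix \<delta> :: real assume "\<delta> > 0"
  then obtain y where y: "y \<in> roe_finite_sums" "dist y x < \<delta>"
    using assms unfolding roe_algebra_eq closure_approachable by blast
  obtain F where F: "finite F" "local_op F y" using roe_finite_sums_local [OF y(1)] by blast
  have "local_op (F \<union> uminus ` F) y" by (rule local_op_mono [OF F(2)]) simp
  then show "\<exists>F y. finite F \<and> (\<forall>s\<in>F. - s \<in> F) \<and> y \<in> bounded_ops \<and> local_op F y \<and> norm (x - y) < \<delta>"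
    using y F(1) roe_finite_sums_bounded_ops
    by (intro exI [of _ "F \<union> uminus ` F"] exI [of _ y]) (auto simp: dist_norm norm_minus_commute)
qed

lemma norm_sq_perturb:
  assumes "norm (u - w) \<le> \<delta>" "norm u \<le> K" "norm w \<le> K"
  shows "(norm u)\<^sup>2 \<le> (norm w)\<^sup>2 + \<delta> * (2 * K)"
proof (cases "norm u \<le> norm w")
  case True
  then have "(norm u)\<^sup>2 \<le> (norm w)\<^sup>2" by (intro power_mono) auto
  moreover have "0 \<le> \<delta> * (2 * K)"
    using order_trans [OF norm_ge_zero assms(1)] order_trans [OF norm_ge_zero assms(2)] by simp
  ultimately show ?thesis by linarith
next
  case False
  have "(norm u)\<^sup>2 - (norm w)\<^sup>2 = (norm u - norm w) * (norm u + norm w)"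
    by (simp add: power2_eq_square algebra_simps)
  also have "\<dots> \<le> \<delta> * (2 * K)"
    using False assms norm_triangle_ineq2 [of u w] by (intro mult_mono) auto
  finally show ?thesis by linarith
qed

text \<open>The exact inequality needs an operator that preserves the block, which only the local
  approximant \<open>y\<close> does. Passing from \<open>x\<close> to \<open>y\<close> and back
  costs \<eta>/2 each time. The set \<open>F\<close> is chosen before \<open>D\<close>, so one
  approximant serves all large blocks.\<close>

lemma cut_trace_adj_commute_approx:
  assumes x: "approx_local x" and "\<eta> > 0" "\<epsilon> \<ge> 0"
  shows "\<exists>F. finite F \<and> (\<forall>D. left_invariant F D \<longrightarrow>
    cut_trace (supp_space D) (adj x o\<^sub>L x) (\<epsilon> + \<eta>) \<le> cut_trace (supp_space D) (x o\<^sub>L adj x) \<epsilon>)"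
proof -
  have xb: "x \<in> bounded_ops" using x by (simp add: approx_local_def)
  define K where "K = norm x + 1"
  have K0: "2 * K > 0" by (simp add: K_def add_nonneg_pos)
  \<comment> \<open>The bound 1 keeps the norm of \<open>y\<close> below \<open>K\<close>; the other
    bound keeps the change of squared norms on unit vectors, at most
    \<open>\<delta> * (2 * K)\<close>, below \<eta>/2.\<close>
  define \<delta> where "\<delta> = min 1 (\<eta> / 2 / (2 * K))"
  have d: "\<delta> > 0" "\<delta> \<le> 1" using \<open>\<eta> > 0\<close> K0 by (simp_all add: \<delta>_def)
  have "\<delta> \<le> \<eta> / 2 / (2 * K)" unfolding \<delta>_def by (rule min.cobounded2)
  then have d2: "\<delta> * (2 * K) \<le> \<eta> / 2" by (rule pos_le_divide_eq [OF K0, THEN iffD1])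
  obtain F y where F: "finite F" "local_op F y" "y \<in> bounded_ops" "norm (x - y) < \<delta>"
    using x d(1) unfolding approx_local_def by blast
  have xyK: "norm x \<le> K" "norm y \<le> K"
    using F(4) d(2) norm_triangle_ineq2 [of y x] by (simp_all add: K_def norm_minus_commute)
  have "norm (adj x - adj y) \<le> norm (x - y)"
    using norm_adj_le [OF diff_bounded_ops [OF xb F(3)]] by (simp add: adj_diff xb F(3))
  then have diff: "norm (x - y) \<le> \<delta>" "norm (adj y - adj x) \<le> \<delta>"
    using F(4) by (simp_all add: norm_minus_commute)
  have adjK: "norm (adj x) \<le> K" "norm (adj y) \<le> K"
    using norm_adj_le [OF xb] norm_adj_le [OF F(3)] xyK by simp_all
  have unit: "norm (blinfun_apply T z) \<le> c" if "norm T \<le> c" "norm z = 1"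
    for T :: "('a, ('b, 'c) l2) l2 operator" and z c
    using blinfun_norm_le [OF that(1), of z] that(2) by simp
  have "cut_trace (supp_space D) (adj x o\<^sub>L x) (\<epsilon> + \<eta>) \<le> cut_trace (supp_space D) (x o\<^sub>L adj x) \<epsilon>"
    if D: "left_invariant F D" for D
  proof -
    let ?L = "supp_space D :: ('a, ('b, 'c) l2) l2 set"
    have "cut_trace ?L (adj x o\<^sub>L x) (\<epsilon> + \<eta>) \<le> cut_trace ?L (adj y o\<^sub>L y) (\<epsilon> + \<eta> / 2)"
    proof (rule cut_trace_mono)
      fix z :: "('a, ('b, 'c) l2) l2" assume z: "norm z = 1"
      have "(norm (x z))\<^sup>2 \<le> (norm (y z))\<^sup>2 + \<delta> * (2 * K)"
        using unit [OF diff(1) z] unit [OF xyK(1) z] unit [OF xyK(2) z]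
        by (intro norm_sq_perturb) (simp_all add: blinfun.diff_left)
      then show "inner ((adj x o\<^sub>L x) z) z - (\<epsilon> + \<eta>) \<le> inner ((adj y o\<^sub>L y) z) z - (\<epsilon> + \<eta> / 2)"
        using d2 unfolding inner_adj_self [OF xb] inner_adj_self [OF F(3)] by linarith
    qed
    also have "\<dots> = cut_trace ?L (\<lambda>z. adj y (y z)) (\<epsilon> + \<eta> / 2)"
      by (simp add: blinfun_compose.rep_eq comp_def)
    also have "\<dots> \<le> cut_trace ?L (\<lambda>z. y (adj y z)) (\<epsilon> + \<eta> / 2)"
      by (rule cut_trace_commute_le [OF subspace_supp_space])
        (use assms F D in \<open>auto simp: inner_adj local_opD bounded_linear.linear [OF blinfun.bounded_linear_right]\<close>)
    also have "\<dots> = cut_trace ?L (y o\<^sub>L adj y) (\<epsilon> + \<eta> / 2)"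
      by (simp add: blinfun_compose.rep_eq comp_def)
    also have "\<dots> \<le> cut_trace ?L (x o\<^sub>L adj x) \<epsilon>"
    proof (rule cut_trace_mono)
      fix z :: "('a, ('b, 'c) l2) l2" assume z: "norm z = 1"
      have "(norm (adj y z))\<^sup>2 \<le> (norm (adj x z))\<^sup>2 + \<delta> * (2 * K)"
        using unit [OF diff(2) z] unit [OF adjK(2) z] unit [OF adjK(1) z]
        by (intro norm_sq_perturb) (simp_all add: blinfun.diff_left)
      then show "inner ((y o\<^sub>L adj y) z) z - (\<epsilon> + \<eta> / 2) \<le> inner ((x o\<^sub>L adj x) z) z - \<epsilon>"
        using d2 unfolding inner_adj_self [OF xb] inner_adj_self [OF F(3)] by linarith
    qed
    finally show ?thesis .
  qed
  then show ?thesis using F(1) by blast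
qed

text \<open>Only inequalities between finitely many values have to survive the limit, so a cluster point
  \<open>\<Phi>\<close> of the weighted truncated traces serves as well as a limit along an ultrafilter.\<close>

locale trace_limit =
  fixes F :: "'s filter" and L :: "'s \<Rightarrow> 'h::chilbert_space set" and c :: "'s \<Rightarrow> ennreal"
    and H :: "('h operator \<times> real \<Rightarrow> ennreal) filter" and \<Phi> :: "'h operator \<times> real \<Rightarrow> ennreal"
  assumes L: "\<And>s. subspace (L s)"
    and H: "H \<noteq> bot"
    and lim: "\<And>i. ((\<lambda>\<psi>. \<psi> i) \<longlongrightarrow> \<Phi> i) H"
    and ev: "\<And>Q. \<forall>\<^sub>F s in F. Q (\<lambda>(a, \<epsilon>). c s * cut_trace (L s) (blinfun_apply a) \<epsilon>) \<Longrightarrow> \<forall>\<^sub>F \<psi> in H. Q \<psi>"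
begin

lemma Phi_le:
  assumes "\<forall>\<^sub>F s in F. cut_trace (L s) (blinfun_apply a) \<epsilon> \<le> cut_trace (L s) (blinfun_apply b) \<delta>"
  shows "\<Phi> (a, \<epsilon>) \<le> \<Phi> (b, \<delta>)"
proof (rule tendsto_le [OF H lim lim])
  show "\<forall>\<^sub>F \<psi> in H. \<psi> (a, \<epsilon>) \<le> \<psi> (b, \<delta>)"
    by (rule ev) (use assms in \<open>auto elim!: eventually_mono intro: mult_left_mono\<close>)
qed

definition \<tau> :: "'h operator \<Rightarrow> ennreal"
  where "\<tau> a = (SUP \<epsilon>\<in>{0<..}. \<Phi> (a, \<epsilon>))"

lemma Phi_le_tau: "\<epsilon> > 0 \<Longrightarrow> \<Phi> (a, \<epsilon>) \<le> \<tau> a"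
  unfolding \<tau>_def by (rule SUP_upper) simp

lemma Phi_antimono: "\<epsilon> \<le> \<delta> \<Longrightarrow> \<Phi> (a, \<delta>) \<le> \<Phi> (a, \<epsilon>)"
  by (rule Phi_le) (simp add: cut_trace_antimono)

text \<open>A loss in the cut is invisible in the supremum: a given cut is spent half on the loss
  and half on the cut that remains.\<close>

lemma tau_le:
  assumes "\<And>\<epsilon> \<eta>. \<epsilon> > 0 \<Longrightarrow> \<eta> > 0 \<Longrightarrow>
    \<forall>\<^sub>F s in F. cut_trace (L s) (blinfun_apply a) (\<epsilon> + \<eta>) \<le> cut_trace (L s) (blinfun_apply b) \<epsilon>"
  shows "\<tau> a \<le> \<tau> b"
  unfolding \<tau>_def [of a]
proof (rule SUP_least)
  fix \<epsilon> :: real assume "\<epsilon> \<in> {0<..}"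
  then have e: "\<epsilon> / 2 > 0" by simp
  have "\<Phi> (a, \<epsilon> / 2 + \<epsilon> / 2) \<le> \<Phi> (b, \<epsilon> / 2)" by (rule Phi_le) (rule assms [OF e e])
  also have "\<dots> \<le> \<tau> b" by (rule Phi_le_tau [OF e])
  finally show "\<Phi> (a, \<epsilon>) \<le> \<tau> b" by simp
qed

text \<open>A cut \<epsilon> of the sum is split into \<epsilon>/2 for each summand, while equal
  cuts are superadditive. Since \<Phi> is antitone in the cut, neither halving a cut nor taking the
  smaller of two affects the supremum.\<close>

lemma tau_add:
  fixes a b :: "'h operator"
  assumes "\<And>x. inner (a x) x \<ge> 0" "\<And>x. inner (b x) x \<ge> 0"
  shows "\<tau> (a + b) = \<tau> a + \<tau> b"
proof (rule antisym)
  have eq: "blinfun_apply (a + b) = (\<lambda>x. a x + b x)" by (rule ext) (simp add: blinfun.add_left)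
  have sumlim: "((\<lambda>\<psi>. \<psi> i + \<psi> j) \<longlongrightarrow> \<Phi> i + \<Phi> j) H" for i j by (intro tendsto_add lim)
  show "\<tau> (a + b) \<le> \<tau> a + \<tau> b"
    unfolding \<tau>_def [of "a + b"]
  proof (rule SUP_least)
    fix \<epsilon> :: real assume "\<epsilon> \<in> {0<..}"
    then have e: "\<epsilon> / 2 > 0" by simp
    have "cut_trace (L s) (blinfun_apply (a + b)) \<epsilon>
        \<le> cut_trace (L s) (blinfun_apply a) (\<epsilon> / 2) + cut_trace (L s) (blinfun_apply b) (\<epsilon> / 2)" for s
      using cut_trace_subadd [of "L s" a b "\<epsilon> / 2" "\<epsilon> / 2"] by (simp add: eq)
    then have "\<forall>\<^sub>F \<psi> in H. \<psi> (a + b, \<epsilon>) \<le> \<psi> (a, \<epsilon> / 2) + \<psi> (b, \<epsilon> / 2)"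
      by (intro ev) (auto simp: distrib_left [symmetric] intro!: always_eventually mult_left_mono)
    then have "\<Phi> (a + b, \<epsilon>) \<le> \<Phi> (a, \<epsilon> / 2) + \<Phi> (b, \<epsilon> / 2)"
      by (rule tendsto_le [OF H sumlim lim])
    also have "\<dots> \<le> \<tau> a + \<tau> b" by (intro add_mono Phi_le_tau e)
    finally show "\<Phi> (a + b, \<epsilon>) \<le> \<tau> a + \<tau> b" .
  qed
  have "\<tau> a + \<tau> b = (SUP \<epsilon>\<in>{0<..}. \<Phi> (a, \<epsilon>) + \<Phi> (b, \<epsilon>))"
    unfolding \<tau>_def
  proof (rule SUP_add_directed_ennreal [symmetric])
    fix i j :: real assume "i \<in> {0<..}" "j \<in> {0<..}"
    then show "\<exists>k\<in>{0<..}. \<Phi> (a, i) + \<Phi> (b, j) \<le> \<Phi> (a, k) + \<Phi> (b, k)"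
      by (intro bexI [of _ "min i j"] add_mono Phi_antimono) auto
  qed
  also have "\<dots> \<le> \<tau> (a + b)"
  proof (rule SUP_least)
    fix \<epsilon> :: real assume e: "\<epsilon> \<in> {0<..}"
    have "cut_trace (L s) (blinfun_apply a) \<epsilon> + cut_trace (L s) (blinfun_apply b) \<epsilon>
        \<le> cut_trace (L s) (blinfun_apply (a + b)) \<epsilon>" for s
      unfolding eq using e assms
      by (intro cut_trace_superadd L) (auto intro: bounded_linear.linear [OF blinfun.bounded_linear_right])
    then have "\<forall>\<^sub>F \<psi> in H. \<psi> (a, \<epsilon>) + \<psi> (b, \<epsilon>) \<le> \<psi> (a + b, \<epsilon>)"
      by (intro ev) (auto simp: distrib_left [symmetric] intro!: always_eventually mult_left_mono)
    then have "\<Phi> (a, \<epsilon>) + \<Phi> (b, \<epsilon>) \<le> \<Phi> (a + b, \<epsilon>)"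
      by (rule tendsto_le [OF H lim sumlim])
    also have "\<dots> \<le> \<tau> (a + b)" using e by (intro Phi_le_tau) simp
    finally show "\<Phi> (a, \<epsilon>) + \<Phi> (b, \<epsilon>) \<le> \<tau> (a + b)" .
  qed
  finally show "\<tau> a + \<tau> b \<le> \<tau> (a + b)" .
qed

lemma tau_scaleR:
  fixes a :: "'h operator"
  assumes "r \<ge> 0"
  shows "\<tau> (r *\<^sub>R a) = ennreal r * \<tau> a"
proof (cases "r = 0")
  case True
  \<comment> \<open>The substitution of r \<epsilon> for \<epsilon> degenerates at r = 0. There the
    truncated traces vanish, in accordance with 0 * \<infinity> = 0.\<close>
  have "\<Phi> (0, \<epsilon>) \<le> 0" if "\<epsilon> > 0" for \<epsilon>
  proof (rule tendsto_le [OF H tendsto_const lim])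
    have "cut_trace (L s) (blinfun_apply 0) \<epsilon> = 0" for s
      using cut_trace_zero [of \<epsilon> "L s"] that by (simp add: zero_blinfun.rep_eq)
    then show "\<forall>\<^sub>F \<psi> in H. \<psi> (0, \<epsilon>) \<le> 0" by (intro ev) simp
  qed
  then have "\<tau> 0 \<le> 0" unfolding \<tau>_def by (intro SUP_least) simp
  then show ?thesis using True by simp
next
  case False
  then have r: "r > 0" using assms by simp
  have eq: "\<Phi> (r *\<^sub>R a, r * \<epsilon>) = ennreal r * \<Phi> (a, \<epsilon>)" for \<epsilon>
  proof -
    have "blinfun_apply (r *\<^sub>R a) = (\<lambda>x. r *\<^sub>R a x)" by (rule ext) (simp add: blinfun.scaleR_left)
    then have "cut_trace (L s) (blinfun_apply (r *\<^sub>R a)) (r * \<epsilon>) = ennreal r * cut_trace (L s) a \<epsilon>" for s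
      using cut_trace_scale [OF r, of "L s" a \<epsilon>] by simp
    then have "\<forall>\<^sub>F \<psi> in H. \<psi> (r *\<^sub>R a, r * \<epsilon>) = ennreal r * \<psi> (a, \<epsilon>)"
      by (intro ev) (simp add: mult_ac)
    then have "((\<lambda>\<psi>. ennreal r * \<psi> (a, \<epsilon>)) \<longlongrightarrow> \<Phi> (r *\<^sub>R a, r * \<epsilon>)) H"
      using lim [of "(r *\<^sub>R a, r * \<epsilon>)"] by (rule tendsto_cong [THEN iffD1])
    moreover have "((\<lambda>\<psi>. ennreal r * \<psi> (a, \<epsilon>)) \<longlongrightarrow> ennreal r * \<Phi> (a, \<epsilon>)) H"
      by (rule ennreal_tendsto_cmult [OF _ lim]) simp
    ultimately show ?thesis using tendsto_unique [OF H] by blast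
  qed
  have img: "{0::real<..} = (*) r ` {0<..}"
  proof (intro set_eqI iffI)
    fix x :: real assume "x \<in> {0<..}"
    then have "x = r * (x / r)" "x / r \<in> {0<..}" using r by simp_all
    then show "x \<in> (*) r ` {0<..}" by blast
  qed (use r in auto)
  have "\<tau> (r *\<^sub>R a) = (SUP \<epsilon>\<in>{0<..}. \<Phi> (r *\<^sub>R a, r * \<epsilon>))"
    unfolding \<tau>_def by (subst img) (simp only: image_image)
  also have "\<dots> = ennreal r * \<tau> a"
    unfolding eq \<tau>_def by (rule SUP_mult_left_ennreal [symmetric])
  finally show ?thesis .
qed

text \<open>Stated for any \<open>b\<close> between a - \<epsilon> and a as forms, so that it
  applies to \<open>cut_down\<close> itself and also to its image under the regular
  representation.\<close>

lemma tau_lower_semicontinuous: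
  fixes a :: "'h operator" and b :: "real \<Rightarrow> 'h operator"
  assumes b: "\<And>\<epsilon> x. \<epsilon> > 0 \<Longrightarrow> inner (b \<epsilon> x) x \<le> inner (a x) x"
      "\<And>\<epsilon> x. \<epsilon> > 0 \<Longrightarrow> inner (a x) x - \<epsilon> * (norm x)\<^sup>2 \<le> inner (b \<epsilon> x) x"
  shows "\<tau> a = (SUP \<epsilon>\<in>{0<..}. \<tau> (b \<epsilon>))"
proof (rule antisym)
  show "(SUP \<epsilon>\<in>{0<..}. \<tau> (b \<epsilon>)) \<le> \<tau> a"
  proof (rule SUP_least)
    fix \<epsilon> :: real assume e: "\<epsilon> \<in> {0<..}"
    show "\<tau> (b \<epsilon>) \<le> \<tau> a"
    proof (rule tau_le)
      fix \<delta> \<eta> :: real assume d: "\<delta> > 0" "\<eta> > 0"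
      have "inner (b \<epsilon> x) x - (\<delta> + \<eta>) \<le> inner (a x) x - \<delta>" for x
        using b(1) [of \<epsilon> x] e d by simp
      then have "cut_trace (L s) (b \<epsilon>) (\<delta> + \<eta>) \<le> cut_trace (L s) a \<delta>" for s
        by (intro cut_trace_mono)
      then show "\<forall>\<^sub>F s in F. cut_trace (L s) (b \<epsilon>) (\<delta> + \<eta>) \<le> cut_trace (L s) a \<delta>" by simp
    qed
  qed
  show "\<tau> a \<le> (SUP \<epsilon>\<in>{0<..}. \<tau> (b \<epsilon>))"
    unfolding \<tau>_def [of a]
  proof (rule SUP_least)
    fix \<epsilon> :: real assume "\<epsilon> \<in> {0<..}"
    then have e: "\<epsilon> / 2 > 0" by simp
    \<comment> \<open>Half of the cut pays for replacing \<open>a\<close> by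
      \<open>b (\<epsilon> / 2)\<close>, the other half is left as the cut.\<close>
    have "inner (a x) x - \<epsilon> \<le> inner (b (\<epsilon> / 2) x) x - \<epsilon> / 2" if "norm x = 1" for x
      using b(2) [OF e, of x] that by simp
    then have "cut_trace (L s) a \<epsilon> \<le> cut_trace (L s) (b (\<epsilon> / 2)) (\<epsilon> / 2)" for s
      by (intro cut_trace_mono)
    then have "\<Phi> (a, \<epsilon>) \<le> \<Phi> (b (\<epsilon> / 2), \<epsilon> / 2)" by (intro Phi_le) simp
    also have "\<dots> \<le> \<tau> (b (\<epsilon> / 2))" by (rule Phi_le_tau [OF e])
    also have "\<dots> \<le> (SUP \<epsilon>\<in>{0<..}. \<tau> (b \<epsilon>))" using e by (intro SUP_upper) simp
    finally show "\<Phi> (a, \<epsilon>) \<le> (SUP \<epsilon>\<in>{0<..}. \<tau> (b \<epsilon>))" .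
  qed
qed

lemma tau_projection:
  assumes "\<And>\<epsilon>. 0 < \<epsilon> \<Longrightarrow> \<epsilon> < 1 \<Longrightarrow>
    \<forall>\<^sub>F s in F. c s * cut_trace (L s) (blinfun_apply a) \<epsilon> = ennreal (1 - \<epsilon>)"
  shows "\<tau> a = 1"
proof (rule antisym)
  have eq: "\<Phi> (a, \<epsilon>) = ennreal (1 - \<epsilon>)" if "0 < \<epsilon>" "\<epsilon> < 1" for \<epsilon>
  proof -
    have "\<forall>\<^sub>F \<psi> in H. \<psi> (a, \<epsilon>) = ennreal (1 - \<epsilon>)"
      by (rule ev) (use assms [OF that] in simp)
    then have "((\<lambda>\<psi>. ennreal (1 - \<epsilon>)) \<longlongrightarrow> \<Phi> (a, \<epsilon>)) H"
      using lim [of "(a, \<epsilon>)"] by (rule tendsto_cong [THEN iffD1])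
    then show ?thesis using tendsto_unique [OF H] tendsto_const by blast
  qed
  show "\<tau> a \<le> 1"
    unfolding \<tau>_def
  proof (rule SUP_least)
    fix \<epsilon> :: real assume "\<epsilon> \<in> {0<..}"
    \<comment> \<open>The value of \<Phi> is known only for cuts below 1; larger cuts are reduced to
      these by monotonicity.\<close>
    then have e: "0 < min \<epsilon> (1 / 2)" "min \<epsilon> (1 / 2) < 1" by auto
    have "\<Phi> (a, \<epsilon>) \<le> \<Phi> (a, min \<epsilon> (1 / 2))" by (rule Phi_antimono) simp
    also have "\<dots> \<le> 1" using eq [OF e] e by (simp add: ennreal_le_1)
    finally show "\<Phi> (a, \<epsilon>) \<le> 1" .
  qed
  show "1 \<le> \<tau> a"
  proof (rule tendsto_upperbound)
    show "((\<lambda>\<epsilon>. ennreal (1 - \<epsilon>)) \<longlongrightarrow> 1) (at_right 0)"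
    proof -
      have "((\<lambda>\<epsilon>::real. 1 - \<epsilon>) \<longlongrightarrow> 1 - 0) (at_right 0)" by (intro tendsto_intros)
      from tendsto_ennrealI [OF this] show ?thesis by simp
    qed
    show "\<forall>\<^sub>F \<epsilon> in at_right 0. ennreal (1 - \<epsilon>) \<le> \<tau> a"
      using eventually_at_right_less [of 0] eventually_at_right_real [of 0 1]
      by (auto elim!: eventually_mono simp: eq [symmetric] intro!: Phi_le_tau)
  qed simp
qed

end

lemma trace_limit_exists:
  fixes F :: "'s filter" and L :: "'s \<Rightarrow> 'h::chilbert_space set" and c :: "'s \<Rightarrow> ennreal"
  assumes "F \<noteq> bot" "\<And>s. subspace (L s)"
  shows "\<exists>H \<Phi>. trace_limit F L c H \<Phi>"
  using cluster_point_exists [OF assms(1), of "\<lambda>s (a, \<epsilon>). c s * cut_trace (L s) (blinfun_apply a) \<epsilon>"] assms(2)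
  unfolding trace_limit_def by blast

section \<open>Traces on the Roe algebra\<close>

lemma regular_rep_diff:
  "left_rep (S - T) = left_rep S - left_rep T"
  using regular_rep_add [of "S - T" T] by (simp add: algebra_simps)

lemma regular_rep_id: "left_rep id_blinfun = id_blinfun"
  by (rule blinfun_l2_eqI)
    (simp add: regular_rep_apply left_translation_def shift_op_shift_op shift_op_0)

text \<open>The regular representation is a direct sum of unitary conjugates of \<open>T\<close>, so
  it preserves positivity of the form and hence every form inequality.\<close>

lemma regular_rep_positive:
  fixes T :: "('g::group_add, 'h::complex_inner) l2 operator"
  assumes "\<And>x. inner (T x) x \<ge> 0"
  shows "inner (left_rep T \<xi>) \<xi> \<ge> 0"
proof -
  have "Re (cinner (left_translation (- t) T x) x) \<ge> 0" for t x
  proof -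
    have "cinner (left_translation (- t) T x) x = cinner (T (shift_op t x)) (shift_op t x)"
    proof -
      have "cinner (shift_op (- t) (T (shift_op t x))) x
          = (\<Sum>\<^sub>\<infinity>i. cinner (l2_apply (T (shift_op t x)) (t + i)) (l2_apply x i))"
        by (simp add: cinner_l2_def shift_op_apply)
      also have "\<dots> = (\<Sum>\<^sub>\<infinity>i. cinner (l2_apply (T (shift_op t x)) (t + i)) (l2_apply x (- t + (t + i))))"
        by (simp add: add.assoc [symmetric])
      also have "\<dots> = (\<Sum>\<^sub>\<infinity>i. cinner (l2_apply (T (shift_op t x)) i) (l2_apply x (- t + i)))"
        by (rule infsum_reindex_bij_betw [OF bij_left_add [of t],
              of "\<lambda>i. cinner (l2_apply (T (shift_op t x)) i) (l2_apply x (- t + i))"])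
      finally show ?thesis by (simp add: left_translation_def cinner_l2_def shift_op_apply)
    qed
    then show ?thesis using assms [of "shift_op t x"] by (simp add: inner_eq_Re_cinner)
  qed
  then show ?thesis
    unfolding inner_eq_Re_cinner [of "left_rep T \<xi>"]
      cinner_l2_def [of "left_rep T \<xi>"]
    by (subst infsum_Re [symmetric, OF cinner_summable])
      (auto simp: regular_rep_apply intro: infsum_nonneg)
qed

lemma pos_cone_regular_rep:
  fixes a :: "('g::group_add, 'h::chilbert_space) l2 operator"
  assumes "a \<in> pos_cone linf_compact"
  shows "left_rep a \<in> pos_cone roe_algebra"
proof -
  obtain x :: "('g, 'h) l2 operator" where x: "x \<in> linf_compact" "a = adj x o\<^sub>L x" using assms by (auto simp: pos_cone_def)
  have "x \<in> bounded_ops" using x(1) linf_compact_bounded_ops by blast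
  then have "left_rep a = adj (left_rep x) o\<^sub>L left_rep x"
    by (simp add: x(2) regular_rep_compose adj_regular_rep)
  then show ?thesis using regular_rep_in_roe_algebra [OF x(1)] by (auto simp: pos_cone_def)
qed

text \<open>One functional serves both claims: the trace on the bounded functions is the restriction
  of \<tau> along \<open>left_rep\<close>, and its invariance comes from the trace identity in the
  crossed product.\<close>

lemma roe_trace_exists:
  fixes p :: "('g::group_add, 'h::chilbert_space) l2 operator"
  assumes lf: "locally_finite_group TYPE('g)" and p: "p \<in> projections linf_compact" "p \<noteq> 0"
  shows "\<exists>\<tau>. lower_semicontinuous_trace (roe_algebra :: ('g, ('g, 'h) l2) l2 operator set) \<tau> \<and>
    lower_semicontinuous_trace (linf_compact :: ('g, 'h) l2 operator set) (\<lambda>a. \<tau> (left_rep a)) \<and>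
    (\<forall>s. \<forall>a\<in>pos_cone (linf_compact :: ('g, 'h) l2 operator set).
      \<tau> (left_rep (left_translation s a)) = \<tau> (left_rep a)) \<and>
    \<tau> (left_rep p) = 1"
proof -
  let ?R = "roe_algebra :: ('g, ('g, 'h) l2) l2 operator set"
  let ?A = "linf_compact :: ('g, 'h) l2 operator set"
  let ?\<pi> = "left_rep :: ('g, 'h) l2 operator \<Rightarrow> ('g, ('g, 'h) l2) l2 operator"
  obtain c where c: "p = diag_op c" "bounded (range c)" "\<And>t. c t \<in> compact_ops"
    using p(1) by (auto simp: projections_def linf_compact_def)
  have "\<exists>t h. c t h \<noteq> 0"
  proof (rule ccontr)
    assume "\<not> ?thesis"
    then have "p = 0" by (intro blinfun_l2_eqI) (simp add: c(1) diag_op_apply [OF c(2)])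
    then show False using p(2) by simp
  qed
  then obtain t0 h where h: "c t0 h \<noteq> 0" by blast
  define P where "P = ?\<pi> p"
  have pA: "p \<in> ?A" "p o\<^sub>L p = p" "adj p = p" using p(1) by (auto simp: projections_def)
  have pb: "p \<in> bounded_ops" using pA(1) linf_compact_bounded_ops by blast
  have Pb: "P \<in> bounded_ops" unfolding P_def by (rule regular_rep_bounded_ops [OF pb])
  have PP: "P (P x) = P x" for x
    unfolding P_def using regular_rep_compose [of p p] pA(2) by (metis blinfun_apply_blinfun_compose)
  have "adj P = P" unfolding P_def by (simp add: adj_regular_rep [OF pb] pA(3))
  then have Psym: "inner (P x) y = inner x (P y)" for x y using inner_adj [OF Pb] by metis
  \<comment> \<open>The orbit of (0, t0) under the generated subgroup; at that point
    \<open>P\<close> acts as \<open>c t0\<close>, which is not zero. Indexing by finite generating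
    sets instead of finite subgroups makes the family directed at once.\<close>
  define D where "D S = (\<lambda>f. (f, t0)) ` generated_subgroup S" for S :: "'g set"
  define L where "L S = (supp_space (D S) :: ('g, ('g, 'h) l2) l2 set)" for S
  have finD: "finite (D S)" if "finite S" for S
    unfolding D_def using lf that by (simp add: locally_finite_group_def)
  have PL: "P x \<in> L S" if "x \<in> L S" for x S
    using that by (simp add: L_def supp_space_def P_def c(1) regular_rep_diag_op_apply [OF c(2)] blinfun.zero_right)
  have "\<exists>n>0. \<forall>\<epsilon>. 0 < \<epsilon> \<and> \<epsilon> < 1 \<longrightarrow> cut_trace (L S) P \<epsilon> = ennreal ((1 - \<epsilon>) * real n)"
    if S: "finite S" for S
  proof (rule cut_trace_projection)
    let ?x = "l2_single 0 (l2_single t0 h) :: ('g, ('g, 'h) l2) l2"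
    show "?x \<in> L S" by (auto simp: L_def supp_space_def D_def generated_subgroup_props)
    have "l2_apply (l2_apply (P ?x) 0) t0 = c t0 h"
      by (simp add: P_def c(1) regular_rep_diag_op_apply [OF c(2)])
    then show "P ?x \<noteq> 0" using h by force
    show "fin_approx (L S) P"
      unfolding L_def P_def by (rule fin_approx_roe_algebra [OF regular_rep_in_roe_algebra [OF pA(1)] finD [OF S]])
  qed (use PL [of _ S] in \<open>auto simp: PP Psym L_def subspace_supp_space intro: bounded_linear.linear [OF blinfun.bounded_linear_right]\<close>)
  then obtain n where n: "\<And>S. finite S \<Longrightarrow> n S > 0"
    "\<And>S \<epsilon>. finite S \<Longrightarrow> 0 < \<epsilon> \<Longrightarrow> \<epsilon> < 1 \<Longrightarrow> cut_trace (L S) P \<epsilon> = ennreal ((1 - \<epsilon>) * real (n S))"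
    by metis
  \<comment> \<open>The inverse of the rank of \<open>P\<close> on the block, so that
    \<open>P\<close> has the weighted truncated trace 1 - \<epsilon> at every finite stage, whatever
    the size of the block.\<close>
  define w where "w S = ennreal (1 / real (n S))" for S
  obtain H \<Phi> where "trace_limit (finite_subsets_at_top UNIV) L w H \<Phi>"
    using trace_limit_exists [of "finite_subsets_at_top (UNIV :: 'g set)" L w] subspace_supp_space
    by (auto simp: L_def)
  then interpret trace_limit "finite_subsets_at_top UNIV" L w H \<Phi> .
  have evS: "\<forall>\<^sub>F S in finite_subsets_at_top UNIV. left_invariant F (D S)" if "finite F" for F
  proof -
    have "left_invariant F (D S)" if "F \<subseteq> S" for S
    proof -
      have "s \<in> generated_subgroup S" if "s \<in> F" for s
        using that \<open>F \<subseteq> S\<close> generated_subgroup_props(1) by blast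
      then show ?thesis by (auto simp: left_invariant_def D_def generated_subgroup_props(3))
    qed
    then show ?thesis
      using that unfolding eventually_finite_subsets_at_top by (intro exI [of _ F]) auto
  qed
  have comm_le: "\<tau> (adj x o\<^sub>L x) \<le> \<tau> (x o\<^sub>L adj x)" if x: "approx_local x" for x
  proof (rule tau_le)
    fix \<epsilon> \<eta> :: real assume "\<epsilon> > 0" "\<eta> > 0"
    then obtain F where F: "finite F" "\<And>D. left_invariant F D \<Longrightarrow>
        cut_trace (supp_space D) (adj x o\<^sub>L x) (\<epsilon> + \<eta>) \<le> cut_trace (supp_space D) (x o\<^sub>L adj x) \<epsilon>"
      using cut_trace_adj_commute_approx [OF x, of \<eta> \<epsilon>] by auto
    show "\<forall>\<^sub>F S in finite_subsets_at_top UNIV.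
        cut_trace (L S) (adj x o\<^sub>L x) (\<epsilon> + \<eta>) \<le> cut_trace (L S) (x o\<^sub>L adj x) \<epsilon>"
      using evS [OF F(1)] by (rule eventually_mono) (simp add: L_def F(2))
  qed
  have comm: "\<tau> (adj x o\<^sub>L x) = \<tau> (x o\<^sub>L adj x)" if "x \<in> ?R" for x
  proof (rule antisym)
    have x: "approx_local x" by (rule approx_local_roe_algebra [OF that])
    then show "\<tau> (adj x o\<^sub>L x) \<le> \<tau> (x o\<^sub>L adj x)" by (rule comm_le)
    have "x \<in> bounded_ops" using x by (simp add: approx_local_def)
    then show "\<tau> (x o\<^sub>L adj x) \<le> \<tau> (adj x o\<^sub>L x)"
      using comm_le [OF approx_local_adj [OF x]] by (simp add: adj_adj)
  qed
  note facts = pos_cone_facts [OF _ roe_algebra_bounded_ops]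
  note afacts = pos_cone_facts [OF _ linf_compact_bounded_ops]
  have "\<tau> \<in> traces ?R"
    unfolding traces_def using facts(3) by (auto intro!: tau_add tau_scaleR comm)
  moreover have "\<tau> a = (SUP \<epsilon>\<in>{0<..}. \<tau> (cut_down a \<epsilon>))" if "a \<in> pos_cone ?R" for a
    by (rule tau_lower_semicontinuous) (use cut_down_bounds [OF facts(2) [OF that] facts(3) [OF that] facts(1) [OF that]] in auto)
  ultimately have R: "lower_semicontinuous_trace ?R \<tau>"
    by (simp add: lower_semicontinuous_trace_def)
  have comm\<pi>: "\<tau> (?\<pi> (adj x o\<^sub>L x)) = \<tau> (?\<pi> (x o\<^sub>L adj x))" if "x \<in> ?A" for x
  proof -
    have "x \<in> bounded_ops" using that linf_compact_bounded_ops by blast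
    then show ?thesis
      using comm [OF regular_rep_in_roe_algebra [OF that]] by (simp add: regular_rep_compose adj_regular_rep)
  qed
  have "(\<lambda>a. \<tau> (?\<pi> a)) \<in> traces ?A"
    unfolding traces_def using facts(3) [OF pos_cone_regular_rep]
    by (auto simp: regular_rep_add regular_rep_scaleR intro!: tau_add tau_scaleR comm\<pi>)
  moreover have "\<tau> (?\<pi> a) = (SUP \<epsilon>\<in>{0<..}. \<tau> (?\<pi> (cut_down a \<epsilon>)))" if a: "a \<in> pos_cone ?A" for a
  proof (rule tau_lower_semicontinuous)
    fix \<epsilon> :: real and x assume e: "\<epsilon> > 0"
    note cb = cut_down_bounds [OF afacts(2) [OF a] afacts(3) [OF a] afacts(1) [OF a] e]
    \<comment> \<open>It is not the functional calculus that is carried through the representation,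
      but only the two form inequalities, by positivity.\<close>
    have "inner (?\<pi> (a - cut_down a \<epsilon>) x) x \<ge> 0"
      by (rule regular_rep_positive) (use cb(1) in \<open>simp add: blinfun.diff_left inner_diff_left\<close>)
    then show "inner (?\<pi> (cut_down a \<epsilon>) x) x \<le> inner (?\<pi> a x) x"
      by (simp add: regular_rep_diff blinfun.diff_left inner_diff_left)
    have "inner (?\<pi> (cut_down a \<epsilon> - a + \<epsilon> *\<^sub>R id_blinfun) x) x \<ge> 0"
    proof (rule regular_rep_positive)
      show "inner ((cut_down a \<epsilon> - a + \<epsilon> *\<^sub>R id_blinfun) z) z \<ge> 0" for z
        using cb(2) [of z] by (simp add: blinfun.bilinear_simps inner_diff_left inner_add_left power2_norm_eq_inner)
    qed
    then show "inner (?\<pi> a x) x - \<epsilon> * (norm x)\<^sup>2 \<le> inner (?\<pi> (cut_down a \<epsilon>) x) x"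
      by (simp add: regular_rep_diff regular_rep_add regular_rep_scaleR regular_rep_id
          blinfun.bilinear_simps inner_diff_left inner_add_left power2_norm_eq_inner)
  qed
  ultimately have A: "lower_semicontinuous_trace ?A (\<lambda>a. \<tau> (?\<pi> a))"
    by (simp add: lower_semicontinuous_trace_def)
  have inv: "\<tau> (?\<pi> (left_translation s a)) = \<tau> (?\<pi> a)" if "a \<in> pos_cone ?A" for s a
  proof -
    obtain x where x: "x \<in> ?A" "a = adj x o\<^sub>L x" using \<open>a \<in> pos_cone ?A\<close> by (auto simp: pos_cone_def)
    have xb: "x \<in> bounded_ops" using x(1) linf_compact_bounded_ops by blast
    \<comment> \<open>A translation alone need not belong to the Roe algebra, but its product with
      \<open>?\<pi> x\<close> does. By covariance \<open>adj y o\<^sub>L y\<close> represents the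
      translate of \<open>a\<close>, while the translations cancel in
      \<open>y o\<^sub>L adj y\<close>.\<close>
    define y where "y = ?\<pi> x o\<^sub>L shift_op (- s)"
    have adjy: "adj y = shift_op s o\<^sub>L ?\<pi> (adj x)"
      by (simp add: y_def adj_compose regular_rep_bounded_ops xb shift_op_bounded_ops adj_shift_op adj_regular_rep)
    have "?\<pi> (left_translation s a) = adj y o\<^sub>L y"
      by (rule blinfun_eqI) (simp add: regular_rep_covariant x(2) adjy [unfolded y_def] regular_rep_compose y_def)
    moreover have "y o\<^sub>L adj y = ?\<pi> (x o\<^sub>L adj x)"
      by (rule blinfun_eqI) (simp add: adjy [unfolded y_def] regular_rep_compose y_def shift_op_shift_op shift_op_0)
    moreover have "y \<in> ?R" unfolding y_def by (rule regular_rep_shift_in_roe_algebra [OF x(1)])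
    ultimately show ?thesis using comm [of y] comm\<pi> [OF x(1)] by (simp add: x(2))
  qed
  have "\<tau> P = 1"
  proof (rule tau_projection)
    fix \<epsilon> :: real assume e: "0 < \<epsilon>" "\<epsilon> < 1"
    have "w S * cut_trace (L S) P \<epsilon> = ennreal (1 - \<epsilon>)" if "finite S" for S
      using n [OF that] e by (simp add: w_def ennreal_mult [symmetric])
    then show "\<forall>\<^sub>F S in finite_subsets_at_top UNIV. w S * cut_trace (L S) P \<epsilon> = ennreal (1 - \<epsilon>)"
      by (intro eventually_finite_subsets_at_top_weakI) auto
  qed
  then show ?thesis using R A inv unfolding P_def by blast
qed

section \<open>Tensor products with operators on \<open>\<ell>\<^sup>2(\<nat>)\<close>\<close>

lemma scaleC_zero_left [simp]: "0 *\<^sub>C (x::'a::complex_inner) = 0"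
  using scaleR_scaleC [of 0 x] by simp

lemma l2_tensor_apply [simp]: "l2_apply (l2_tensor \<xi> h) i = l2_apply \<xi> i *\<^sub>C h"
proof -
  have "(\<lambda>i. (norm (l2_apply \<xi> i *\<^sub>C h))\<^sup>2) summable_on UNIV"
    unfolding norm_scaleC power_mult_distrib by (intro summable_on_cmult_left l2_summable)
  then show ?thesis unfolding l2_tensor_def by (subst Abs_l2_inverse) auto
qed

lemma cinner_l2_tensor: "cinner (l2_tensor \<xi> h) (l2_tensor \<eta> g) = cinner \<xi> \<eta> * cinner h g"
proof -
  have "cinner (l2_apply \<xi> i *\<^sub>C h) (l2_apply \<eta> i *\<^sub>C g)
      = cinner (l2_apply \<xi> i) (l2_apply \<eta> i) * cinner h g" for i
    by (simp add: cinner_scaleC_left cinner_scaleC_right cinner_complex_def)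
  then show ?thesis unfolding cinner_l2_def by (simp add: infsum_cmult_left')
qed

lemma norm_l2_tensor: "norm (l2_tensor \<xi> h) = norm \<xi> * norm h"
proof -
  have "(norm (l2_tensor \<xi> h))\<^sup>2 = (norm \<xi> * norm h)\<^sup>2"
    using cinner_l2_tensor [of \<xi> h \<xi> h]
    by (simp add: cinner_self power_mult_distrib of_real_mult [symmetric] of_real_power [symmetric]
        del: of_real_mult of_real_power)
  then show ?thesis by (simp add: power2_eq_iff_nonneg)
qed

lemma l2_tensor_simps:
  "l2_tensor (\<xi> + \<eta>) h = l2_tensor \<xi> h + l2_tensor \<eta> h"
  "l2_tensor \<xi> (h + g) = l2_tensor \<xi> h + l2_tensor \<xi> g"
  "l2_tensor (c *\<^sub>C \<xi>) h = c *\<^sub>C l2_tensor \<xi> h"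
  "l2_tensor \<xi> (c *\<^sub>C h) = c *\<^sub>C l2_tensor \<xi> h"
  "l2_tensor (r *\<^sub>R \<xi>) h = r *\<^sub>R l2_tensor \<xi> h"
  "l2_tensor \<xi> (r *\<^sub>R h) = r *\<^sub>R l2_tensor \<xi> h"
  "l2_tensor \<xi> 0 = 0"
  by (auto intro!: l2_eqI simp: scaleC_add_left scaleC_add_right scaleC_scaleC scaleC_complex_def
      scaleC_scaleR scaleR_scaleC mult.commute)

lemma bounded_linear_l2_tensor_left: "bounded_linear (\<lambda>\<xi>. l2_tensor \<xi> h)"
  by (rule bounded_linear_intro [where K = "norm h"]) (simp_all add: l2_tensor_simps norm_l2_tensor)

lemma norm_add_sq_orthogonal: "inner x y = 0 \<Longrightarrow> (norm (x + y))\<^sup>2 = (norm x)\<^sup>2 + (norm y)\<^sup>2"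
  by (simp add: power2_norm_eq_inner inner_add_left inner_add_right inner_commute)

text \<open>Induction on the number of vectors: split off the component of every \<open>h m\<close> in the
  direction of one of them; the two resulting sums are orthogonal.\<close>

lemma norm_sum_l2_tensor_le:
  fixes x :: "'k \<Rightarrow> ('i, complex) l2" and h :: "'k \<Rightarrow> 'h::complex_inner"
  assumes "finite F" "\<And>c. (norm (\<Sum>m\<in>F. c m *\<^sub>C x m))\<^sup>2 \<le> K * (\<Sum>m\<in>F. (cmod (c m))\<^sup>2)"
  shows "(norm (\<Sum>m\<in>F. l2_tensor (x m) (h m)))\<^sup>2 \<le> K * (\<Sum>m\<in>F. (norm (h m))\<^sup>2)"
  using assms
proof (induction F arbitrary: h rule: finite_induct)
  case (insert n F)
  have sub: "(norm (\<Sum>m\<in>F. c m *\<^sub>C x m))\<^sup>2 \<le> K * (\<Sum>m\<in>F. (cmod (c m))\<^sup>2)" for c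
  proof -
    \<comment> \<open>The coefficient 0 at \<open>n\<close> turns the hypothesis for the larger
      index set into the one for \<open>F\<close>.\<close>
    let ?c = "\<lambda>m. if m = n then 0 else c m"
    have "(\<Sum>m\<in>F. ?c m *\<^sub>C x m) = (\<Sum>m\<in>F. c m *\<^sub>C x m)" "(\<Sum>m\<in>F. (cmod (?c m))\<^sup>2) = (\<Sum>m\<in>F. (cmod (c m))\<^sup>2)"
      using insert.hyps(2) by (auto intro!: sum.cong)
    then show ?thesis using insert.prems [of ?c] insert.hyps by simp
  qed
  show ?case
  proof (cases "h n = 0")
    case True
    then show ?thesis using insert.IH [OF sub, of h] insert.hyps by (simp add: l2_tensor_simps)
  next
    case False
    define u where "u = inverse (norm (h n)) *\<^sub>R h n"
    have nu: "norm u = 1" using False by (simp add: u_def)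
    define c where "c m = cinner (h m) u" for m
    define g where "g m = h m - c m *\<^sub>C u" for m
    have h: "h m = c m *\<^sub>C u + g m" for m by (simp add: g_def)
    have gu: "cinner (g m) u = 0" for m
    proof -
      have "cinner (c m *\<^sub>C u + g m) u = c m" by (simp add: c_def [symmetric] h [symmetric])
      then show ?thesis by (simp add: cinner_add_left cinner_scaleC_left cinner_self nu)
    qed
    have ug: "cinner u (g m) = 0" for m using gu [of m] by (metis cinner_commute complex_cnj_zero)
    have "h n = norm (h n) *\<^sub>R u" using False by (simp add: u_def)
    then have hn: "h n = complex_of_real (norm (h n)) *\<^sub>C u" by (simp add: scaleR_scaleC)
    have "c n = complex_of_real (norm (h n)) * cinner u u"
      unfolding c_def by (subst hn) (rule cinner_scaleC_left)
    \<comment> \<open>As \<open>u\<close> points along \<open>h n\<close>, the index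
      \<open>n\<close> drops out of the orthogonal part, to which the induction hypothesis over
      \<open>F\<close> then applies.\<close>
    then have gn: "g n = 0" using hn by (simp add: g_def cinner_self nu)
    have nh: "(norm (h m))\<^sup>2 = (cmod (c m))\<^sup>2 + (norm (g m))\<^sup>2" for m
    proof -
      have "inner (c m *\<^sub>C u) (g m) = 0"
        by (simp add: inner_eq_Re_cinner cinner_scaleC_left ug)
      then show ?thesis using norm_add_sq_orthogonal [of "c m *\<^sub>C u" "g m"]
        by (simp add: h [symmetric] norm_scaleC nu)
    qed
    let ?X = "\<Sum>m\<in>insert n F. c m *\<^sub>C x m"
    let ?Y = "\<Sum>m\<in>F. l2_tensor (x m) (g m)"
    have "(\<Sum>m\<in>insert n F. l2_tensor (x m) (h m))
        = (\<Sum>m\<in>insert n F. l2_tensor (c m *\<^sub>C x m) u) + (\<Sum>m\<in>insert n F. l2_tensor (x m) (g m))"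
      unfolding sum.distrib [symmetric] by (subst h) (simp add: l2_tensor_simps)
    also have "(\<Sum>m\<in>insert n F. l2_tensor (c m *\<^sub>C x m) u) = l2_tensor ?X u"
      by (rule linear_sum [symmetric, OF bounded_linear.linear [OF bounded_linear_l2_tensor_left]])
    also have "(\<Sum>m\<in>insert n F. l2_tensor (x m) (g m)) = ?Y"
      using insert.hyps by (simp add: gn l2_tensor_simps)
    finally have "(norm (\<Sum>m\<in>insert n F. l2_tensor (x m) (h m)))\<^sup>2 = (norm (l2_tensor ?X u + ?Y))\<^sup>2"
      by simp
    also have "\<dots> = (norm ?X)\<^sup>2 + (norm ?Y)\<^sup>2"
    proof -
      have "inner (l2_tensor ?X u) ?Y = 0"
        unfolding inner_sum_right
        by (intro sum.neutral ballI) (simp add: inner_eq_Re_cinner cinner_l2_tensor ug)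
      then show ?thesis by (simp only: norm_add_sq_orthogonal norm_l2_tensor nu) simp
    qed
    also have "\<dots> \<le> K * (\<Sum>m\<in>insert n F. (cmod (c m))\<^sup>2) + K * (\<Sum>m\<in>F. (norm (g m))\<^sup>2)"
      by (intro add_mono insert.prems insert.IH sub)
    also have "\<dots> = K * (\<Sum>m\<in>insert n F. (norm (h m))\<^sup>2)"
      using insert.hyps by (simp add: nh gn sum.distrib algebra_simps)
    finally show ?thesis .
  qed
qed simp

lemma l2_sq_sums:
  fixes \<xi> :: "(nat, 'h::complex_inner) l2"
  shows "(\<lambda>n. (norm (l2_apply \<xi> n))\<^sup>2) sums (norm \<xi>)\<^sup>2"
  unfolding norm_l2_sq by (rule has_sum_imp_sums) (rule has_sum_infsum [OF l2_summable])

lemma l2_single_sums: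
  fixes \<xi> :: "(nat, 'h::complex_inner) l2"
  shows "(\<lambda>n. l2_single n (l2_apply \<xi> n)) sums \<xi>"
proof -
  define P where "P n = (\<Sum>m<n. l2_single m (l2_apply \<xi> m))" for n
  have 1: "inner \<xi> (P n) = (\<Sum>m<n. (norm (l2_apply \<xi> m))\<^sup>2)" for n
    by (simp add: P_def inner_sum_right inner_l2_single power2_norm_eq_inner)
  have 2: "inner (P n) (P n) = (\<Sum>m<n. (norm (l2_apply \<xi> m))\<^sup>2)" for n
  proof -
    have "l2_apply (P n) i = (\<Sum>m<n. if i = m then l2_apply \<xi> m else 0)" for i
      unfolding P_def l2_apply_sum by (intro sum.cong refl) simp
    then have ap: "l2_apply (P n) i = (if i < n then l2_apply \<xi> i else 0)" for i by simp
    have "inner (P n) (P n) = (\<Sum>m<n. inner (l2_apply (P n) m) (l2_apply \<xi> m))"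
      by (subst (2) P_def) (simp only: inner_sum_right inner_l2_single)
    also have "\<dots> = (\<Sum>m<n. (norm (l2_apply \<xi> m))\<^sup>2)"
      by (intro sum.cong refl) (simp add: ap power2_norm_eq_inner)
    finally show ?thesis .
  qed
  have "(norm (P n - \<xi>))\<^sup>2 = (norm \<xi>)\<^sup>2 - (\<Sum>m<n. (norm (l2_apply \<xi> m))\<^sup>2)" for n
    using 1 [of n] 2 [of n] inner_commute [of "P n" \<xi>]
    by (simp add: power2_norm_eq_inner inner_diff_left inner_diff_right)
  moreover have "(\<lambda>n. (norm \<xi>)\<^sup>2 - (\<Sum>m<n. (norm (l2_apply \<xi> m))\<^sup>2)) \<longlonglongrightarrow> (norm \<xi>)\<^sup>2 - (norm \<xi>)\<^sup>2"
    using l2_sq_sums [of \<xi>] by (intro tendsto_intros) (simp add: sums_def)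
  ultimately have "(\<lambda>n. (norm (P n - \<xi>))\<^sup>2) \<longlonglongrightarrow> 0" by simp
  then have "(\<lambda>n. sqrt ((norm (P n - \<xi>))\<^sup>2)) \<longlonglongrightarrow> sqrt 0" by (rule tendsto_real_sqrt)
  then have "(\<lambda>n. norm (P n - \<xi>)) \<longlonglongrightarrow> 0" by simp
  then show ?thesis unfolding sums_def P_def [symmetric] by (simp add: LIM_zero_iff tendsto_norm_zero_iff)
qed

lemma blinfun_l2_single_eqI:
  fixes S T :: "(nat, 'h::complex_inner) l2 \<Rightarrow>\<^sub>L 'b::real_normed_vector"
  assumes "\<And>n h. S (l2_single n h) = T (l2_single n h)"
  shows "S = T"
proof (rule blinfun_eqI)
  fix \<xi>
  have "(\<lambda>n. S (l2_single n (l2_apply \<xi> n))) sums S \<xi>" "(\<lambda>n. T (l2_single n (l2_apply \<xi> n))) sums T \<xi>"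
    by (intro bounded_linear.sums [OF blinfun.bounded_linear_right] l2_single_sums)+
  then show "S \<xi> = T \<xi>" using assms sums_unique2 by fastforce
qed

lemma tensor_left_bound:
  fixes k :: "(nat, complex) l2 operator" and \<xi> :: "(nat, 'h::complex_inner) l2"
  assumes "k \<in> bounded_ops" "finite F"
  shows "(norm (\<Sum>m\<in>F. l2_tensor (k (l2_single m 1)) (l2_apply \<xi> m)))\<^sup>2
    \<le> (norm k)\<^sup>2 * (\<Sum>m\<in>F. (norm (l2_apply \<xi> m))\<^sup>2)"
proof (rule norm_sum_l2_tensor_le [OF assms(2)])
  fix c :: "nat \<Rightarrow> complex"
  let ?s = "\<Sum>m\<in>F. c m *\<^sub>C l2_single m (1::complex)"
  have ap: "l2_apply ?s i = (if i \<in> F then c i else 0)" for i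
  proof -
    have "l2_apply ?s i = (\<Sum>m\<in>F. if i = m then c m else 0)"
      unfolding l2_apply_sum by (intro sum.cong refl) (simp add: scaleC_complex_def)
    then show ?thesis using assms(2) by simp
  qed
  have "(norm ?s)\<^sup>2 = (\<Sum>\<^sub>\<infinity>i\<in>F. (norm (c i))\<^sup>2)"
    unfolding norm_l2_sq ap by (rule infsum_cong_neutral) auto
  then have s: "(norm ?s)\<^sup>2 = (\<Sum>i\<in>F. (cmod (c i))\<^sup>2)" using assms(2) by simp
  have "(\<Sum>m\<in>F. c m *\<^sub>C k (l2_single m 1)) = k ?s"
    by (simp add: blinfun.sum_right bounded_opsD [OF assms(1)])
  then have "(norm (\<Sum>m\<in>F. c m *\<^sub>C k (l2_single m 1)))\<^sup>2 \<le> (norm k * norm ?s)\<^sup>2"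
    by (simp add: power_mono norm_blinfun)
  then show "(norm (\<Sum>m\<in>F. c m *\<^sub>C k (l2_single m 1)))\<^sup>2 \<le> (norm k)\<^sup>2 * (\<Sum>m\<in>F. (cmod (c m))\<^sup>2)"
    by (simp only: power_mult_distrib s)
qed

text \<open>This is k \<otimes> 1, built from the columns of \<open>k\<close>. The definite
  description in \<open>op_tensor\<close> requires such an operator to exist. In general the series
  does not converge absolutely; its convergence rests on \<open>tensor_left_bound\<close>.\<close>

definition tensor_one :: "(nat, complex) l2 operator \<Rightarrow> (nat, 'h::chilbert_space) l2 operator"
  where "tensor_one k = Blinfun (\<lambda>\<xi>. \<Sum>m. l2_tensor (k (l2_single m 1)) (l2_apply \<xi> m))"

lemma tensor_one_summable:
  fixes \<xi> :: "(nat, 'h::chilbert_space) l2"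
  assumes "k \<in> bounded_ops"
  shows "summable (\<lambda>m. l2_tensor (k (l2_single m 1)) (l2_apply \<xi> m))"
  unfolding summable_Cauchy
proof (intro allI impI)
  fix e :: real assume "e > 0"
  define d where "d = (e / (norm k + 1))\<^sup>2"
  have k1: "norm k + 1 > 0" by (simp add: add_nonneg_pos)
  have "d > 0" using \<open>e > 0\<close> k1 by (simp add: d_def)
  moreover have "summable (\<lambda>n. (norm (l2_apply \<xi> n))\<^sup>2)" using l2_sq_sums sums_summable by blast
  ultimately obtain N where N: "\<And>m n. m \<ge> N \<Longrightarrow> norm (\<Sum>i\<in>{m..<n}. (norm (l2_apply \<xi> i))\<^sup>2) < d"
    unfolding summable_Cauchy by metis
  have "norm (\<Sum>i\<in>{m..<n}. l2_tensor (k (l2_single i 1)) (l2_apply \<xi> i)) < e" if "m \<ge> N" for m n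
  proof -
    have "(norm (\<Sum>i\<in>{m..<n}. l2_tensor (k (l2_single i 1)) (l2_apply \<xi> i)))\<^sup>2
        \<le> (norm k)\<^sup>2 * (\<Sum>i\<in>{m..<n}. (norm (l2_apply \<xi> i))\<^sup>2)"
      by (rule tensor_left_bound [OF assms]) simp
    also have "\<dots> \<le> (norm k + 1)\<^sup>2 * (\<Sum>i\<in>{m..<n}. (norm (l2_apply \<xi> i))\<^sup>2)"
      by (intro mult_right_mono power_mono sum_nonneg) auto
    also have "\<dots> < (norm k + 1)\<^sup>2 * d"
      using N [OF that, of n] k1 by (intro mult_strict_left_mono) auto
    also have "\<dots> = e\<^sup>2" using k1 by (simp add: d_def power_divide)
    finally show ?thesis using \<open>e > 0\<close> by (simp add: power_less_imp_less_base)
  qed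
  then show "\<exists>N. \<forall>m\<ge>N. \<forall>n. norm (\<Sum>i\<in>{m..<n}. l2_tensor (k (l2_single i 1)) (l2_apply \<xi> i)) < e"
    by blast
qed

lemma
  fixes \<xi> :: "(nat, 'h::chilbert_space) l2"
  assumes k: "k \<in> bounded_ops"
  shows tensor_one_sums: "(\<lambda>m. l2_tensor (k (l2_single m 1)) (l2_apply \<xi> m)) sums tensor_one k \<xi>"
    and norm_tensor_one_le: "norm (tensor_one k :: (nat, 'h) l2 operator) \<le> norm k"
proof -
  define T where "T \<xi> = (\<Sum>m. l2_tensor (k (l2_single m 1)) (l2_apply \<xi> m))" for \<xi> :: "(nat, 'h) l2"
  have sums: "(\<lambda>m. l2_tensor (k (l2_single m 1)) (l2_apply \<xi> m)) sums T \<xi>" for \<xi>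
    unfolding T_def by (rule summable_sums [OF tensor_one_summable [OF k]])
  have le: "norm (T \<xi>) \<le> norm \<xi> * norm k" for \<xi>
  proof (rule LIMSEQ_le_const2)
    show "(\<lambda>n. norm (\<Sum>m<n. l2_tensor (k (l2_single m 1)) (l2_apply \<xi> m))) \<longlonglongrightarrow> norm (T \<xi>)"
      using sums [of \<xi>] unfolding sums_def by (rule tendsto_norm)
    have "norm (\<Sum>m<n. l2_tensor (k (l2_single m 1)) (l2_apply \<xi> m)) \<le> norm \<xi> * norm k" for n
    proof (rule power2_le_imp_le)
      have "(norm (\<Sum>m<n. l2_tensor (k (l2_single m 1)) (l2_apply \<xi> m)))\<^sup>2
          \<le> (norm k)\<^sup>2 * (\<Sum>m<n. (norm (l2_apply \<xi> m))\<^sup>2)"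
        by (rule tensor_left_bound [OF k]) simp
      also have "\<dots> \<le> (norm k)\<^sup>2 * (norm \<xi>)\<^sup>2"
        by (intro mult_left_mono sum_norm_l2_le) auto
      finally show "(norm (\<Sum>m<n. l2_tensor (k (l2_single m 1)) (l2_apply \<xi> m)))\<^sup>2 \<le> (norm \<xi> * norm k)\<^sup>2"
        by (simp add: power_mult_distrib mult.commute)
    qed simp
    then show "\<exists>N. \<forall>n\<ge>N. norm (\<Sum>m<n. l2_tensor (k (l2_single m 1)) (l2_apply \<xi> m)) \<le> norm \<xi> * norm k"
      by blast
  qed
  have "bounded_linear T"
  proof (rule bounded_linear_intro [OF _ _ le])
    show "T (\<xi> + \<eta>) = T \<xi> + T \<eta>" for \<xi> \<eta>
      using sums_add [OF sums [of \<xi>] sums [of \<eta>]] sums [of "\<xi> + \<eta>"]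
      by (simp add: l2_tensor_simps sums_unique2)
    show "T (r *\<^sub>R \<xi>) = r *\<^sub>R T \<xi>" for r \<xi>
      using sums_scaleR_right [OF sums [of \<xi>], of r] sums [of "r *\<^sub>R \<xi>"]
      by (simp add: l2_tensor_simps sums_unique2)
  qed
  then have eq: "tensor_one k \<xi> = T \<xi>" for \<xi>
    unfolding tensor_one_def T_def [abs_def] by (rule bounded_linear_Blinfun_apply [THEN fun_cong])
  show "(\<lambda>m. l2_tensor (k (l2_single m 1)) (l2_apply \<xi> m)) sums tensor_one k \<xi>"
    using sums eq by simp
  show "norm (tensor_one k :: (nat, 'h) l2 operator) \<le> norm k"
    by (rule norm_blinfun_bound) (use le eq in \<open>simp_all add: mult.commute\<close>)
qed

lemma tensor_one_l2_single:
  assumes "k \<in> bounded_ops"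
  shows "tensor_one k (l2_single n (h::'h::chilbert_space)) = l2_tensor (k (l2_single n 1)) h"
proof -
  have "(\<lambda>m. l2_tensor (k (l2_single m 1)) (l2_apply (l2_single n h) m))
      = (\<lambda>m. if m = n then l2_tensor (k (l2_single m 1)) h else 0)"
    by (auto simp: l2_tensor_simps)
  then show ?thesis
    using tensor_one_sums [OF assms, of "l2_single n h"] sums_single [of n "\<lambda>m. l2_tensor (k (l2_single m 1)) h"]
    by (auto intro: sums_unique2)
qed

lemma tensor_one_l2_tensor:
  assumes k: "k \<in> bounded_ops"
  shows "tensor_one k (l2_tensor \<xi> (h::'h::chilbert_space)) = l2_tensor (k \<xi>) h"
proof -
  have "l2_tensor (k (l2_single m 1)) (l2_apply (l2_tensor \<xi> h) m) = l2_tensor (k (l2_single m (l2_apply \<xi> m))) h" for m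
  proof -
    have "l2_single m (l2_apply \<xi> m) = l2_apply \<xi> m *\<^sub>C l2_single m 1"
      by (rule l2_eqI) (simp add: scaleC_complex_def)
    then show ?thesis by (simp add: bounded_opsD [OF k] l2_tensor_simps)
  qed
  then have "(\<lambda>m. l2_tensor (k (l2_single m (l2_apply \<xi> m))) h) sums tensor_one k (l2_tensor \<xi> h)"
    using tensor_one_sums [OF k, of "l2_tensor \<xi> h"] by simp
  moreover have "(\<lambda>m. l2_tensor (k (l2_single m (l2_apply \<xi> m))) h) sums l2_tensor (k \<xi>) h"
    by (intro bounded_linear.sums [OF bounded_linear_l2_tensor_left]
        bounded_linear.sums [OF blinfun.bounded_linear_right] l2_single_sums)
  ultimately show ?thesis by (rule sums_unique2)
qed

lemma tensor_one_bounded_ops: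
  assumes k: "k \<in> bounded_ops"
  shows "(tensor_one k :: (nat, 'h::chilbert_space) l2 operator) \<in> bounded_ops"
  unfolding bounded_ops_def
proof (intro CollectI allI)
  fix c and \<xi> :: "(nat, 'h) l2"
  have "(\<lambda>m. c *\<^sub>C l2_tensor (k (l2_single m 1)) (l2_apply \<xi> m)) sums (c *\<^sub>C tensor_one k \<xi>)"
    by (rule bounded_linear.sums [OF bounded_linear_scaleC tensor_one_sums [OF k]])
  then show "tensor_one k (c *\<^sub>C \<xi>) = c *\<^sub>C tensor_one k \<xi>"
    using tensor_one_sums [OF k, of "c *\<^sub>C \<xi>"] by (simp add: l2_tensor_simps sums_unique2)
qed

text \<open>a \<otimes> k is the product of k \<otimes> 1 and a \<otimes> 1. It is unique because
  the coordinate vectors are elementary tensors and have dense span.\<close>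

lemma op_tensor_eq:
  fixes a :: "'h::chilbert_space operator"
  assumes "a \<in> bounded_ops" "k \<in> bounded_ops"
  shows "op_tensor a k = tensor_one k o\<^sub>L diag_op (\<lambda>_. a)"
  unfolding op_tensor_def
proof (rule the_equality)
  have diag: "diag_op (\<lambda>_. a) (l2_tensor \<xi> h) = l2_tensor \<xi> (a h)" for \<xi> :: "(nat, complex) l2" and h
    by (rule l2_eqI) (simp add: diag_op_apply bounded_opsD [OF assms(1)])
  show T: "\<forall>\<xi> h. (tensor_one k o\<^sub>L diag_op (\<lambda>_. a)) (l2_tensor \<xi> h) = l2_tensor (k \<xi>) (a h)"
    by (simp add: diag tensor_one_l2_tensor [OF assms(2)])
  fix S :: "(nat, 'h) l2 operator"
  assume S: "\<forall>\<xi> h. S (l2_tensor \<xi> h) = l2_tensor (k \<xi>) (a h)"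
  have single: "l2_single n h = l2_tensor (l2_single n 1) h" for n and h :: 'h
    by (rule l2_eqI) simp
  show "S = tensor_one k o\<^sub>L diag_op (\<lambda>_. a)"
    by (rule blinfun_l2_single_eqI) (simp only: single S T)
qed

section \<open>The stabilisation of the Roe algebra\<close>

text \<open>Even for finite \<open>D\<close> every site occurs in infinitely many copies; in that
  direction finiteness has to come from the compact tensor factor.\<close>

definition stable_supp :: "('g \<times> 'k) set \<Rightarrow> (nat, ('g, ('k, 'h::complex_inner) l2) l2) l2 set"
  where "stable_supp D = {\<Xi>. \<forall>n. l2_apply \<Xi> n \<in> supp_space D}"

lemma subspace_stable_supp: "subspace (stable_supp D)"
  using subspace_supp_space [of D] by (auto simp: stable_supp_def subspace_def)

text \<open>k \<otimes> 1 only mixes the copies: each coordinate of the result is a limit of complex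
  combinations of vectors in the closed space \<open>supp_space D\<close>.\<close>

lemma tensor_one_stable_supp:
  fixes \<Xi> :: "(nat, ('g, ('k, 'h::chilbert_space) l2) l2) l2"
  assumes k: "k \<in> bounded_ops" and \<Xi>: "\<Xi> \<in> stable_supp D"
  shows "tensor_one k \<Xi> \<in> stable_supp D"
  unfolding stable_supp_def
proof (intro CollectI allI)
  fix n
  have "(\<lambda>m. l2_apply (l2_tensor (k (l2_single m 1)) (l2_apply \<Xi> m)) n) sums l2_apply (tensor_one k \<Xi>) n"
    by (rule bounded_linear.sums [OF bounded_linear_l2_apply tensor_one_sums [OF k]])
  then have lim: "(\<lambda>N. \<Sum>m<N. l2_apply (k (l2_single m 1)) n *\<^sub>C l2_apply \<Xi> m) \<longlonglongrightarrow> l2_apply (tensor_one k \<Xi>) n"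
    by (simp add: sums_def)
  have mem: "(\<Sum>m<N. l2_apply (k (l2_single m 1)) n *\<^sub>C l2_apply \<Xi> m) \<in> supp_space D" for N
    using \<Xi> by (intro subspace_sum [OF subspace_supp_space] scaleC_supp_space) (simp add: stable_supp_def)
  show "l2_apply (tensor_one k \<Xi>) n \<in> supp_space D"
    by (rule closed_sequentially [OF closed_supp_space mem lim])
qed

lemma diag_op_const_apply: "l2_apply (diag_op (\<lambda>_. a) \<xi>) n = a (l2_apply \<xi> n)"
  by (rule diag_op_apply) simp

lemma diag_op_const_bounded_ops: "a \<in> bounded_ops \<Longrightarrow> diag_op (\<lambda>_. a) \<in> bounded_ops"
  by (rule diag_op_bounded_ops) simp_all

lemma op_tensor_bounded_ops:
  fixes a :: "'h::chilbert_space operator" and k :: "(nat, complex) l2 operator"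
  shows "a \<in> bounded_ops \<Longrightarrow> k \<in> bounded_ops \<Longrightarrow> op_tensor a k \<in> bounded_ops"
  by (simp add: op_tensor_eq compose_bounded_ops tensor_one_bounded_ops diag_op_const_bounded_ops)

lemma norm_op_tensor_diff_le:
  fixes a b :: "'h::chilbert_space operator" and k :: "(nat, complex) l2 operator"
  assumes "a \<in> bounded_ops" "b \<in> bounded_ops" "k \<in> bounded_ops"
  shows "norm (op_tensor a k - op_tensor b k) \<le> norm k * norm (a - b)"
proof -
  have "op_tensor a k - op_tensor b k = tensor_one k o\<^sub>L diag_op (\<lambda>_. a - b)"
  proof (rule blinfun_eqI)
    fix \<xi> :: "(nat, 'h) l2"
    have "diag_op (\<lambda>_. a - b) \<xi> = diag_op (\<lambda>_. a) \<xi> - diag_op (\<lambda>_. b) \<xi>"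
      by (rule l2_eqI) (simp add: diag_op_const_apply blinfun.diff_left)
    then show "(op_tensor a k - op_tensor b k) \<xi> = (tensor_one k o\<^sub>L diag_op (\<lambda>_. a - b)) \<xi>"
      by (simp add: op_tensor_eq assms blinfun.bilinear_simps)
  qed
  also have "norm \<dots> \<le> norm (tensor_one k :: (nat, 'h) l2 operator) * norm (diag_op (\<lambda>_::nat. a - b))"
    by (rule norm_blinfun_compose)
  also have "\<dots> \<le> norm k * norm (a - b)"
    by (intro mult_mono norm_tensor_one_le assms norm_diag_op_le) auto
  finally show ?thesis .
qed

section \<open>Truncation in the sequence coordinate\<close>

definition tail_op :: "nat \<Rightarrow> (nat, 'h::complex_inner) l2 operator"
  where "tail_op n = diag_op (\<lambda>i. if i < n then 0 else id_blinfun)"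

lemma norm_tail_le: "norm ((if i < n then 0 else id_blinfun) :: 'h::complex_inner operator) \<le> 1"
  by (auto intro!: norm_blinfun_bound)

lemma bounded_tail: "bounded (range (\<lambda>i. if i < n then 0 else id_blinfun :: 'h::complex_inner operator))"
  unfolding bounded_iff using norm_tail_le by blast

lemma tail_op_apply: "l2_apply (tail_op n \<xi>) i = (if i < n then 0 else l2_apply \<xi> i)"
  unfolding tail_op_def by (subst diag_op_apply [OF bounded_tail]) simp

lemma norm_tail_op_le: "norm (tail_op n) \<le> 1"
  unfolding tail_op_def by (rule norm_diag_op_le) (rule norm_tail_le)

lemma tail_op_bounded_ops: "tail_op n \<in> bounded_ops"
  unfolding tail_op_def
  by (rule diag_op_bounded_ops [OF bounded_tail]) (simp add: zero_bounded_ops id_bounded_ops)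

lemma tail_op_eq: "tail_op n \<xi> = \<xi> - (\<Sum>j<n. l2_single j (l2_apply \<xi> j))"
proof (rule l2_eqI)
  fix i
  have "(\<Sum>j<n. l2_apply (l2_single j (l2_apply \<xi> j)) i) = (\<Sum>j<n. if i = j then l2_apply \<xi> j else 0)"
    by (intro sum.cong refl) simp
  then show "l2_apply (tail_op n \<xi>) i = l2_apply (\<xi> - (\<Sum>j<n. l2_single j (l2_apply \<xi> j))) i"
    by (simp add: tail_op_apply)
qed

text \<open>The tail projections tend to 0 strongly, hence uniformly on the unit ball of a
  finite-dimensional space approximating the values of \<open>k\<close>. The approximation error
  stays small because they are contractions.\<close>

lemma compact_op_tail:
  fixes k :: "(nat, complex) l2 operator"
  assumes k: "k \<in> compact_ops" and "\<eta> > 0"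
  shows "\<exists>n. norm (tail_op n o\<^sub>L k) \<le> \<eta>"
proof -
  have e: "\<eta> / 2 > 0" using \<open>\<eta> > 0\<close> by simp
  obtain C where C: "finite C" "\<And>x. \<exists>y\<in>span C. norm (k x - y) \<le> \<eta> / 2 * norm x"
    using fin_approxE [OF fin_approx_compact_op [OF k, of UNIV] e] by (metis UNIV_I)
  obtain B where B: "orthonormal B" "span B = span C" using gram_schmidt [OF C(1)] by blast
  \<comment> \<open>\<open>K * norm x\<close> bounds the approximant of \<open>k x\<close>, which
    determines how small the tails of the basis vectors have to be.\<close>
  define K where "K = norm k + \<eta> / 2"
  have K: "K > 0" using e by (simp add: K_def add_nonneg_pos)
  have "(\<lambda>n. tail_op n b) \<longlonglongrightarrow> 0" for b :: "(nat, complex) l2"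
  proof -
    have "(\<lambda>n. b - (\<Sum>j<n. l2_single j (l2_apply b j))) \<longlonglongrightarrow> b - b"
      using l2_single_sums [of b] by (intro tendsto_intros) (simp add: sums_def)
    then show ?thesis by (simp only: tail_op_eq diff_self)
  qed
  then have "(\<lambda>n. \<Sum>b\<in>B. norm (tail_op n b)) \<longlonglongrightarrow> (\<Sum>b\<in>B. 0)"
    by (intro tendsto_sum tendsto_norm_zero)
  moreover have "\<eta> / 2 / K > 0" using e K by simp
  ultimately obtain n where "norm ((\<Sum>b\<in>B. norm (tail_op n b)) - (\<Sum>b\<in>B. 0)) < \<eta> / 2 / K"
    using LIMSEQ_D by blast
  then have n: "(\<Sum>b\<in>B. norm (tail_op n b)) \<le> \<eta> / 2 / K" by (simp add: sum_nonneg)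
  have "norm ((tail_op n o\<^sub>L k) x) \<le> \<eta> * norm x" for x
  proof -
    obtain y where y: "y \<in> span B" "norm (k x - y) \<le> \<eta> / 2 * norm x" using C(2) B(2) by blast
    have "norm y \<le> norm (k x) + norm (k x - y)"
      using norm_triangle_ineq2 [of y "k x"] by (simp add: norm_minus_commute)
    then have ny: "norm y \<le> K * norm x"
      using y(2) norm_blinfun [of k x] by (simp add: K_def algebra_simps)
    have "tail_op n y = tail_op n (\<Sum>b\<in>B. inner y b *\<^sub>R b)" by (simp only: orthonormal_expand [OF B(1) y(1)])
    also have "\<dots> = (\<Sum>b\<in>B. inner y b *\<^sub>R tail_op n b)" by (simp add: blinfun.sum_right blinfun.scaleR_right)
    also have "norm \<dots> \<le> (\<Sum>b\<in>B. norm y * norm (tail_op n b))"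
    proof (rule sum_norm_le)
      fix b assume "b \<in> B"
      then have "\<bar>inner y b\<bar> \<le> norm y"
        using Cauchy_Schwarz_ineq2 [of y b] orthonormal_norm [OF B(1)] by simp
      then show "norm (inner y b *\<^sub>R tail_op n b) \<le> norm y * norm (tail_op n b)"
        by (simp add: mult_right_mono)
    qed
    also have "\<dots> \<le> (K * norm x) * (\<eta> / 2 / K)"
      unfolding sum_distrib_left [symmetric]
      using ny n K by (intro mult_mono) (auto intro: sum_nonneg)
    also have "\<dots> = \<eta> / 2 * norm x" using K by simp
    finally have 1: "norm (tail_op n y) \<le> \<eta> / 2 * norm x" .
    have 2: "norm (tail_op n (k x - y)) \<le> \<eta> / 2 * norm x"
      using blinfun_norm_le [OF norm_tail_op_le, of n "k x - y"] y(2) by simp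
    have "(tail_op n o\<^sub>L k) x = tail_op n (k x - y) + tail_op n y"
      by (simp add: blinfun.diff_right)
    then show ?thesis
      using norm_triangle_ineq [of "tail_op n (k x - y)" "tail_op n y"] 1 2 by (simp add: algebra_simps)
  qed
  then show ?thesis using \<open>\<eta> > 0\<close> by (intro exI [of _ n] norm_blinfun_bound) auto
qed

lemma tensor_one_diag_commute:
  fixes a :: "'h::chilbert_space operator"
  assumes "k \<in> bounded_ops" "a \<in> bounded_ops"
  shows "tensor_one k (diag_op (\<lambda>_. a) \<xi>) = diag_op (\<lambda>_. a) (tensor_one k \<xi>)"
proof -
  have single: "diag_op (\<lambda>_. a) (l2_single n h) = l2_single n (a h)" for n :: nat and h
    by (rule l2_eqI) (simp add: diag_op_const_apply blinfun.zero_right)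
  have tensor: "diag_op (\<lambda>_. a) (l2_tensor \<eta> h) = l2_tensor \<eta> (a h)" for \<eta> :: "(nat, complex) l2" and h
    by (rule l2_eqI) (simp add: diag_op_const_apply bounded_opsD [OF assms(2)])
  have "tensor_one k o\<^sub>L diag_op (\<lambda>_. a) = diag_op (\<lambda>_. a) o\<^sub>L tensor_one k"
    by (rule blinfun_l2_single_eqI) (simp add: single tensor tensor_one_l2_single [OF assms(1)])
  then show ?thesis by (metis blinfun_apply_blinfun_compose)
qed

lemma tensor_one_tail:
  fixes \<xi> :: "(nat, 'h::chilbert_space) l2"
  assumes "k \<in> bounded_ops"
  shows "tensor_one (tail_op n o\<^sub>L k) \<xi> = tail_op n (tensor_one k \<xi>)"
proof -
  have "tail_op n (l2_tensor \<eta> h) = l2_tensor (tail_op n \<eta>) h" for \<eta> :: "(nat, complex) l2" and h :: 'h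
    by (rule l2_eqI) (simp add: tail_op_apply)
  then have "(tensor_one (tail_op n o\<^sub>L k) :: (nat, 'h) l2 operator) = tail_op n o\<^sub>L tensor_one k"
    by (intro blinfun_l2_single_eqI)
      (simp add: tensor_one_l2_single assms compose_bounded_ops tail_op_bounded_ops)
  then show ?thesis by simp
qed

text \<open>The first \<open>n\<close> coordinates contribute finitely many maps that are compact in
  the sense of \<open>fin_approx\<close>, and the rest is small because the tail of \<open>k\<close>
  is. Applying \<open>w\<close> after \<open>k\<close>, by \<open>tensor_one_diag_commute\<close>,
  lets it act on one vector of \<open>supp_space D\<close> per coordinate.\<close>

lemma fin_approx_op_tensor:
  fixes w :: "('g, ('k, 'h::chilbert_space) l2) l2 operator" and k :: "(nat, complex) l2 operator"
  assumes w: "w \<in> bounded_ops" "fin_approx (supp_space D) w" and k: "k \<in> compact_ops"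
  shows "fin_approx (stable_supp D) (op_tensor w k)"
proof (rule fin_approx_limit)
  have kb: "k \<in> bounded_ops" using k by (simp add: compact_ops_def)
  fix \<eta> :: real assume "\<eta> > 0"
  then have "\<eta> / (norm w + 1) > 0" by (simp add: add_nonneg_pos)
  then obtain n where n: "norm (tail_op n o\<^sub>L k) \<le> \<eta> / (norm w + 1)" using compact_op_tail [OF k] by blast
  define S where "S \<Xi> = (\<Sum>j<n. l2_single j (w (l2_apply (tensor_one k \<Xi>) j)))"
    for \<Xi> :: "(nat, ('g, ('k, 'h) l2) l2) l2"
  have "fin_approx (stable_supp D) (\<lambda>\<Xi>. l2_single j (w (l2_apply (tensor_one k \<Xi>) j)))" for j :: nat
  proof (rule fin_approx_compose_left [OF _ bounded_linear_l2_single])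
    show "fin_approx (stable_supp D) (\<lambda>\<Xi>. w (l2_apply (tensor_one k \<Xi>) j))"
    proof (rule fin_approx_compose_right [OF w(2), where K = "norm k"])
      fix \<Xi> :: "(nat, ('g, ('k, 'h) l2) l2) l2" assume "\<Xi> \<in> stable_supp D"
      then show "l2_apply (tensor_one k \<Xi>) j \<in> supp_space D"
        using tensor_one_stable_supp [OF kb] by (auto simp: stable_supp_def)
      show "norm (l2_apply (tensor_one k \<Xi>) j) \<le> norm k * norm \<Xi>"
        by (rule order_trans [OF norm_l2_apply_le blinfun_norm_le [OF norm_tensor_one_le [OF kb]]])
    qed
  qed
  then have "fin_approx (stable_supp D) S" unfolding S_def [abs_def] by (intro fin_approx_sum)
  moreover have "norm (op_tensor w k \<Xi> - S \<Xi>) \<le> \<eta> * norm \<Xi>" for \<Xi>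
  proof -
    have "S \<Xi> = (\<Sum>j<n. l2_single j (l2_apply (op_tensor w k \<Xi>) j))"
      by (simp add: S_def op_tensor_eq [OF w(1) kb] tensor_one_diag_commute [OF kb w(1)] diag_op_const_apply)
    then have "op_tensor w k \<Xi> - S \<Xi> = tensor_one (tail_op n o\<^sub>L k) (diag_op (\<lambda>_. w) \<Xi>)"
      by (simp add: tail_op_eq [symmetric] op_tensor_eq [OF w(1) kb] tensor_one_tail [OF kb])
    also have "norm \<dots> \<le> norm (tail_op n o\<^sub>L k) * norm (diag_op (\<lambda>_. w) \<Xi>)"
      by (rule order_trans [OF norm_blinfun])
        (intro mult_right_mono norm_tensor_one_le compose_bounded_ops tail_op_bounded_ops kb, simp)
    also have "\<dots> \<le> \<eta> / (norm w + 1) * ((norm w + 1) * norm \<Xi>)"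
    proof (intro mult_mono n)
      show "norm (diag_op (\<lambda>_. w) \<Xi>) \<le> (norm w + 1) * norm \<Xi>"
        by (intro blinfun_norm_le norm_diag_op_le) simp
    qed (use \<open>\<eta> / (norm w + 1) > 0\<close> in auto)
    also have "\<dots> = \<eta> * norm \<Xi>"
      using norm_ge_zero [of w] by (simp add: add_nonneg_eq_0_iff)
    finally show ?thesis .
  qed
  ultimately show "\<exists>S. fin_approx (stable_supp D) S \<and>
      (\<forall>\<Xi>\<in>stable_supp D. norm (op_tensor w k \<Xi> - S \<Xi>) \<le> \<eta> * norm \<Xi>)" by blast
qed

definition stable_sums :: "'h::complex_inner operator set \<Rightarrow> (nat, 'h) l2 operator set"
  where "stable_sums A = {\<Sum>i<n. op_tensor (a i) (k i) | (n::nat) a k. \<forall>i<n. a i \<in> A \<and> k i \<in> compact_ops}"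

lemma stabilization_eq: "stabilization A = closure (stable_sums A)"
  by (simp add: stabilization_def stable_sums_def)

lemma stabilization_bounded_ops:
  fixes A :: "'h::chilbert_space operator set"
  assumes "A \<subseteq> bounded_ops"
  shows "stabilization A \<subseteq> bounded_ops"
  unfolding stabilization_eq
proof (rule closure_minimal [OF _ closed_bounded_ops])
  show "stable_sums A \<subseteq> bounded_ops"
    using assms by (auto simp: stable_sums_def compact_ops_def intro!: sum_bounded_ops op_tensor_bounded_ops)
qed

lemma fin_approx_stabilization:
  fixes w :: "(nat, ('g::group_add, ('g, 'h::chilbert_space) l2) l2) l2 operator"
  assumes w: "w \<in> stabilization roe_algebra" and D: "finite D"
  shows "fin_approx (stable_supp D) w"
proof (rule fin_approx_closure [OF w [unfolded stabilization_eq]])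
  fix y :: "(nat, ('g, ('g, 'h) l2) l2) l2 operator"
  assume "y \<in> stable_sums roe_algebra"
  then obtain n :: nat and a k where ak: "\<forall>i<n. a i \<in> roe_algebra \<and> k i \<in> compact_ops"
    and y: "y = (\<Sum>i<n. op_tensor (a i) (k i))" unfolding stable_sums_def by blast
  have "blinfun_apply y = (\<lambda>\<Xi>. \<Sum>i<n. op_tensor (a i) (k i) \<Xi>)"
    unfolding y by (rule ext) (rule blinfun.sum_left)
  moreover have "fin_approx (stable_supp D) \<dots>"
    using ak roe_algebra_bounded_ops
    by (intro fin_approx_sum fin_approx_op_tensor fin_approx_roe_algebra D) auto
  ultimately show "fin_approx (stable_supp D) y" by simp
qed

section \<open>Locality in the stabilisation\<close>

definition stable_local :: "'g::group_add set \<Rightarrow> (nat, ('g, ('k, 'h::complex_inner) l2) l2) l2 operator \<Rightarrow> bool"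
  where "stable_local F T \<longleftrightarrow> (\<forall>D. left_invariant F D \<longrightarrow> (\<forall>\<Xi>\<in>stable_supp D. T \<Xi> \<in> stable_supp D))"

definition stable_approx_local :: "(nat, ('g::group_add, ('k, 'h::complex_inner) l2) l2) l2 operator \<Rightarrow> bool"
  where "stable_approx_local w \<longleftrightarrow> (\<forall>\<delta>>0. \<exists>F w0. finite F \<and> norm (w - w0) < \<delta> \<and> stable_local F w0)"

lemma left_invariant_Un: "left_invariant (F \<union> F') D \<longleftrightarrow> left_invariant F D \<and> left_invariant F' D"
  unfolding left_invariant_def by (meson Un_iff)

lemma stable_approx_local_zero: "stable_approx_local 0"
  unfolding stable_approx_local_def stable_local_def
  by (intro allI impI exI [of _ "{}"] exI [of _ 0]) (simp add: subspace_0 [OF subspace_stable_supp])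

lemma stable_approx_local_diff:
  assumes "stable_approx_local u" "stable_approx_local w"
  shows "stable_approx_local (u - w)"
  unfolding stable_approx_local_def
proof (intro allI impI)
  fix \<delta> :: real assume "\<delta> > 0"
  then have d: "\<delta> / 2 > 0" by simp
  obtain F u0 where u0: "finite F" "norm (u - u0) < \<delta> / 2"
      "stable_local F u0"
    using assms(1) d unfolding stable_approx_local_def by blast
  obtain F' w0 where w0: "finite F'" "norm (w - w0) < \<delta> / 2"
      "stable_local F' w0"
    using assms(2) d unfolding stable_approx_local_def by blast
  have "norm (u - w - (u0 - w0)) < \<delta>"
    using norm_triangle_ineq4 [of "u - u0" "w - w0"] u0(2) w0(2) by (simp add: algebra_simps)
  moreover have "stable_local (F \<union> F') (u0 - w0)"
    using u0(3) w0(3) unfolding stable_local_def blinfun.diff_left left_invariant_Un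
    by (auto intro!: subspace_diff [OF subspace_stable_supp])
  ultimately show "\<exists>F w0. finite F \<and> norm (u - w - w0) < \<delta> \<and> stable_local F w0"
    using u0(1) w0(1) by (intro exI [of _ "F \<union> F'"] exI [of _ "u0 - w0"]) auto
qed

lemma stable_approx_local_add:
  assumes "stable_approx_local u" "stable_approx_local w"
  shows "stable_approx_local (u + w)"
  using stable_approx_local_diff [OF assms(1) stable_approx_local_diff [OF stable_approx_local_zero assms(2)]]
  by simp

lemma stable_approx_local_sum:
  "(\<And>i. i \<in> I \<Longrightarrow> stable_approx_local (w i)) \<Longrightarrow> stable_approx_local (\<Sum>i\<in>I. w i)"
  by (induction I rule: infinite_finite_induct)
    (auto intro: stable_approx_local_zero stable_approx_local_add)

text \<open>Only \<open>a\<close> has to be approximated, since \<open>k\<close> acts across the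
  copies and respects every support exactly.\<close>

lemma stable_approx_local_op_tensor:
  fixes a :: "('g::group_add, ('k, 'h::chilbert_space) l2) l2 operator"
    and k :: "(nat, complex) l2 operator"
  assumes a: "approx_local a" and k: "k \<in> bounded_ops"
  shows "stable_approx_local (op_tensor a k)"
  unfolding stable_approx_local_def
proof (intro allI impI)
  have ab: "a \<in> bounded_ops" using a by (simp add: approx_local_def)
  fix \<delta> :: real assume "\<delta> > 0"
  then have "\<delta> / (norm k + 1) > 0" by (simp add: add_nonneg_pos)
  then obtain F b where b: "finite F" "b \<in> bounded_ops" "local_op F b" "norm (a - b) < \<delta> / (norm k + 1)"
    using a unfolding approx_local_def by blast
  have "norm (op_tensor a k - op_tensor b k) \<le> norm k * norm (a - b)"
    by (rule norm_op_tensor_diff_le [OF ab b(2) k])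
  also have "\<dots> \<le> (norm k + 1) * norm (a - b)" by (intro mult_right_mono) auto
  also have "\<dots> < \<delta>"
    using b(4) norm_ge_zero [of k] by (simp add: pos_less_divide_eq add_nonneg_pos mult.commute)
  finally have "norm (op_tensor a k - op_tensor b k) < \<delta>" .
  moreover have "diag_op (\<lambda>_. b) \<Xi> \<in> stable_supp D"
    if "left_invariant F D" "\<Xi> \<in> stable_supp D" for D \<Xi>
    using that local_opD [OF b(3)] by (simp add: stable_supp_def diag_op_const_apply)
  then have "stable_local F (op_tensor b k)"
    by (simp add: stable_local_def op_tensor_eq [OF b(2) k] tensor_one_stable_supp [OF k])
  ultimately show "\<exists>F w0. finite F \<and> norm (op_tensor a k - w0) < \<delta> \<and> stable_local F w0"
    using b(1) by blast
qed

lemma stable_approx_local_stabilization: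
  fixes w :: "(nat, ('g::group_add, ('g, 'h::chilbert_space) l2) l2) l2 operator"
  assumes "w \<in> stabilization roe_algebra"
  shows "stable_approx_local w"
  unfolding stable_approx_local_def
proof (intro allI impI)
  fix \<delta> :: real assume "\<delta> > 0"
  then have d: "\<delta> / 2 > 0" by simp
  then obtain y where y: "y \<in> stable_sums roe_algebra" "dist y w < \<delta> / 2"
    using assms unfolding stabilization_eq closure_approachable by blast
  have "stable_approx_local y"
    using y(1) unfolding stable_sums_def
    by (auto simp: compact_ops_def intro!: stable_approx_local_sum stable_approx_local_op_tensor approx_local_roe_algebra)
  then obtain F w0 where w0: "finite F" "norm (y - w0) < \<delta> / 2"
      "stable_local F w0"
    using d unfolding stable_approx_local_def by blast
  have "norm (w - w0) < \<delta>"
    using norm_triangle_ineq [of "w - y" "y - w0"] w0(2) y(2) by (simp add: dist_norm norm_minus_commute)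
  then show "\<exists>F w0. finite F \<and> norm (w - w0) < \<delta> \<and> stable_local F w0"
    using w0 by blast
qed

section \<open>Stable finiteness\<close>

text \<open>If \<open>p\<close> were equivalent to \<open>q < p\<close> via \<open>v\<close>, then approximating \<open>v\<close> and \<open>e = p - q\<close> by \<open>v\<^sub>0\<close> and \<open>e\<^sub>0\<close>
  supported on a finite subgroup yields a block \<open>L\<close> invariant under both. A subspace of \<open>L\<close> of maximal
  dimension on which \<open>p\<close> is close to the identity could be enlarged: replace \<open>V\<close> by \<open>v\<^sub>0 V + \<real> e\<^sub>0 x\<close>.\<close>

lemma no_infinite_projection:
  fixes p :: "(nat, ('g::group_add, ('g, 'h::chilbert_space) l2) l2) l2 operator"
  assumes lf: "locally_finite_group TYPE('g)"
  shows "\<not> infinite_projection (stabilization roe_algebra) p"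
proof
  let ?A = "stabilization roe_algebra :: (nat, ('g, ('g, 'h) l2) l2) l2 operator set"
  have Ab: "?A \<subseteq> bounded_ops" by (rule stabilization_bounded_ops [OF roe_algebra_bounded_ops])
  assume "infinite_projection ?A p"
  then obtain q v where pq: "p \<in> projections ?A" "q \<in> projections ?A" "p o\<^sub>L q = q" "q \<noteq> p"
    and v: "v \<in> ?A" "adj v o\<^sub>L v = p" "v o\<^sub>L adj v = q"
    by (auto simp: infinite_projection_def murray_von_neumann_equiv_def)
  have mem: "p \<in> ?A" "q \<in> ?A" using pq by (auto simp: projections_def)
  have bd: "p \<in> bounded_ops" "q \<in> bounded_ops" "v \<in> bounded_ops" using mem v(1) Ab by auto
  have sym: "inner (p x) y = inner x (p y)" "inner (q x) y = inner x (q y)" for x y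
    using inner_adj [OF bd(1)] inner_adj [OF bd(2)] pq(1,2) by (auto simp: projections_def)
  have pp: "p (p x) = p x" for x
    using pq(1) by (metis (mono_tags, lifting) projections_def mem_Collect_eq blinfun_apply_blinfun_compose)
  have pq': "p (q x) = q x" for x using pq(3) by (metis blinfun_apply_blinfun_compose)
  have qp: "q (p x) = q x" for x
    by (rule cinner_eqI) (metis sym pq')
  have vv: "adj v (v x) = p x" "v (adj v x) = q x" for x
    using v(2,3) by (metis blinfun_apply_blinfun_compose)+
  define e where "e = p - q"
  have e: "e x = p x - q x" for x by (simp add: e_def blinfun.diff_left)
  have esym: "inner (e x) y = inner x (e y)" for x y by (simp add: e inner_diff_left inner_diff_right sym)
  have pe: "p (e x) = e x" for x by (simp add: e blinfun.diff_right pp pq')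
  have nv: "norm (v x) = norm (p x)" for x
  proof -
    have "(norm (v x))\<^sup>2 = (norm (p x))\<^sup>2"
      using inner_adj [OF bd(3), of x "v x"] sym(1) [of x "p x"] by (simp add: power2_norm_eq_inner vv pp inner_commute)
    then show ?thesis by (simp add: power2_eq_iff_nonneg)
  qed
  have pv: "p (v x) = v x" and ev: "e (v x) = 0" for x
  proof -
    \<comment> \<open>\<open>v\<close> vanishes on the kernel of \<open>p\<close>, hence v = v p = q
      v. Its range therefore lies in that of \<open>q\<close>, which \<open>e\<close>
      annihilates.\<close>
    have "norm (v (x - p x)) = 0" unfolding nv by (simp add: blinfun.diff_right pp)
    then have "v x = v (p x)" by (simp add: blinfun.diff_right)
    also have "\<dots> = q (v x)" by (simp add: vv(1) [symmetric] vv(2))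
    finally have qv: "q (v x) = v x" by simp
    then show "p (v x) = v x" by (metis pq')
    then show "e (v x) = 0" by (simp add: e qv)
  qed
  have p_contr: "norm (x - p x) \<le> norm x" for x
  proof -
    have "inner (x - p x) (p x) = 0" by (simp add: inner_diff_left sym pp)
    then have "(norm x)\<^sup>2 = (norm (x - p x))\<^sup>2 + (norm (p x))\<^sup>2"
      using norm_add_sq_orthogonal [of "x - p x" "p x"] by simp
    then have "(norm (x - p x))\<^sup>2 \<le> (norm x)\<^sup>2" by simp
    then show ?thesis by (rule power2_le_imp_le) simp
  qed

  \<comment> \<open>A vector at a single site not annihilated by \<open>e\<close> is needed, so that
    a finite orbit can be built around it.\<close>
  have "\<exists>n t s h. e (l2_single n (l2_single t (l2_single s h))) \<noteq> 0"
  proof (rule ccontr)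
    assume "\<not> ?thesis"
    then have z: "inner (e \<xi>) (l2_single n (l2_single t (l2_single s h))) = 0" for \<xi> n t s h
      by (simp add: esym)
    have "l2_apply (l2_apply (l2_apply (e \<xi>) n) t) s = 0" for \<xi> n t s
      using z [of \<xi> n t s "l2_apply (l2_apply (l2_apply (e \<xi>) n) t) s"] by (simp add: inner_l2_single)
    then have "e \<xi> = 0" for \<xi> by (intro l2_eqI) simp
    then show False using pq(4) by (auto simp: e intro: blinfun_eqI)
  qed
  then obtain n t s h where ne: "e (l2_single n (l2_single t (l2_single s h))) \<noteq> 0" by blast
  define x where "x = l2_single n (l2_single t (l2_single s h))"
  define \<kappa> where "\<kappa> = norm (e x)"
  have \<kappa>: "\<kappa> > 0" using ne by (simp add: \<kappa>_def x_def)

  \<comment> \<open>For \<open>a\<close> in \<open>span B\<close> below, \<open>norm a\<close> is at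
    most twice \<open>norm (v a)\<close>, so this tolerance becomes the error 1/20 relative to
    \<open>norm u\<close>.\<close>
  obtain F1 v0 where v0: "finite F1" "norm (v - v0) < 1 / 40"
      "\<And>D \<Xi>. left_invariant F1 D \<Longrightarrow> \<Xi> \<in> stable_supp D \<Longrightarrow> v0 \<Xi> \<in> stable_supp D"
    using stable_approx_local_stabilization [OF v(1)] unfolding stable_approx_local_def stable_local_def
    by (metis zero_less_divide_1_iff zero_less_numeral)
  have "stable_approx_local e"
    unfolding e_def by (intro stable_approx_local_diff stable_approx_local_stabilization mem)
  \<comment> \<open>Chosen so that \<open>e0 x\<close> is within \<kappa>/40 of \<open>e x\<close>,
    whose norm is \<kappa>.\<close>
  moreover have "\<kappa> / (40 * (norm x + 1)) > 0" using \<kappa> by (simp add: add_nonneg_pos)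
  ultimately obtain F2 e0 where e0: "finite F2" "norm (e - e0) < \<kappa> / (40 * (norm x + 1))"
      "\<And>D \<Xi>. left_invariant F2 D \<Longrightarrow> \<Xi> \<in> stable_supp D \<Longrightarrow> e0 \<Xi> \<in> stable_supp D"
    unfolding stable_approx_local_def stable_local_def by metis
  define G where "G = generated_subgroup (F1 \<union> F2)"
  have finG: "finite G" using lf v0(1) e0(1) by (simp add: G_def locally_finite_group_def)
  \<comment> \<open>The orbit of the site of \<open>x\<close>: finite, and invariant under the
    propagation of both \<open>v0\<close> and \<open>e0\<close>.\<close>
  define D where "D = (\<lambda>g. (g + t, s)) ` G"
  have "left_invariant (F1 \<union> F2) D"
    unfolding left_invariant_def
  proof (intro ballI allI impI)
    fix f a b assume f: "f \<in> F1 \<union> F2" and "(a, b) \<in> D"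
    then obtain g where g: "g \<in> G" "a = g + t" "b = s" by (auto simp: D_def)
    have "f + g \<in> G"
      using subsetD [OF generated_subgroup_props(1) f] g(1) unfolding G_def
      by (rule generated_subgroup_props(3))
    then show "(f + a, b) \<in> D"
      unfolding D_def by (rule rev_image_eqI) (simp add: g(2,3) add.assoc)
  qed
  then have inv: "left_invariant F1 D" "left_invariant F2 D" by (simp_all add: left_invariant_Un)
  define L where "L = (stable_supp D :: (nat, ('g, ('g, 'h) l2) l2) l2 set)"
  have L: "subspace L" unfolding L_def by (rule subspace_stable_supp)
  have "(t, s) \<in> D" unfolding D_def G_def using generated_subgroup_props(2) by (intro image_eqI [of _ _ 0]) auto
  then have xL: "x \<in> L" by (auto simp: L_def stable_supp_def supp_space_def x_def)
  have v0L: "v0 y \<in> L" if "y \<in> L" for y using that v0(3) [OF inv(1)] by (simp add: L_def)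
  have e0L: "e0 x \<in> L" using xL e0(3) [OF inv(2)] by (simp add: L_def)

  define Q where "Q B \<longleftrightarrow> independent B \<and> finite B \<and> span B \<subseteq> L \<and>
    (\<forall>y\<in>span B. norm (y - p y) \<le> 1 / 2 * norm y)" for B
  have "fin_approx L p"
    unfolding L_def using finG by (intro fin_approx_stabilization mem) (simp add: D_def)
  then obtain m where m: "\<And>B. Q B \<Longrightarrow> card B \<le> m"
    using fin_approx_card_bound [of L p] unfolding Q_def by blast
  have "Q {}" using subspace_0 [OF L] by (simp add: Q_def independent_empty)
  then obtain B where B: "Q B" and max: "\<And>B'. Q B' \<Longrightarrow> card B' \<le> card B"
    using ex_has_greatest_nat [of Q "{}" card "Suc m"] m by (metis le_imp_less_Suc)

  \<comment> \<open>One estimate with three uses: it keeps the enlarged span close to the range of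
    \<open>p\<close>; with c = 0 it makes \<open>v0\<close> injective on \<open>span B\<close>; with
    c = 1 it separates \<open>e0 x\<close> from the image. The reason is that \<open>z\<close> is
    close to the exact vector \<open>u = v a + c *\<^sub>R e x\<close>, which \<open>p\<close>
    fixes.\<close>
  have key: "norm (z - p z) \<le> 1 / 2 * norm z \<and> (z = 0 \<longrightarrow> a = 0 \<and> c = 0)"
    if a: "a \<in> span B" and z: "z = v0 a + c *\<^sub>R e0 x" for a c z
  proof -
    define u where "u = v a + c *\<^sub>R e x"
    have pu: "p u = u" by (simp add: u_def blinfun.bilinear_simps pv pe)
    \<comment> \<open>The ranges of \<open>v\<close> and \<open>e\<close> are orthogonal, so neither
      part of \<open>u\<close> can be cancelled by the other.\<close>
    have "inner (v a) (c *\<^sub>R e x) = 0" using esym [of "v a" x] by (simp add: ev)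
    then have nu: "(norm u)\<^sup>2 = (norm (v a))\<^sup>2 + (norm (c *\<^sub>R e x))\<^sup>2"
      unfolding u_def by (rule norm_add_sq_orthogonal)
    then have "(norm (v a))\<^sup>2 \<le> (norm u)\<^sup>2" "(norm (c *\<^sub>R e x))\<^sup>2 \<le> (norm u)\<^sup>2"
      by (simp_all add: nu)
    then have le: "norm (v a) \<le> norm u" "norm (c *\<^sub>R e x) \<le> norm u"
      by (auto intro: power2_le_imp_le)
    have "norm a \<le> norm (a - p a) + norm (p a)" using norm_triangle_ineq [of "a - p a" "p a"] by simp
    also have "norm (a - p a) \<le> 1 / 2 * norm a" using B a by (simp add: Q_def)
    finally have na: "norm a \<le> 2 * norm (v a)" by (simp add: nv)
    have 1: "norm (v0 a - v a) \<le> 1 / 20 * norm u"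
      using blinfun_norm_le [of "v - v0" "1 / 40" a] v0(2) na le(1)
      by (simp add: blinfun.diff_left norm_minus_commute)
    have "norm (e0 x - e x) \<le> norm (e - e0) * norm x"
      using norm_blinfun [of "e0 - e" x] by (simp add: blinfun.diff_left norm_minus_commute)
    also have "\<dots> \<le> \<kappa> / (40 * (norm x + 1)) * (norm x + 1)"
      using e0(2) \<kappa> by (intro mult_mono) auto
    also have "\<dots> = \<kappa> / 40" using norm_ge_zero [of x] by (simp add: add_nonneg_eq_0_iff field_simps)
    finally have "\<bar>c\<bar> * norm (e0 x - e x) \<le> \<bar>c\<bar> * (\<kappa> / 40)" by (rule mult_left_mono) simp
    then have 2: "norm (c *\<^sub>R (e0 x - e x)) \<le> 1 / 40 * norm u"
      using le(2) by (simp add: \<kappa>_def)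
    have "z - u = (v0 a - v a) + c *\<^sub>R (e0 x - e x)" by (simp add: z u_def scaleR_diff_right)
    then have "norm (z - u) \<le> norm (v0 a - v a) + norm (c *\<^sub>R (e0 x - e x))"
      by (simp only: norm_triangle_ineq)
    \<comment> \<open>1/20 + 1/40 is below 1/10. Then \<open>norm u\<close> is at most 10/9 of
      \<open>norm z\<close>, and \<open>p\<close> moves \<open>z\<close> by at most 1/9 of its norm,
      well below the 1/2 required by \<open>Q\<close>.\<close>
    then have zu: "norm (z - u) \<le> 1 / 10 * norm u" using 1 2 norm_ge_zero [of u] by linarith
    have "norm u \<le> norm z + norm (z - u)" using norm_triangle_ineq2 [of u z] by (simp add: norm_minus_commute)
    with zu have uz: "norm u \<le> 10 / 9 * norm z" by simp
    have "z - p z = (z - u) - p (z - u)" by (simp add: blinfun.diff_right pu)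
    then have "norm (z - p z) \<le> norm (z - u)" using p_contr by metis
    then have "norm (z - p z) \<le> 1 / 2 * norm z" using zu uz norm_ge_zero [of z] by linarith
    moreover have "a = 0 \<and> c = 0" if "z = 0"
    proof -
      have "norm u = 0" using uz that by simp
      then have "v a = 0" "c *\<^sub>R e x = 0" using le by (metis norm_le_zero_iff)+
      then show ?thesis using na \<kappa> by (simp add: \<kappa>_def)
    qed
    ultimately show ?thesis by blast
  qed
  have lin: "linear v0" by (rule bounded_linear.linear [OF blinfun.bounded_linear_right])
  have inj: "inj_on v0 (span B)"
  proof (rule inj_onI)
    fix a b assume "a \<in> span B" "b \<in> span B" "v0 a = v0 b"
    then show "a = b" using key [of "a - b" "v0 (a - b)" 0] by (simp add: span_diff blinfun.diff_right)
  qed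
  let ?B = "insert (e0 x) (v0 ` B)"
  have spanv: "span (v0 ` B) = v0 ` span B" by (rule linear_span_image [OF lin])
  have new: "e0 x \<notin> span (v0 ` B)"
  proof
    assume "e0 x \<in> span (v0 ` B)"
    then obtain a where a: "a \<in> span B" "e0 x = v0 a" unfolding spanv by blast
    \<comment> \<open>Here z = v0 (- a) + e0 x = 0 although the coefficient of \<open>e0 x\<close>
      is 1.\<close>
    then show False using key [of "- a" 0 1] by (simp add: span_neg blinfun.minus_right)
  qed
  have "independent (v0 ` B)"
    using B by (intro linear_independent_injective_image [OF lin _ inj]) (simp add: Q_def)
  then have "independent ?B" using new by (rule independent_insertI [rotated])
  moreover have "finite ?B" using B by (simp add: Q_def)
  moreover have "span ?B \<subseteq> L"
  proof (rule span_minimal [OF _ L])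
    show "?B \<subseteq> L" using e0L v0L B span_superset [of B] by (auto simp: Q_def)
  qed
  moreover have "norm (y - p y) \<le> 1 / 2 * norm y" if y: "y \<in> span ?B" for y
  proof -
    obtain c where "y - c *\<^sub>R e0 x \<in> span (v0 ` B)" using y unfolding span_breakdown_eq ..
    then obtain a where "a \<in> span B" "y - c *\<^sub>R e0 x = v0 a" unfolding spanv by blast
    then show ?thesis using key [of a y c] by (simp add: algebra_simps)
  qed
  ultimately have "Q ?B" unfolding Q_def by blast
  then have "card ?B \<le> card B" by (rule max)
  moreover have "card ?B = Suc (card B)"
  proof -
    have "e0 x \<notin> v0 ` B" using new span_base [of "e0 x"] by metis
    moreover have "card (v0 ` B) = card B" by (rule card_image) (rule inj_on_subset [OF inj span_superset])
    ultimately show ?thesis using B by (simp add: Q_def)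
  qed
  ultimately show False by simp
qed

theorem proposition5p5:
  assumes "locally_finite_group TYPE('g::group_add)"
    and "separable_space (euclidean :: 'h::chilbert_space topology)"
    and "\<not> (\<exists>B :: 'h set. finite B \<and> span B = UNIV)"
  shows "stably_finite (roe_algebra :: ('g, ('g, 'h) l2) l2 operator set) \<and>
    (\<forall>p \<in> projections (linf_compact :: ('g, 'h) l2 operator set). p \<noteq> 0 \<longrightarrow>
      (\<exists>\<tau>. lower_semicontinuous_trace (roe_algebra :: ('g, ('g, 'h) l2) l2 operator set) \<tau> \<and>
        \<tau> (regular_rep left_translation p) = 1) \<and>
      (\<exists>\<sigma>. lower_semicontinuous_trace (linf_compact :: ('g, 'h) l2 operator set) \<sigma> \<and>
        (\<forall>s. \<forall>a\<in>pos_cone linf_compact. \<sigma> (left_translation s a) = \<sigma> a) \<and> \<sigma> p = 1))"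
proof (intro conjI ballI impI)
  show "stably_finite (roe_algebra :: ('g, ('g, 'h) l2) l2 operator set)"
    using no_infinite_projection [OF assms(1)] by (auto simp: stably_finite_def)
next
  fix p :: "('g, 'h) l2 operator"
  assume "p \<in> projections linf_compact" "p \<noteq> 0"
  from roe_trace_exists [OF assms(1) this] obtain \<tau> where
    \<tau>: "lower_semicontinuous_trace (roe_algebra :: ('g, ('g, 'h) l2) l2 operator set) \<tau>"
      "lower_semicontinuous_trace (linf_compact :: ('g, 'h) l2 operator set) (\<lambda>a. \<tau> (regular_rep left_translation a))"
      "\<forall>s. \<forall>a\<in>pos_cone (linf_compact :: ('g, 'h) l2 operator set).
        \<tau> (regular_rep left_translation (left_translation s a)) = \<tau> (regular_rep left_translation a)"
      "\<tau> (regular_rep left_translation p) = 1" by blast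
  show "\<exists>\<tau>. lower_semicontinuous_trace (roe_algebra :: ('g, ('g, 'h) l2) l2 operator set) \<tau> \<and>
      \<tau> (regular_rep left_translation p) = 1"
    using \<tau>(1,4) by blast
  show "\<exists>\<sigma>. lower_semicontinuous_trace (linf_compact :: ('g, 'h) l2 operator set) \<sigma> \<and>
      (\<forall>s. \<forall>a\<in>pos_cone linf_compact. \<sigma> (left_translation s a) = \<sigma> a) \<and> \<sigma> p = 1"
    using \<tau>(2-4) by (intro exI [of _ "\<lambda>a. \<tau> (regular_rep left_translation a)"]) simp
qed

end
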